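(* Every $\mathit{LTL}^{\Box\bigcirc}_{\mathit{bool}}$ ontology-mediated instance query (OMIQ) $\boldsymbol q=(\mathcal O,\varkappa)$ is $\mathrm{FO}(\mathrm{RPR})$-rewritable and $\mathrm{MSO}(<)$-rewritable; consequently, answering any such OMIQ (for fixed $\boldsymbol q$: given a data instance $\mathcal A$ and $\ell\in\mathrm{tem}(\mathcal A)$, decide whether $\ell\in\mathrm{ans}(\boldsymbol q,\mathcal A)$) is in $\mathrm{NC}^1$ for data complexity.
   Context: Fix a countably infinite set of atomic concepts. Temporal concepts (LTL-formulas) are given by $\varkappa::=\top\mid A_i\mid\neg\varkappa\mid\varkappa_1\land\varkappa_2\mid\varkappa_1\lor\varkappa_2\mid\bigcirc_F\varkappa\mid\Diamond_F\varkappa\mid\Box_F\varkappa\mid\varkappa_1\,\mathcal U\,\varkappa_2\mid\bigcirc_P\varkappa\mid\Diamond_P\varkappa\mid\Box_P\varkappa\mid\varkappa_1\,\mathcal S\,\varkappa_2$. An interpretation $\mathfrak M$ assigns to each atomic concept $A$ a set $A^{\mathfrak M}\subseteq\mathbb Z$. Extensions: $\top^{\mathfrak M}=\mathbb Z$, Booleans set-theoretically (negation is complement in $\mathbb Z$), $(\bigcirc_F\varkappa)^{\mathfrak M}=\{n\mid n+1\in\varkappa^{\mathfrak M}\}$, $(\Box_F\varkappa)^{\mathfrak M}=\{n\mid k\in\varkappa^{\mathfrak M}\ \forall k>n\}$, $(\Diamond_F\varkappa)^{\mathfrak M}=\{n\mid\exists k>n,\ k\in\varkappa^{\mathfrak M}\}$,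 $(\varkappa_1\,\mathcal U\,\varkappa_2)^{\mathfrak M}=\{n\mid\exists k>n,\ k\in\varkappa_2^{\mathfrak M}\text{ and }m\in\varkappa_1^{\mathfrak M}\text{ for all }n<m<k\}$, and symmetrically for the past operators $\bigcirc_P,\Box_P,\Diamond_P,\mathcal S$. An $\mathit{LTL}^{\Box\bigcirc}_{\mathit{bool}}$ ontology $\mathcal O$ is a finite set of clauses $C_1\land\dots\land C_k\to C_{k+1}\lor\dots\lor C_{k+m}$, $k,m\ge0$ (empty $\land$ is $\top$, empty $\lor$ is $\bot$), where each $C_i$ is a basic temporal concept, i.e. an atomic concept prefixed by a sequence of operators from $\Box_F,\Box_P,\bigcirc_F,\bigcirc_P$. A clause is true in $\mathfrak M$ if $\bigcap_{i\le k}C_i^{\mathfrak M}\subseteq\bigcup_{j=1}^{m}C_{k+j}^{\mathfrak M}$ (empty $\bigcap$ is $\mathbb Z$, empty $\bigcup$ is $\emptyset$); $\mathfrak M$ is a model of $\mathcal O$ if all its clauses are true in $\mathfrak M$. An $\mathit{LTL}^{\Box\bigcirc}_{\mathit{bool}}$ OMIQ is a pair $\boldsymbol q=(\mathcal O,\varkappa)$ with such an ontology $\mathcal O$ and an arbitrary temporal concept $\varkappa$. A data instance $\mathcal A$ is a finite set of ground atoms $A_i(\ell)$, $\ell\in\mathbb Z$; it is assumed throughout that the least integer $\min\mathcal A$ occurring in it is $0$ and the greatest one satisfies $\max\mathcal A\ge1$; $\mathrm{tem}(\mathcal A)=\{n\in\mathbb Z\mid\min\mathcal A\le n\le\max\mathcal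 A\}$. $\mathfrak M$ is a model of $(\mathcal O,\mathcal A)$ if it is a model of $\mathcal O$ and $\ell\in A^{\mathfrak M}$ for all $A(\ell)\in\mathcal A$. $\mathrm{ans}(\boldsymbol q,\mathcal A)=\{\ell\in\mathrm{tem}(\mathcal A)\mid\ell\in\varkappa^{\mathfrak M}\text{ for every model }\mathfrak M\text{ of }(\mathcal O,\mathcal A)\}$. Data complexity: $\boldsymbol q$ is fixed and only the data ($\mathcal A$, $\ell$) is the input. $\mathfrak S_{\mathcal A}$ is the finite first-order structure with domain $\mathrm{tem}(\mathcal A)$ ordered by $<$ in which $A(\ell)$ holds iff $A(\ell)\in\mathcal A$. For a class $\mathcal L$ of formulas, $\boldsymbol q$ is $\mathcal L$-rewritable if there is a constant-free $\mathcal L$-formula $\boldsymbol Q(t)$ with one free variable such that $\mathrm{ans}(\boldsymbol q,\mathcal A)=\{\ell\in\mathrm{tem}(\mathcal A)\mid\mathfrak S_{\mathcal A}\models\boldsymbol Q(\ell)\}$ for every data instance $\mathcal A$. $\mathrm{MSO}(<)$-formulas are built from atoms $A(t)$ and $t<t'$ using the Booleans, first-order quantifiers, and second-order quantifiers $\forall A,\exists A$ over unary predicates. $\mathrm{FO}(\mathrm{RPR})$ extends first-order logic over the unary predicates and the successor relation with relational primitive recursion: if $\Theta_1,\dots,\Theta_n,\Psi$ are $\mathrm{FO}(\mathrm{RPR})$-formulas, one may form $$\big[\,Q_i(\boldsymbol z_i,t)\equiv\Theta_i(\boldsymbol z_i,t,Q_1(\boldsymbol z_1,t-1),\dots,Q_n(\boldsymbol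 z_n,t-1)),\ 1\le i\le n\,\big]\ \Psi(\boldsymbol z,\boldsymbol z_1,\dots,\boldsymbol z_n),$$ where the bracketed part defines the relations $Q_i$ used in $\Psi$ by recursion on $t=0,1,2,\dots$ in $\mathrm{tem}(\mathcal A)$, with all $Q_i(\boldsymbol z_i,-1)$ taken to be false; each relation variable $Q_i$ occurs in only one recursive definition. *)

theory Defs
  imports Complex_Main "HOL-Library.Discrete_Functions"
begin

type_synonym atom = nat

datatype concept =
    CTop
  | CAtom atom
  | CNot concept
  | CAnd concept concept
  | COr concept concept
  | NextF concept
  | DiaF concept
  | BoxF concept
  | Until concept concept
  | NextP concept
  | DiaP concept
  | BoxP concept
  | Since concept concept

type_synonym interp = "atom \<Rightarrow> int set"

primrec ext :: "interp \<Rightarrow> concept \<Rightarrow> int set" where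
  "ext M CTop = UNIV"
| "ext M (CAtom a) = M a"
| "ext M (CNot c) = - ext M c"
| "ext M (CAnd c d) = ext M c \<inter> ext M d"
| "ext M (COr c d) = ext M c \<union> ext M d"
| "ext M (NextF c) = {n. n + 1 \<in> ext M c}"
| "ext M (DiaF c) = {n. \<exists>k>n. k \<in> ext M c}"
| "ext M (BoxF c) = {n. \<forall>k>n. k \<in> ext M c}"
| "ext M (Until c d) = {n. \<exists>k>n. k \<in> ext M d \<and> (\<forall>m. n < m \<and> m < k \<longrightarrow> m \<in> ext M c)}"
| "ext M (NextP c) = {n. n - 1 \<in> ext M c}"
| "ext M (DiaP c) = {n. \<exists>k<n. k \<in> ext M c}"
| "ext M (BoxP c) = {n. \<forall>k<n. k \<in> ext M c}"
| "ext M (Since c d) = {n. \<exists>k<n. k \<in> ext M d \<and> (\<forall>m. k < m \<and> m < n \<longrightarrow> m \<in> ext M c)}"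

inductive basic :: "concept \<Rightarrow> bool" where
  "basic (CAtom a)"
| "basic c \<Longrightarrow> basic (BoxF c)"
| "basic c \<Longrightarrow> basic (BoxP c)"
| "basic c \<Longrightarrow> basic (NextF c)"
| "basic c \<Longrightarrow> basic (NextP c)"

text \<open>The pair \<open>(B, H)\<close> stands for the clause whose left-hand side is the conjunction of \<open>B\<close> and
  whose right-hand side is the disjunction of \<open>H\<close>.\<close>

type_synonym clause = "concept list \<times> concept list"
type_synonym ontology = "clause set"
type_synonym omiq = "ontology \<times> concept"

definition ltl_box_next_bool_ontology :: "ontology \<Rightarrow> bool" where
  "ltl_box_next_bool_ontology Ont \<longleftrightarrow>
     finite Ont \<and> (\<forall>(B, H) \<in> Ont. \<forall>c \<in> set B \<union> set H. basic c)"

definition ltl_box_next_bool_omiq :: "omiq \<Rightarrow> bool" where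
  "ltl_box_next_bool_omiq q \<longleftrightarrow> ltl_box_next_bool_ontology (fst q)"

definition clause_true :: "interp \<Rightarrow> clause \<Rightarrow> bool" where
  "clause_true M C \<longleftrightarrow> (\<Inter>c\<in>set (fst C). ext M c) \<subseteq> (\<Union>c\<in>set (snd C). ext M c)"

type_synonym data = "(atom \<times> int) set"

definition min_data :: "data \<Rightarrow> int" where
  "min_data A = Min (snd ` A)"

definition max_data :: "data \<Rightarrow> int" where
  "max_data A = Max (snd ` A)"

definition data_instance :: "data \<Rightarrow> bool" where
  "data_instance A \<longleftrightarrow> finite A \<and> A \<noteq> {} \<and> min_data A = 0 \<and> max_data A \<ge> 1"

definition tem :: "data \<Rightarrow> int set" where
  "tem A = {min_data A..max_data A}"

definition is_model :: "interp \<Rightarrow> ontology \<Rightarrow> data \<Rightarrow> bool" where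
  "is_model M Ont A \<longleftrightarrow> (\<forall>C\<in>Ont. clause_true M C) \<and> (\<forall>(a, l)\<in>A. l \<in> M a)"

definition ans :: "omiq \<Rightarrow> data \<Rightarrow> int set" where
  "ans q A = {l \<in> tem A. \<forall>M. is_model M (fst q) A \<longrightarrow> l \<in> ext M (snd q)}"

text \<open>The structure of a data instance \<open>A\<close> has domain \<open>tem A\<close> and the following unary predicates.\<close>

definition preds :: "data \<Rightarrow> interp" where
  "preds A = (\<lambda>a. {l. (a, l) \<in> A})"

type_synonym var = nat

text \<open>As in the temporal language, predicate symbols are atomic concepts; a second-order quantifier
  binds a predicate symbol, and the symbols left free are interpreted by the data.\<close>

datatype mso =
    MPred atom var
  | MLess var var
  | MNot mso
  | MAnd mso mso
  | MOr mso mso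
  | MEx var mso
  | MAll var mso
  | MEx2 atom mso
  | MAll2 atom mso

primrec mso_fv :: "mso \<Rightarrow> var set" where
  "mso_fv (MPred a x) = {x}"
| "mso_fv (MLess x y) = {x, y}"
| "mso_fv (MNot f) = mso_fv f"
| "mso_fv (MAnd f g) = mso_fv f \<union> mso_fv g"
| "mso_fv (MOr f g) = mso_fv f \<union> mso_fv g"
| "mso_fv (MEx x f) = mso_fv f - {x}"
| "mso_fv (MAll x f) = mso_fv f - {x}"
| "mso_fv (MEx2 a f) = mso_fv f"
| "mso_fv (MAll2 a f) = mso_fv f"

primrec mso_sat :: "int set \<Rightarrow> mso \<Rightarrow> interp \<Rightarrow> (var \<Rightarrow> int) \<Rightarrow> bool" where
  "mso_sat D (MPred a x) P v \<longleftrightarrow> v x \<in> P a"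
| "mso_sat D (MLess x y) P v \<longleftrightarrow> v x < v y"
| "mso_sat D (MNot f) P v \<longleftrightarrow> \<not> mso_sat D f P v"
| "mso_sat D (MAnd f g) P v \<longleftrightarrow> mso_sat D f P v \<and> mso_sat D g P v"
| "mso_sat D (MOr f g) P v \<longleftrightarrow> mso_sat D f P v \<or> mso_sat D g P v"
| "mso_sat D (MEx x f) P v \<longleftrightarrow> (\<exists>d\<in>D. mso_sat D f P (v(x := d)))"
| "mso_sat D (MAll x f) P v \<longleftrightarrow> (\<forall>d\<in>D. mso_sat D f P (v(x := d)))"
| "mso_sat D (MEx2 a f) P v \<longleftrightarrow> (\<exists>X\<subseteq>D. mso_sat D f (P(a := X)) v)"
| "mso_sat D (MAll2 a f) P v \<longleftrightarrow> (\<forall>X\<subseteq>D. mso_sat D f (P(a := X)) v)"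

text \<open>Only the value of the single free variable matters, so the assignment may be taken constant.\<close>

definition mso_rewritable :: "omiq \<Rightarrow> bool" where
  "mso_rewritable q \<longleftrightarrow>
     (\<exists>Q t. mso_fv Q = {t} \<and>
        (\<forall>A. data_instance A \<longrightarrow>
           ans q A = {l \<in> tem A. mso_sat (tem A) Q (preds A) (\<lambda>_. l)}))"

text \<open>\<open>RRel Q zs t\<close> is the atom \<open>Q(zs, t)\<close> and \<open>RPrev Q zs t\<close> is the atom \<open>Q(zs, t - 1)\<close>;
  \<open>RSucc s t\<close> says that \<open>t\<close> is the successor of \<open>s\<close>.  In \<open>RRec ds t f\<close> the list \<open>ds\<close> consists of the
  definitions \<open>Q\<^sub>i(zs\<^sub>i, t) \<equiv> g\<^sub>i\<close>, written as triples \<open>(Q\<^sub>i, zs\<^sub>i, g\<^sub>i)\<close>, with common recursion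
  variable \<open>t\<close>; the relations they define are available in \<open>f\<close>.\<close>

type_synonym relvar = nat

datatype rpr =
    RPred atom var
  | REq var var
  | RSucc var var
  | RRel relvar "var list" var
  | RPrev relvar "var list" var
  | RNot rpr
  | RAnd rpr rpr
  | ROr rpr rpr
  | REx var rpr
  | RAll var rpr
  | RRec "(relvar \<times> var list \<times> rpr) list" var rpr

fun rpr_fv :: "rpr \<Rightarrow> var set" where
  "rpr_fv (RPred a x) = {x}"
| "rpr_fv (REq x y) = {x, y}"
| "rpr_fv (RSucc x y) = {x, y}"
| "rpr_fv (RRel R zs x) = insert x (set zs)"
| "rpr_fv (RPrev R zs x) = insert x (set zs)"
| "rpr_fv (RNot f) = rpr_fv f"
| "rpr_fv (RAnd f g) = rpr_fv f \<union> rpr_fv g"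
| "rpr_fv (ROr f g) = rpr_fv f \<union> rpr_fv g"
| "rpr_fv (REx x f) = rpr_fv f - {x}"
| "rpr_fv (RAll x f) = rpr_fv f - {x}"
| "rpr_fv (RRec ds t f) = rpr_fv f \<union> (\<Union>(R, zs, g)\<in>set ds. rpr_fv g - insert t (set zs))"

fun rpr_defined :: "rpr \<Rightarrow> relvar list" where
  "rpr_defined (RNot f) = rpr_defined f"
| "rpr_defined (RAnd f g) = rpr_defined f @ rpr_defined g"
| "rpr_defined (ROr f g) = rpr_defined f @ rpr_defined g"
| "rpr_defined (REx x f) = rpr_defined f"
| "rpr_defined (RAll x f) = rpr_defined f"
| "rpr_defined (RRec ds t f) =
     concat (map (\<lambda>(R, zs, g). R # rpr_defined g) ds) @ rpr_defined f"
| "rpr_defined _ = []"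

text \<open>A scope maps a relation variable to its arity (not counting the recursion argument) and to the
  way in which it may be used: \<open>None\<close> if it is already fully defined, so that \<open>Q(zs, s)\<close> is allowed
  for any variable \<open>s\<close>, and \<open>Some t\<close> inside the definitions of its own recursion on \<open>t\<close>, where only
  \<open>Q(zs, t - 1)\<close> is allowed.  In the latter case \<open>Q\<close> goes out of scope when \<open>t\<close> is bound again.\<close>

type_synonym scope = "relvar \<rightharpoonup> nat \<times> var option"

definition rebind :: "var set \<Rightarrow> scope \<Rightarrow> scope" where
  "rebind X G = (\<lambda>R. case G R of
      Some (k, Some t) \<Rightarrow> if t \<in> X then None else G R
    | _ \<Rightarrow> G R)"

fun rpr_wf :: "scope \<Rightarrow> rpr \<Rightarrow> bool" where
  "rpr_wf G (RPred a x) \<longleftrightarrow> True"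
| "rpr_wf G (REq x y) \<longleftrightarrow> True"
| "rpr_wf G (RSucc x y) \<longleftrightarrow> True"
| "rpr_wf G (RRel R zs x) \<longleftrightarrow> G R = Some (length zs, None)"
| "rpr_wf G (RPrev R zs x) \<longleftrightarrow> G R = Some (length zs, Some x)"
| "rpr_wf G (RNot f) \<longleftrightarrow> rpr_wf G f"
| "rpr_wf G (RAnd f g) \<longleftrightarrow> rpr_wf G f \<and> rpr_wf G g"
| "rpr_wf G (ROr f g) \<longleftrightarrow> rpr_wf G f \<and> rpr_wf G g"
| "rpr_wf G (REx x f) \<longleftrightarrow> rpr_wf (rebind {x} G) f"
| "rpr_wf G (RAll x f) \<longleftrightarrow> rpr_wf (rebind {x} G) f"
| "rpr_wf G (RRec ds t f) \<longleftrightarrow>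
     (\<forall>(R, zs, g)\<in>set ds.
        distinct (t # zs) \<and> rpr_fv g \<subseteq> insert t (set zs) \<and>
        rpr_wf (rebind (insert t (set zs)) G
                  ++ map_of (map (\<lambda>(R', zs', g'). (R', length zs', Some t)) ds)) g) \<and>
     rpr_wf (G ++ map_of (map (\<lambda>(R', zs', g'). (R', length zs', None)) ds)) f"

text \<open>Relation variables denote relations between the tuple of the first arguments and the recursion
  argument.  The function \<open>rpr_stage\<close> computes the simultaneously defined relations at the
  points \<open>0, \<dots>, k - 1\<close>; at all other points, in particular at \<open>-1\<close>, they are false.\<close>

type_synonym relenv = "relvar \<Rightarrow> int list \<Rightarrow> int \<Rightarrow> bool"

definition assign :: "(var \<Rightarrow> int) \<Rightarrow> var list \<Rightarrow> int list \<Rightarrow> var \<Rightarrow> int" where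
  "assign v zs ds = fold (\<lambda>(z, d) w. w(z := d)) (zip zs ds) v"

primrec rpr_stage ::
  "(relvar \<times> var list \<times> ((var \<Rightarrow> int) \<Rightarrow> relenv \<Rightarrow> bool)) list \<Rightarrow> var \<Rightarrow> (var \<Rightarrow> int) \<Rightarrow> relenv
     \<Rightarrow> nat \<Rightarrow> relenv" where
  "rpr_stage ds t v E 0 =
     (\<lambda>R. case map_of ds R of None \<Rightarrow> E R | Some _ \<Rightarrow> (\<lambda>_ _. False))"
| "rpr_stage ds t v E (Suc k) =
     (\<lambda>R. case map_of ds R of
        None \<Rightarrow> E R
      | Some (zs, g) \<Rightarrow> (\<lambda>as s.
          if s = int k
          then length as = length zs \<and> g ((assign v zs as)(t := s)) (rpr_stage ds t v E k)
          else rpr_stage ds t v E k R as s))"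

text \<open>The domain \<open>D\<close> is meant to be an initial segment \<open>{0, \<dots>, N - 1}\<close> of the non-negative integers,
  so that \<open>card D\<close> stages are needed.\<close>

primrec rpr_sat :: "int set \<Rightarrow> interp \<Rightarrow> rpr \<Rightarrow> (var \<Rightarrow> int) \<Rightarrow> relenv \<Rightarrow> bool" where
  "rpr_sat D P (RPred a x) = (\<lambda>v E. v x \<in> P a)"
| "rpr_sat D P (REq x y) = (\<lambda>v E. v x = v y)"
| "rpr_sat D P (RSucc x y) = (\<lambda>v E. v y = v x + 1)"
| "rpr_sat D P (RRel R zs x) = (\<lambda>v E. E R (map v zs) (v x))"
| "rpr_sat D P (RPrev R zs x) = (\<lambda>v E. E R (map v zs) (v x - 1))"
| "rpr_sat D P (RNot f) = (\<lambda>v E. \<not> rpr_sat D P f v E)"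
| "rpr_sat D P (RAnd f g) = (\<lambda>v E. rpr_sat D P f v E \<and> rpr_sat D P g v E)"
| "rpr_sat D P (ROr f g) = (\<lambda>v E. rpr_sat D P f v E \<or> rpr_sat D P g v E)"
| "rpr_sat D P (REx x f) = (\<lambda>v E. \<exists>d\<in>D. rpr_sat D P f (v(x := d)) E)"
| "rpr_sat D P (RAll x f) = (\<lambda>v E. \<forall>d\<in>D. rpr_sat D P f (v(x := d)) E)"
| "rpr_sat D P (RRec ds t f) = (\<lambda>v E.
     rpr_sat D P f v
       (rpr_stage (map (map_prod id (map_prod id (rpr_sat D P))) ds) t v E (card D)))"

definition fo_rpr_rewritable :: "omiq \<Rightarrow> bool" where
  "fo_rpr_rewritable q \<longleftrightarrow>
     (\<exists>Q t. rpr_fv Q = {t} \<and> rpr_wf Map.empty Q \<and> distinct (rpr_defined Q) \<and>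
        (\<forall>A. data_instance A \<longrightarrow>
           ans q A = {l \<in> tem A. rpr_sat (tem A) (preds A) Q (\<lambda>_. l) (\<lambda>_ _ _. False)}))"

text \<open>A circuit is a finite set of gates named by bit strings; its output gate is \<open>[]\<close>.\<close>

type_synonym name = "bool list"

datatype gate =
    GInput nat
  | GConst bool
  | GNot name
  | GAnd name name
  | GOr name name

type_synonym circuit = "name \<rightharpoonup> gate"

text \<open>\<open>False\<close> selects the left (or only) predecessor of a gate, \<open>True\<close> the right one.\<close>

fun gate_pred :: "gate \<Rightarrow> bool \<Rightarrow> name option" where
  "gate_pred (GNot g) False = Some g"
| "gate_pred (GAnd g h) b = Some (if b then h else g)"
| "gate_pred (GOr g h) b = Some (if b then h else g)"
| "gate_pred _ _ = None"

primrec gate_path :: "circuit \<Rightarrow> name \<Rightarrow> bool list \<Rightarrow> name option" where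
  "gate_path C g [] = (if g \<in> dom C then Some g else None)"
| "gate_path C g (b # p) =
     (case C g of None \<Rightarrow> None
      | Some k \<Rightarrow> (case gate_pred k b of None \<Rightarrow> None | Some h \<Rightarrow> gate_path C h p))"

definition circuit_wf :: "nat \<Rightarrow> circuit \<Rightarrow> bool" where
  "circuit_wf n C \<longleftrightarrow>
     finite (dom C) \<and> [] \<in> dom C \<and>
     (\<forall>g k. C g = Some k \<longrightarrow>
        (\<forall>b h. gate_pred k b = Some h \<longrightarrow> h \<in> dom C) \<and> (\<forall>i. k = GInput i \<longrightarrow> i < n))"

text \<open>A bound on the depth entails that the circuit is acyclic.\<close>

definition depth_le :: "circuit \<Rightarrow> nat \<Rightarrow> bool" where
  "depth_le C d \<longleftrightarrow> (\<forall>g p. gate_path C g p \<noteq> None \<longrightarrow> length p \<le> d)"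

inductive gate_val :: "circuit \<Rightarrow> bool list \<Rightarrow> name \<Rightarrow> bool \<Rightarrow> bool" for C w where
  "C g = Some (GInput i) \<Longrightarrow> i < length w \<Longrightarrow> gate_val C w g (w ! i)"
| "C g = Some (GConst b) \<Longrightarrow> gate_val C w g b"
| "C g = Some (GNot h) \<Longrightarrow> gate_val C w h b \<Longrightarrow> gate_val C w g (\<not> b)"
| "C g = Some (GAnd h h') \<Longrightarrow> gate_val C w h b \<Longrightarrow> gate_val C w h' b' \<Longrightarrow> gate_val C w g (b \<and> b')"
| "C g = Some (GOr h h') \<Longrightarrow> gate_val C w h b \<Longrightarrow> gate_val C w h' b' \<Longrightarrow> gate_val C w g (b \<or> b')"

text \<open>Binary notation, least significant bit first.\<close>

fun bits :: "nat \<Rightarrow> bool list" where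
  "bits n = (if n = 0 then [] else odd n # bits (n div 2))"

declare bits.simps [simp del]

text \<open>Deterministic multi-tape machines with states and tape symbols below some \<open>K\<close>.  A transition maps
  the state and the scanned symbols to the new state and, for each tape, the symbol written and the
  head move.  State 0 is initial, 1 is accepting and 2 is rejecting; symbol 0 is the blank.\<close>

type_synonym machine = "nat \<Rightarrow> nat list \<Rightarrow> nat \<times> (nat \<times> int) list"
type_synonym tape = "(int \<Rightarrow> nat) \<times> int"

definition machine_wf :: "nat \<Rightarrow> nat \<Rightarrow> machine \<Rightarrow> bool" where
  "machine_wf k K M \<longleftrightarrow> 3 \<le> K \<and>
     (\<forall>q<K. \<forall>ss. length ss = k \<and> set ss \<subseteq> {..<K} \<longrightarrow>
        fst (M q ss) < K \<and> length (snd (M q ss)) = k \<and>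
        set (snd (M q ss)) \<subseteq> {..<K} \<times> {-1, 0, 1})"

definition machine_step :: "machine \<Rightarrow> nat \<times> tape list \<Rightarrow> nat \<times> tape list" where
  "machine_step M = (\<lambda>(q, ts).
     if q = 1 \<or> q = 2 then (q, ts)
     else case M q (map (\<lambda>(f, h). f h) ts) of
       (q', acts) \<Rightarrow> (q', map2 (\<lambda>(f, h) (s, d). (f(h := s), h + d)) ts acts))"

definition input_tape :: "bool list \<Rightarrow> tape" where
  "input_tape w =
     (\<lambda>j. if 0 \<le> j \<and> j < int (length w) then (if w ! nat j then 2 else 1) else 0, 0)"

definition machine_init :: "nat \<Rightarrow> bool list list \<Rightarrow> nat \<times> tape list" where
  "machine_init k ws = (0, map input_tape (ws @ replicate (k - length ws) []))"

text \<open>The predicate \<open>L n ws\<close> on numbers \<open>n\<close> and \<open>m\<close>-tuples \<open>ws\<close> of words is decidable, given \<open>n\<close> in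
  binary and \<open>ws\<close> on separate tapes, in time logarithmic in \<open>n\<close>.\<close>

definition log_time_decidable :: "nat \<Rightarrow> (nat \<Rightarrow> bool list list \<Rightarrow> bool) \<Rightarrow> bool" where
  "log_time_decidable m L \<longleftrightarrow>
     (\<exists>k K M c. Suc m \<le> k \<and> machine_wf k K M \<and>
        (\<forall>n ws. length ws = m \<longrightarrow>
           fst ((machine_step M ^^ (c * (floor_log n + 1))) (machine_init k (bits n # ws)))
             = (if L n ws then 1 else 2)))"

fun gate_code :: "gate \<Rightarrow> bool list" where
  "gate_code (GInput i) = True # bits i"
| "gate_code (GConst b) = [False, False, False, b]"
| "gate_code (GNot g) = [False, False, True]"
| "gate_code (GAnd g h) = [False, True, False]"
| "gate_code (GOr g h) = [False, True, True]"

text \<open>Ruzzo's uniformity condition \<open>U\<^sub>E\<close>: the extended connection language of the circuit family,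
  i.e. the types of the gates and the gates reached from a given gate along a given path, is
  decidable in deterministic time logarithmic in the input length.\<close>

definition uniform :: "(nat \<Rightarrow> circuit) \<Rightarrow> bool" where
  "uniform C \<longleftrightarrow>
     log_time_decidable 2 (\<lambda>n ws. \<exists>g k. ws = [g, gate_code k] \<and> C n g = Some k) \<and>
     log_time_decidable 3 (\<lambda>n ws. \<exists>g p h. ws = [g, p, h] \<and> gate_path (C n) g p = Some h)"

definition in_NC1 :: "bool list set \<Rightarrow> bool" where
  "in_NC1 L \<longleftrightarrow>
     (\<exists>C c. uniform C \<and>
        (\<forall>n. circuit_wf n (C n) \<and> card (dom (C n)) \<le> n ^ c + c \<and>
             depth_le (C n) (c * (floor_log n + 1)) \<and>
             (\<forall>w. length w = n \<longrightarrow> (gate_val (C n) w [] True \<longleftrightarrow> w \<in> L))))"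

text \<open>Input words for the answering problem: for a finite signature \<open>S\<close>, the structure of a data
  instance over \<open>S\<close> with a distinguished element \<open>l\<close> is written point by point, each point giving the
  truth values of the atoms in \<open>S\<close> followed by a bit that marks \<open>l\<close>.\<close>

definition encode :: "atom list \<Rightarrow> data \<Rightarrow> int \<Rightarrow> bool list" where
  "encode S A l =
     concat (map (\<lambda>t. map (\<lambda>a. (a, t) \<in> A) S @ [t = l]) [min_data A..max_data A])"

definition answering_problem :: "atom list \<Rightarrow> omiq \<Rightarrow> bool list set" where
  "answering_problem S q =
     {encode S A l | A l. data_instance A \<and> fst ` A \<subseteq> set S \<and> l \<in> ans q A}"

definition answering_in_NC1 :: "omiq \<Rightarrow> bool" where
  "answering_in_NC1 q \<longleftrightarrow> (\<forall>S. in_NC1 (answering_problem S q))"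

end

theory Submission
  imports Defs
begin

text \<open>
  The type of a point in an interpretation is the set of subconcepts of the query that hold there.
  Two models that agree on the type of a point can be glued at that point, and gluing preserves
  all other types.  Hence \<open>l\<close> is not an answer iff the points of \<open>tem A\<close> can be labelled by types such
  that neighbouring labels occur at neighbouring points of some model of the ontology, labels contain
  the atoms of the data, and the label of \<open>l\<close> omits the query: the eventualities need no
  treatment of their own.  Such a labelling is guessed by second-order quantifiers, or the set of types
  reachable by partial labellings is computed by recursion, or by a finite automaton.

  For \<open>NC\<^sup>1\<close>, the words accepted by the automaton are recognised by divide and conquer: it passes from
  \<open>s\<close> to \<open>s'\<close> on a block iff it passes from \<open>s\<close> to \<open>r\<close> on the left half and from \<open>r\<close> to \<open>s'\<close> on the
  right half, for some \<open>r\<close>.  Written as a formula this is a tree of logarithmic depth.  If every gate is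
  named by its path from the root, the gate reached from \<open>g\<close> along \<open>p\<close> can only be \<open>g @ p\<close>, and a finite
  control that scans a name and the binary representation of the input length computes the gate's type.
\<close>

section \<open>Gluing models at points of equal type\<close>

text \<open>A labelling of the finitely many points of \<open>tem A\<close> extends to all integers
  at no cost: the model found for the first pair brings its infinite past, the one for the last pair
  its infinite future. Since the query is fixed, the relation between neighbouring types is only
  required to exist as a finite set; it is never computed from the ontology. On the side of
  circuits, uniformity dictates the form. Subformulas are never shared, so that a gate has only one
  path from the root; the tree is still of polynomial size, because a path spends a bounded number
  of gates on each of logarithmically many levels. The number of levels is the number of binary
  digits of the input length, so that a head moving over this number counts them. Such a tree has
  room for more positions than the input has letters, hence the padding; whether a position lies
  inside the input is decided by comparing digits on the way down.\<close>

primrec subconcepts :: "concept \<Rightarrow> concept set" where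
  "subconcepts CTop = {CTop}"
| "subconcepts (CAtom a) = {CAtom a}"
| "subconcepts (CNot c) = insert (CNot c) (subconcepts c)"
| "subconcepts (CAnd c d) = insert (CAnd c d) (subconcepts c \<union> subconcepts d)"
| "subconcepts (COr c d) = insert (COr c d) (subconcepts c \<union> subconcepts d)"
| "subconcepts (NextF c) = insert (NextF c) (subconcepts c)"
| "subconcepts (DiaF c) = insert (DiaF c) (subconcepts c)"
| "subconcepts (BoxF c) = insert (BoxF c) (subconcepts c)"
| "subconcepts (Until c d) = insert (Until c d) (subconcepts c \<union> subconcepts d)"
| "subconcepts (NextP c) = insert (NextP c) (subconcepts c)"
| "subconcepts (DiaP c) = insert (DiaP c) (subconcepts c)"
| "subconcepts (BoxP c) = insert (BoxP c) (subconcepts c)"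
| "subconcepts (Since c d) = insert (Since c d) (subconcepts c \<union> subconcepts d)"

lemma finite_subconcepts: "finite (subconcepts c)"
  by (induction c) auto

lemma self_subconcepts: "c \<in> subconcepts c"
  by (cases c) auto

lemma subconcepts_trans: "d \<in> subconcepts c \<Longrightarrow> subconcepts d \<subseteq> subconcepts c"
  by (induction c) auto

section \<open>Types of points and translation of interpretations\<close>

definition type_at :: "concept set \<Rightarrow> interp \<Rightarrow> int \<Rightarrow> concept set" where
  "type_at \<Phi> M n = {c \<in> \<Phi>. n \<in> ext M c}"

definition subclosed :: "concept set \<Rightarrow> bool" where
  "subclosed \<Phi> \<longleftrightarrow> (\<forall>c\<in>\<Phi>. subconcepts c \<subseteq> \<Phi>)"

lemma ext_cong_atoms:
  assumes "\<And>a. CAtom a \<in> subconcepts c \<Longrightarrow> M a = M' a"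
  shows "ext M c = ext M' c"
  using assms by (induction c) auto

definition shift :: "int \<Rightarrow> interp \<Rightarrow> interp" where
  "shift d M = (\<lambda>a. {n. n + d \<in> M a})"

lemma all_shift: "(\<forall>k. P (k + d)) \<longleftrightarrow> (\<forall>k. P k)" for d :: int
  by (metis diff_add_cancel)

lemma shift_all_gt: "(\<forall>k>n. P (k + d)) \<longleftrightarrow> (\<forall>k>n + d. P k)" for n :: int
  using all_shift[of "\<lambda>k. n + d < k \<longrightarrow> P k" d] by simp

lemma shift_all_lt: "(\<forall>k<n. P (k + d)) \<longleftrightarrow> (\<forall>k<n + d. P k)" for n :: int
  using all_shift[of "\<lambda>k. k < n + d \<longrightarrow> P k" d] by simp

lemma shift_all_between:
  "(\<forall>m. a < m \<and> m < b \<longrightarrow> P (m + d)) \<longleftrightarrow> (\<forall>m. a + d < m \<and> m < b + d \<longrightarrow> P m)" for a :: int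
  using all_shift[of "\<lambda>m. a + d < m \<and> m < b + d \<longrightarrow> P m" d] by simp

lemma ext_shift: "ext (shift d M) c = {n. n + d \<in> ext M c}"
proof (induction c)
  case (BoxF c)
  then show ?case using shift_all_gt[where P = "\<lambda>k. k \<in> ext M c"] by simp
next
  case (BoxP c)
  then show ?case using shift_all_lt[where P = "\<lambda>k. k \<in> ext M c"] by simp
next
  case (DiaF c)
  then show ?case using shift_all_gt[where P = "\<lambda>k. k \<notin> ext M c" and d = d] by simp blast
next
  case (DiaP c)
  then show ?case using shift_all_lt[where P = "\<lambda>k. k \<notin> ext M c" and d = d] by simp blast
next
  case (Until c e)
  have "n \<in> ext (shift d M) (Until c e) \<longleftrightarrow> n + d \<in> ext M (Until c e)" for n
    using shift_all_gt[where n = n and d = d and P = "\<lambda>k. \<not> (k \<in> ext M e \<and> (\<forall>m. n + d < m \<and> m < k \<longrightarrow> m \<in> ext M c))"]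
      shift_all_between[where P = "\<lambda>k. k \<in> ext M c" and d = d]
    by (simp add: Until) blast
  then show ?case by blast
next
  case (Since c e)
  have "n \<in> ext (shift d M) (Since c e) \<longleftrightarrow> n + d \<in> ext M (Since c e)" for n
    using shift_all_lt[where n = n and d = d and P = "\<lambda>k. \<not> (k \<in> ext M e \<and> (\<forall>m. k < m \<and> m < n + d \<longrightarrow> m \<in> ext M c))"]
      shift_all_between[where P = "\<lambda>k. k \<in> ext M c" and d = d]
    by (simp add: Since) blast
  then show ?case by blast
qed (auto simp: shift_def algebra_simps)

lemma type_at_shift: "type_at \<Phi> (shift d M) n = type_at \<Phi> M (n + d)"
  by (simp add: type_at_def ext_shift)

section \<open>Pasting two interpretations at a point of equal type\<close>

definition paste :: "int \<Rightarrow> interp \<Rightarrow> interp \<Rightarrow> interp" where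
  "paste n M M' = (\<lambda>a. {m. if m \<le> n then m \<in> M a else m \<in> M' a})"

lemma type_at_eqD:
  "type_at \<Phi> M n = type_at \<Phi> M' n' \<Longrightarrow> c \<in> \<Phi> \<Longrightarrow> n \<in> ext M c \<longleftrightarrow> n' \<in> ext M' c"
  by (auto simp: type_at_def set_eq_iff)

text \<open>The halves overlap in \<open>n\<close>. This common point carries what an operator
  evaluated on one side needs to know about the other side.\<close>

definition agree :: "int \<Rightarrow> int set \<Rightarrow> int set \<Rightarrow> int set \<Rightarrow> bool" where
  "agree n X X\<^sub>1 X\<^sub>2 \<longleftrightarrow> (\<forall>m\<le>n. m \<in> X \<longleftrightarrow> m \<in> X\<^sub>1) \<and> (\<forall>m\<ge>n. m \<in> X \<longleftrightarrow> m \<in> X\<^sub>2)"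

definition until_set :: "int set \<Rightarrow> int set \<Rightarrow> int set" where
  "until_set X Y = {n. \<exists>k>n. k \<in> Y \<and> (\<forall>m. n < m \<and> m < k \<longrightarrow> m \<in> X)}"

definition since_set :: "int set \<Rightarrow> int set \<Rightarrow> int set" where
  "since_set X Y = {n. \<exists>k<n. k \<in> Y \<and> (\<forall>m. k < m \<and> m < n \<longrightarrow> m \<in> X)}"

text \<open>Seen from the left, everything beyond \<open>n\<close> enters through a single bit, the
  truth of the same until at \<open>n\<close>. This is why equality of types at one point suffices
  for gluing.\<close>

lemma until_set_split:
  assumes "m \<le> n"
  shows "m \<in> until_set X Y \<longleftrightarrow>
    (\<exists>k. m < k \<and> k \<le> n \<and> k \<in> Y \<and> (\<forall>j. m < j \<and> j < k \<longrightarrow> j \<in> X)) \<or>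
    (\<forall>j. m < j \<and> j \<le> n \<longrightarrow> j \<in> X) \<and> n \<in> until_set X Y" (is "?L \<longleftrightarrow> ?A \<or> ?B")
proof
  assume ?L
  then obtain k where k: "k > m" "k \<in> Y" "\<forall>j. m < j \<and> j < k \<longrightarrow> j \<in> X"
    unfolding until_set_def by blast
  show "?A \<or> ?B"
  proof (cases "k \<le> n")
    case True
    with k show ?thesis by blast
  next
    case False
    with k assms have "\<forall>j. m < j \<and> j \<le> n \<longrightarrow> j \<in> X" by auto
    moreover from False k assms have "n \<in> until_set X Y"
      unfolding until_set_def by (auto intro!: exI[of _ k])
    ultimately show ?thesis by blast
  qed
next
  assume "?A \<or> ?B"
  then show ?L
  proof
    assume ?A
    then show ?L unfolding until_set_def by blast
  next
    assume B: ?B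
    then obtain k where k: "k > n" "k \<in> Y" "\<forall>j. n < j \<and> j < k \<longrightarrow> j \<in> X"
      unfolding until_set_def by blast
    from k B have "\<forall>j. m < j \<and> j < k \<longrightarrow> j \<in> X" by (meson not_le)
    moreover from k assms have "k > m" by simp
    ultimately show ?L using k unfolding until_set_def by blast
  qed
qed

lemma agree_until:
  assumes X: "agree n X X\<^sub>1 X\<^sub>2" and Y: "agree n Y Y\<^sub>1 Y\<^sub>2"
    and eq: "n \<in> until_set X\<^sub>1 Y\<^sub>1 \<longleftrightarrow> n \<in> until_set X\<^sub>2 Y\<^sub>2"
  shows "agree n (until_set X Y) (until_set X\<^sub>1 Y\<^sub>1) (until_set X\<^sub>2 Y\<^sub>2)"
proof -
  have right: "m \<in> until_set X Y \<longleftrightarrow> m \<in> until_set X\<^sub>2 Y\<^sub>2" if "m \<ge> n" for m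
  proof -
    have "k \<in> X \<longleftrightarrow> k \<in> X\<^sub>2" "k \<in> Y \<longleftrightarrow> k \<in> Y\<^sub>2" if "k > m" for k
      using X Y \<open>m \<ge> n\<close> that by (simp_all add: agree_def)
    then show ?thesis unfolding until_set_def by blast
  qed
  have "m \<in> until_set X Y \<longleftrightarrow> m \<in> until_set X\<^sub>1 Y\<^sub>1" if "m \<le> n" for m
  proof -
    have "k \<in> X \<longleftrightarrow> k \<in> X\<^sub>1" "k \<in> Y \<longleftrightarrow> k \<in> Y\<^sub>1" if "k \<le> n" for k
      using X Y that by (simp_all add: agree_def)
    then have "(\<exists>k. m < k \<and> k \<le> n \<and> k \<in> Y \<and> (\<forall>j. m < j \<and> j < k \<longrightarrow> j \<in> X)) \<longleftrightarrow>
        (\<exists>k. m < k \<and> k \<le> n \<and> k \<in> Y\<^sub>1 \<and> (\<forall>j. m < j \<and> j < k \<longrightarrow> j \<in> X\<^sub>1))"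
      and "(\<forall>j. m < j \<and> j \<le> n \<longrightarrow> j \<in> X) \<longleftrightarrow> (\<forall>j. m < j \<and> j \<le> n \<longrightarrow> j \<in> X\<^sub>1)"
      by (intro ex_cong1 all_cong1 conj_cong imp_cong refl; simp)+
    \<comment> \<open>The split leaves the until at \<open>n\<close>: the right half replaces it by
      the one for \<open>X\<^sub>2\<close>, and \<open>eq\<close> by the one for
      \<open>X\<^sub>1\<close>.\<close>
    then show ?thesis
      unfolding until_set_split[OF that] right[OF order.refl] eq[symmetric] by (rule arg_cong2)
  qed
  with right show ?thesis by (simp add: agree_def)
qed

lemma all_uminus: "(\<forall>k. P k) \<longleftrightarrow> (\<forall>k. P (- k))" for P :: "int \<Rightarrow> bool"
  by (metis minus_minus)

lemma ex_uminus: "(\<exists>k. P k) \<longleftrightarrow> (\<exists>k. P (- k))" for P :: "int \<Rightarrow> bool"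
  by (metis minus_minus)

text \<open>The past operators are mirror images of the future ones, so gluing is proved only
  once.\<close>

lemma since_set_uminus: "since_set X Y = uminus ` until_set (uminus ` X) (uminus ` Y)"
proof -
  have *: "m \<in> uminus ` Z \<longleftrightarrow> - m \<in> Z" for m :: int and Z by force
  have "n \<in> since_set X Y \<longleftrightarrow> - n \<in> until_set (uminus ` X) (uminus ` Y)" for n
  proof -
    have "n \<in> since_set X Y \<longleftrightarrow> (\<exists>k. k < n \<and> k \<in> Y \<and> (\<forall>m. k < m \<and> m < n \<longrightarrow> m \<in> X))"
      by (simp add: since_set_def)
    also have "\<dots> \<longleftrightarrow> (\<exists>k. - k < n \<and> - k \<in> Y \<and> (\<forall>m. - k < - m \<and> - m < n \<longrightarrow> - m \<in> X))"
      by (subst ex_uminus, subst all_uminus) (rule refl)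
    also have "\<dots> \<longleftrightarrow> (\<exists>k. - n < k \<and> - k \<in> Y \<and> (\<forall>m. - n < m \<and> m < k \<longrightarrow> - m \<in> X))"
    proof -
      have "- k < n \<longleftrightarrow> - n < k" for k by linarith
      then show ?thesis by (simp only: neg_less_iff_less conj_commute)
    qed
    finally show ?thesis by (simp only: until_set_def * mem_Collect_eq)
  qed
  then show ?thesis by (simp only: set_eq_iff * simp_thms)
qed

text \<open>Reflection exchanges the two halves, and with them \<open>X\<^sub>1\<close> and
  \<open>X\<^sub>2\<close>.\<close>

lemma agree_uminus: "agree n X X\<^sub>1 X\<^sub>2 \<longleftrightarrow> agree (- n) (uminus ` X) (uminus ` X\<^sub>2) (uminus ` X\<^sub>1)"
proof -
  have *: "m \<in> uminus ` Z \<longleftrightarrow> - m \<in> Z" for m :: int and Z by force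
  have "(\<forall>m\<le>n. m \<in> X \<longleftrightarrow> m \<in> X\<^sub>1) \<longleftrightarrow> (\<forall>m\<ge>- n. - m \<in> X \<longleftrightarrow> - m \<in> X\<^sub>1)"
    by (subst all_uminus) (simp only: minus_le_iff[of _ n])
  moreover have "(\<forall>m\<ge>n. m \<in> X \<longleftrightarrow> m \<in> X\<^sub>2) \<longleftrightarrow> (\<forall>m\<le>- n. - m \<in> X \<longleftrightarrow> - m \<in> X\<^sub>2)"
    by (subst all_uminus) (simp only: le_minus_iff[of n])
  ultimately show ?thesis by (simp add: agree_def * conj_commute)
qed

lemma agree_since:
  assumes "agree n X X\<^sub>1 X\<^sub>2" and "agree n Y Y\<^sub>1 Y\<^sub>2"
    and "n \<in> since_set X\<^sub>1 Y\<^sub>1 \<longleftrightarrow> n \<in> since_set X\<^sub>2 Y\<^sub>2"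
  shows "agree n (since_set X Y) (since_set X\<^sub>1 Y\<^sub>1) (since_set X\<^sub>2 Y\<^sub>2)"
proof -
  have *: "m \<in> uminus ` Z \<longleftrightarrow> - m \<in> Z" for m :: int and Z by force
  show ?thesis
    using assms agree_until[of "- n" "uminus ` X" "uminus ` X\<^sub>2" "uminus ` X\<^sub>1"
        "uminus ` Y" "uminus ` Y\<^sub>2" "uminus ` Y\<^sub>1"]
    by (simp add: agree_uminus[of n] since_set_uminus * image_image)
qed

lemma agree_Compl: "agree n X X\<^sub>1 X\<^sub>2 \<Longrightarrow> agree n (- X) (- X\<^sub>1) (- X\<^sub>2)"
  by (auto simp: agree_def)

lemma agree_next:
  assumes "agree n X X\<^sub>1 X\<^sub>2" and "n + 1 \<in> X\<^sub>1 \<longleftrightarrow> n + 1 \<in> X\<^sub>2"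
  shows "agree n {m. m + 1 \<in> X} {m. m + 1 \<in> X\<^sub>1} {m. m + 1 \<in> X\<^sub>2}"
proof -
  \<comment> \<open>At \<open>m = n\<close> the successor lies beyond the seam, where
    \<open>X\<close> follows \<open>X\<^sub>2\<close>; the hypothesis on \<open>n + 1\<close> leads
    back to \<open>X\<^sub>1\<close>.\<close>
  have "m + 1 \<in> X \<longleftrightarrow> m + 1 \<in> X\<^sub>1" if "m \<le> n" for m
    using assms that by (cases "m = n") (simp_all add: agree_def)
  with assms show ?thesis by (simp add: agree_def)
qed

lemma agree_prev:
  assumes "agree n X X\<^sub>1 X\<^sub>2" and "n - 1 \<in> X\<^sub>1 \<longleftrightarrow> n - 1 \<in> X\<^sub>2"
  shows "agree n {m. m - 1 \<in> X} {m. m - 1 \<in> X\<^sub>1} {m. m - 1 \<in> X\<^sub>2}"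
proof -
  have "m - 1 \<in> X \<longleftrightarrow> m - 1 \<in> X\<^sub>2" if "m \<ge> n" for m
    using assms that by (cases "m = n") (simp_all add: agree_def)
  with assms show ?thesis by (simp add: agree_def)
qed

lemma agree_UNIV: "agree n UNIV UNIV UNIV"
  by (auto simp: agree_def)

text \<open>Leaves until and since as the only operators of unbounded range for which gluing has to
  be shown.\<close>

lemma ext_until_since:
  "ext M (Until c d) = until_set (ext M c) (ext M d)"
  "ext M (DiaF c) = until_set UNIV (ext M c)"
  "ext M (BoxF c) = - until_set UNIV (- ext M c)"
  "ext M (Since c d) = since_set (ext M c) (ext M d)"
  "ext M (DiaP c) = since_set UNIV (ext M c)"
  "ext M (BoxP c) = - since_set UNIV (- ext M c)"
  by (auto simp: until_set_def since_set_def)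

text \<open>Subconcepts agree by induction. What a temporal operator needs beyond that is its own
  truth value at \<open>n\<close>, and this is the same in both models because \<open>c\<close>
  itself belongs to \<Phi>.\<close>

lemma ext_paste:
  assumes "subclosed \<Phi>" and tp: "type_at \<Phi> M n = type_at \<Phi> M' n" and "c \<in> \<Phi>"
  shows "agree n (ext (paste n M M') c) (ext M c) (ext M' c)"
  using assms(3)
proof (induction c)
  case (CAtom a)
  \<comment> \<open>\<open>paste\<close> takes the point \<open>n\<close> from \<open>M\<close>; for
    atoms in \<Phi> equality of types makes this choice immaterial.\<close>
  have "n \<in> M a \<longleftrightarrow> n \<in> M' a" using type_at_eqD[OF tp CAtom] by simp
  then show ?case by (auto simp: agree_def paste_def order.order_iff_strict)
next
  case (CNot c)
  then have "c \<in> \<Phi>"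
    using assms(1) self_subconcepts by (fastforce simp: subclosed_def)+
  moreover note type_at_eqD[OF tp CNot.prems]
  ultimately show ?case
    using CNot.IH by (auto simp: agree_def)
next
  case (CAnd c d)
  then have "c \<in> \<Phi>" "d \<in> \<Phi>"
    using assms(1) self_subconcepts by (fastforce simp: subclosed_def)+
  moreover note type_at_eqD[OF tp CAnd.prems]
  ultimately show ?case
    using CAnd.IH by (auto simp: agree_def)
next
  case (COr c d)
  then have "c \<in> \<Phi>" "d \<in> \<Phi>"
    using assms(1) self_subconcepts by (fastforce simp: subclosed_def)+
  moreover note type_at_eqD[OF tp COr.prems]
  ultimately show ?case
    using COr.IH by (auto simp: agree_def)
next
  case (NextF c)
  then have "c \<in> \<Phi>"
    using assms(1) self_subconcepts by (fastforce simp: subclosed_def)+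
  moreover note type_at_eqD[OF tp NextF.prems]
  ultimately show ?case
    using NextF.IH by (auto intro!: agree_next)
next
  case (NextP c)
  then have "c \<in> \<Phi>"
    using assms(1) self_subconcepts by (fastforce simp: subclosed_def)+
  moreover note type_at_eqD[OF tp NextP.prems]
  ultimately show ?case
    using NextP.IH by (auto intro!: agree_prev)
next
  case (DiaF c)
  then have "c \<in> \<Phi>"
    using assms(1) self_subconcepts by (fastforce simp: subclosed_def)+
  moreover note type_at_eqD[OF tp DiaF.prems]
  ultimately show ?case
    using DiaF.IH unfolding ext_until_since
    by (intro agree_until agree_UNIV) auto
next
  case (DiaP c)
  then have "c \<in> \<Phi>"
    using assms(1) self_subconcepts by (fastforce simp: subclosed_def)+
  moreover note type_at_eqD[OF tp DiaP.prems]
  ultimately show ?case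
    using DiaP.IH unfolding ext_until_since
    by (intro agree_since agree_UNIV) auto
next
  case (BoxF c)
  then have "c \<in> \<Phi>"
    using assms(1) self_subconcepts by (fastforce simp: subclosed_def)+
  moreover note type_at_eqD[OF tp BoxF.prems]
  ultimately show ?case
    using BoxF.IH unfolding ext_until_since
    by (intro agree_Compl agree_until agree_UNIV) auto
next
  case (BoxP c)
  then have "c \<in> \<Phi>"
    using assms(1) self_subconcepts by (fastforce simp: subclosed_def)+
  moreover note type_at_eqD[OF tp BoxP.prems]
  ultimately show ?case
    using BoxP.IH unfolding ext_until_since
    by (intro agree_Compl agree_since agree_UNIV) auto
next
  case (Until c d)
  then have "c \<in> \<Phi>" "d \<in> \<Phi>"
    using assms(1) self_subconcepts by (fastforce simp: subclosed_def)+
  moreover note type_at_eqD[OF tp Until.prems]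
  ultimately show ?case
    using Until.IH unfolding ext_until_since
    by (intro agree_until) auto
next
  case (Since c d)
  then have "c \<in> \<Phi>" "d \<in> \<Phi>"
    using assms(1) self_subconcepts by (fastforce simp: subclosed_def)+
  moreover note type_at_eqD[OF tp Since.prems]
  ultimately show ?case
    using Since.IH unfolding ext_until_since
    by (intro agree_since) auto
qed (simp add: agree_UNIV)

section \<open>Being a model as a condition on the types that occur\<close>

definition covers :: "concept set \<Rightarrow> ontology \<Rightarrow> bool" where
  "covers \<Phi> Ont \<longleftrightarrow> subclosed \<Phi> \<and> (\<forall>(B, H)\<in>Ont. set B \<union> set H \<subseteq> \<Phi>)"

definition ont_model :: "ontology \<Rightarrow> interp \<Rightarrow> bool" where
  "ont_model Ont M \<longleftrightarrow> (\<forall>C\<in>Ont. clause_true M C)"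

text \<open>A clause is tested at each point separately, so being a model depends only on the set of
  types that occur. Translation and pasting create no new types, hence preserve models.\<close>

lemma ont_model_iff_types:
  assumes "covers \<Phi> Ont"
  shows "ont_model Ont M \<longleftrightarrow>
    (\<forall>n. \<forall>(B, H)\<in>Ont. set B \<subseteq> type_at \<Phi> M n \<longrightarrow> set H \<inter> type_at \<Phi> M n \<noteq> {})"
proof -
  have "clause_true M (B, H) \<longleftrightarrow>
      (\<forall>n. set B \<subseteq> type_at \<Phi> M n \<longrightarrow> set H \<inter> type_at \<Phi> M n \<noteq> {})" if "(B, H) \<in> Ont" for B H
  proof -
    have "set B \<subseteq> \<Phi>" "set H \<subseteq> \<Phi>" using assms that by (auto simp: covers_def)
    then have "set B \<subseteq> type_at \<Phi> M n \<longleftrightarrow> n \<in> (\<Inter>c\<in>set B. ext M c)"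
      and "set H \<inter> type_at \<Phi> M n \<noteq> {} \<longleftrightarrow> n \<in> (\<Union>c\<in>set H. ext M c)" for n
      by (auto simp: type_at_def)
    then show ?thesis by (simp add: clause_true_def subset_iff)
  qed
  then have "(\<forall>C\<in>Ont. clause_true M C) \<longleftrightarrow>
      (\<forall>(B, H)\<in>Ont. \<forall>n. set B \<subseteq> type_at \<Phi> M n \<longrightarrow> set H \<inter> type_at \<Phi> M n \<noteq> {})"
    by (intro ball_cong refl) auto
  then show ?thesis unfolding ont_model_def by blast
qed

lemma ont_model_cong_types:
  assumes "covers \<Phi> Ont" and "\<And>n. \<exists>M' n'. ont_model Ont M' \<and> type_at \<Phi> M n = type_at \<Phi> M' n'"
  shows "ont_model Ont M"
  unfolding ont_model_iff_types[OF assms(1)] using assms(2) ont_model_iff_types[OF assms(1)] by metis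

lemma ont_model_shift: "covers \<Phi> Ont \<Longrightarrow> ont_model Ont M \<Longrightarrow> ont_model Ont (shift d M)"
  by (rule ont_model_cong_types) (auto simp: type_at_shift)

lemma type_at_paste:
  assumes "subclosed \<Phi>" "type_at \<Phi> M n = type_at \<Phi> M' n"
  shows "m \<le> n \<Longrightarrow> type_at \<Phi> (paste n M M') m = type_at \<Phi> M m"
    and "m \<ge> n \<Longrightarrow> type_at \<Phi> (paste n M M') m = type_at \<Phi> M' m"
  using ext_paste[OF assms] by (auto simp: type_at_def agree_def)

lemma ont_model_paste:
  assumes "covers \<Phi> Ont" "type_at \<Phi> M n = type_at \<Phi> M' n" "ont_model Ont M" "ont_model Ont M'"
  shows "ont_model Ont (paste n M M')"
proof (rule ont_model_cong_types[OF assms(1)])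
  fix m
  have sc: "subclosed \<Phi>" using assms(1) by (simp add: covers_def)
  show "\<exists>N n'. ont_model Ont N \<and> type_at \<Phi> (paste n M M') m = type_at \<Phi> N n'"
    using type_at_paste[OF sc assms(2), of m] assms(3,4) by (meson linear)
qed

text \<open>The pairs come from whole models over the integers and not from a local consistency
  condition; eventualities on either side are therefore fulfilled from the outset.\<close>

definition succ_types :: "concept set \<Rightarrow> ontology \<Rightarrow> (concept set \<times> concept set) set" where
  "succ_types \<Phi> Ont = {(type_at \<Phi> M n, type_at \<Phi> M (n + 1)) | M n. ont_model Ont M}"

text \<open>Models are glued at points of equal type, so it is enough to ask for a separate model for each
  pair of neighbouring points.\<close>

lemma model_of_succ_types:
  assumes cov: "covers \<Phi> Ont" and "\<And>t. t < Suc N \<Longrightarrow> (\<rho> t, \<rho> (Suc t)) \<in> succ_types \<Phi> Ont"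
  shows "\<exists>M. ont_model Ont M \<and> (\<forall>t\<le>Suc N. type_at \<Phi> M (int t) = \<rho> t)"
  using assms(2)
proof (induction N)
  case 0
  then obtain M n where M: "ont_model Ont M" "\<rho> 0 = type_at \<Phi> M n" "\<rho> 1 = type_at \<Phi> M (n + 1)"
    by (auto simp: succ_types_def)
  have "type_at \<Phi> (shift n M) (int t) = \<rho> t" if "t \<le> Suc 0" for t
    using M that by (cases t) (auto simp: type_at_shift add.commute)
  with M cov show ?case using ont_model_shift by blast
next
  case (Suc N)
  then obtain M where M: "ont_model Ont M" "\<And>t. t \<le> Suc N \<Longrightarrow> type_at \<Phi> M (int t) = \<rho> t"
    by (metis less_Suc_eq)
  obtain M' n where M': "ont_model Ont M'"
      "\<rho> (Suc N) = type_at \<Phi> M' n" "\<rho> (Suc (Suc N)) = type_at \<Phi> M' (n + 1)"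
    using Suc.prems[of "Suc N"] by (auto simp: succ_types_def)
  \<comment> \<open>\<open>j\<close> is the seam. \<open>M'\<close> is translated so that its first
    relevant point lies at the last point reached by \<open>M\<close>.\<close>
  define j where "j = int (Suc N)"
  define M'' where "M'' = shift (n - j) M'"
  have tp: "type_at \<Phi> M j = type_at \<Phi> M'' j" "type_at \<Phi> M'' (j + 1) = \<rho> (Suc (Suc N))"
    using M(2)[of "Suc N"] M' by (simp_all add: M''_def j_def type_at_shift ac_simps)
  have sc: "subclosed \<Phi>" using cov by (simp add: covers_def)
  have "ont_model Ont (paste j M M'')"
    using ont_model_paste[OF cov tp(1) M(1)] ont_model_shift[OF cov M'(1)] by (simp add: M''_def)
  moreover have "type_at \<Phi> (paste j M M'') (int t) = \<rho> t" if "t \<le> Suc (Suc N)" for t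
  proof (cases "t \<le> Suc N")
    case True
    then show ?thesis using type_at_paste(1)[OF sc tp(1)] M(2) by (simp add: j_def)
  next
    case False
    then have t: "t = Suc (Suc N)" using that by simp
    then have "int t = j + 1" by (simp add: j_def)
    then show ?thesis using type_at_paste(2)[OF sc tp(1), of "j + 1"] tp(2) t by (simp add: add.commute)
  qed
  ultimately show ?case by blast
qed

section \<open>Runs of types as countermodels on the data\<close>

definition is_run ::
  "'a set \<Rightarrow> ('a \<times> 'a) set \<Rightarrow> (nat \<Rightarrow> 'a \<Rightarrow> bool) \<Rightarrow> nat \<Rightarrow> (nat \<Rightarrow> 'a) \<Rightarrow> bool" where
  "is_run T R ok N \<rho> \<longleftrightarrow>
     (\<forall>t\<le>N. \<rho> t \<in> T \<and> ok t (\<rho> t)) \<and> (\<forall>t<N. (\<rho> t, \<rho> (Suc t)) \<in> R)"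

text \<open>The subset construction, for those formalisms that cannot guess a labelling: recursion
  and deterministic automata.\<close>

primrec reach :: "'a set \<Rightarrow> ('a \<times> 'a) set \<Rightarrow> (nat \<Rightarrow> 'a \<Rightarrow> bool) \<Rightarrow> nat \<Rightarrow> 'a set" where
  "reach T R ok 0 = {s \<in> T. ok 0 s}"
| "reach T R ok (Suc t) = {s \<in> T. ok (Suc t) s \<and> (\<exists>r\<in>reach T R ok t. (r, s) \<in> R)}"

lemma reach_iff_run: "s \<in> reach T R ok N \<longleftrightarrow> (\<exists>\<rho>. is_run T R ok N \<rho> \<and> \<rho> N = s)"
proof (induction N arbitrary: s)
  case 0
  show ?case by (auto simp: is_run_def)
next
  case (Suc N)
  show ?case
  proof
    assume "s \<in> reach T R ok (Suc N)"
    then obtain \<rho> where "s \<in> T" "ok (Suc N) s" "is_run T R ok N \<rho>" "(\<rho> N, s) \<in> R"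
      using Suc.IH by auto
    then have "is_run T R ok (Suc N) (\<rho>(Suc N := s))"
      by (auto simp: is_run_def le_Suc_eq less_Suc_eq)
    then show "\<exists>\<rho>. is_run T R ok (Suc N) \<rho> \<and> \<rho> (Suc N) = s" by force
  next
    assume "\<exists>\<rho>. is_run T R ok (Suc N) \<rho> \<and> \<rho> (Suc N) = s"
    then obtain \<rho> where "is_run T R ok (Suc N) \<rho>" "\<rho> (Suc N) = s" by blast
    moreover from this have "is_run T R ok N \<rho>" by (auto simp: is_run_def)
    then have "\<rho> N \<in> reach T R ok N" using Suc.IH by blast
    ultimately show "s \<in> reach T R ok (Suc N)" by (auto simp: is_run_def)
  qed
qed

lemma reach_cong: "(\<And>t s. t \<le> N \<Longrightarrow> ok t s \<longleftrightarrow> ok' t s) \<Longrightarrow> reach T R ok N = reach T R ok' N"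
  by (induction N) auto

lemma reach_subset: "reach T R ok N \<subseteq> T"
  by (cases N) auto

text \<open>The atoms are constrained in one direction only, since models may contain facts beyond
  the data. The query must fail at \<open>l\<close> because a run stands for a countermodel.\<close>

definition admissible :: "concept set \<Rightarrow> concept \<Rightarrow> data \<Rightarrow> int \<Rightarrow> int \<Rightarrow> concept set \<Rightarrow> bool" where
  "admissible \<Phi> \<kappa> A l t \<tau> \<longleftrightarrow>
     (\<forall>a. CAtom a \<in> \<Phi> \<and> (a, t) \<in> A \<longrightarrow> CAtom a \<in> \<tau>) \<and> (t = l \<longrightarrow> \<kappa> \<notin> \<tau>)"

lemma tem_data_instance: "data_instance A \<Longrightarrow> tem A = {0..max_data A}"
  by (simp add: tem_def data_instance_def)

lemma data_in_tem: "data_instance A \<Longrightarrow> (a, t) \<in> A \<Longrightarrow> 0 \<le> t \<and> t \<le> max_data A"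
proof -
  assume A: "data_instance A" "(a, t) \<in> A"
  then have "t \<in> snd ` A" "finite (snd ` A)" by (force simp: data_instance_def)+
  then show ?thesis using A(1) Min_le[of "snd ` A" t] Max_ge[of "snd ` A" t]
    by (auto simp: data_instance_def min_data_def max_data_def)
qed

theorem ans_iff_no_run:
  assumes A: "data_instance A" and l: "l \<in> tem A" and cov: "covers \<Phi> Ont" and \<kappa>: "\<kappa> \<in> \<Phi>"
  shows "l \<in> ans (Ont, \<kappa>) A \<longleftrightarrow>
    \<not> (\<exists>\<rho>. is_run (Pow \<Phi>) (succ_types \<Phi> Ont) (\<lambda>t. admissible \<Phi> \<kappa> A l (int t)) (nat (max_data A)) \<rho>)"
    (is "_ \<longleftrightarrow> \<not> (\<exists>\<rho>. ?run \<rho>)")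
proof -
  have max: "max_data A \<ge> 1" using A by (simp add: data_instance_def)
  \<comment> \<open>With at least two points every label of a run lies in some pair, and so occurs
    in a model; the label of a single point would be subject to no such condition.\<close>
  obtain N where N: "nat (max_data A) = Suc N" using max by (cases "nat (max_data A)") auto
  have sc: "subclosed \<Phi>" using cov by (simp add: covers_def)
  have "(\<exists>M. is_model M Ont A \<and> l \<notin> ext M \<kappa>) \<longleftrightarrow> (\<exists>\<rho>. ?run \<rho>)"
  proof
    assume "\<exists>M. is_model M Ont A \<and> l \<notin> ext M \<kappa>"
    then obtain M where M: "is_model M Ont A" "l \<notin> ext M \<kappa>" by blast
    then have "ont_model Ont M" by (simp add: is_model_def ont_model_def)
    then have "(type_at \<Phi> M (int t), type_at \<Phi> M (int (Suc t))) \<in> succ_types \<Phi> Ont" for t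
      unfolding succ_types_def by (force simp: add.commute)
    moreover have "admissible \<Phi> \<kappa> A l (int t) (type_at \<Phi> M (int t))" for t
      using M by (auto simp: admissible_def is_model_def type_at_def)
    ultimately have "?run (\<lambda>t. type_at \<Phi> M (int t))"
      by (auto simp: is_run_def type_at_def)
    then show "\<exists>\<rho>. ?run \<rho>" by blast
  next
    assume "\<exists>\<rho>. ?run \<rho>"
    then obtain \<rho> where \<rho>: "?run \<rho>" by blast
    then obtain M where M: "ont_model Ont M" "\<And>t. t \<le> Suc N \<Longrightarrow> type_at \<Phi> M (int t) = \<rho> t"
      using model_of_succ_types[OF cov, of N \<rho>] by (auto simp: is_run_def N)
    have M_\<rho>: "type_at \<Phi> M t = \<rho> (nat t) \<and> admissible \<Phi> \<kappa> A l t (\<rho> (nat t))"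
      if "0 \<le> t" "t \<le> max_data A" for t
    proof -
      have "nat t \<le> Suc N" using that N by simp
      then show ?thesis using M(2)[of "nat t"] \<rho> that N by (auto simp: is_run_def)
    qed
    \<comment> \<open>The data may assert atoms outside of \<Phi>, about which types say nothing.
      Making them true everywhere satisfies the data and changes no type.\<close>
    define M' where "M' = (\<lambda>a. if CAtom a \<in> \<Phi> then M a else UNIV)"
    have ext_eq: "ext M' c = ext M c" if "c \<in> \<Phi>" for c
      by (rule ext_cong_atoms) (use sc that in \<open>auto simp: M'_def subclosed_def\<close>)
    then have "type_at \<Phi> M' n = type_at \<Phi> M n" for n by (auto simp: type_at_def)
    with M(1) have "ont_model Ont M'" using ont_model_cong_types[OF cov] by blast
    moreover have "t \<in> M' a" if "(a, t) \<in> A" for a t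
    proof -
      have "CAtom a \<in> \<Phi> \<Longrightarrow> CAtom a \<in> type_at \<Phi> M t"
        using M_\<rho>[of t] data_in_tem[OF A that] that by (auto simp: admissible_def)
      then show ?thesis by (auto simp: M'_def type_at_def)
    qed
    ultimately have "is_model M' Ont A" by (auto simp: is_model_def ont_model_def)
    moreover have "l \<notin> ext M' \<kappa>"
      using M_\<rho>[of l] l \<kappa> ext_eq[OF \<kappa>] tem_data_instance[OF A]
      by (auto simp: admissible_def type_at_def)
    ultimately show "\<exists>M. is_model M Ont A \<and> l \<notin> ext M \<kappa>" by blast
  qed
  with l show ?thesis by (auto simp: ans_def)
qed

corollary ans_iff_reach:
  assumes "data_instance A" "l \<in> tem A" "covers \<Phi> Ont" "\<kappa> \<in> \<Phi>"
  shows "l \<in> ans (Ont, \<kappa>) A \<longleftrightarrow>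
    reach (Pow \<Phi>) (succ_types \<Phi> Ont) (\<lambda>t. admissible \<Phi> \<kappa> A l (int t)) (nat (max_data A)) = {}"
  using ans_iff_no_run[OF assms] by (auto simp: reach_iff_run set_eq_iff)

lemma finite_cover:
  assumes "ltl_box_next_bool_ontology Ont"
  shows "\<exists>\<Phi>. finite \<Phi> \<and> covers \<Phi> Ont \<and> \<kappa> \<in> \<Phi>"
proof -
  define Cs where "Cs = insert \<kappa> (\<Union>(B, H)\<in>Ont. set B \<union> set H)"
  define \<Phi> where "\<Phi> = \<Union> (subconcepts ` Cs)"
  have sub: "Cs \<subseteq> \<Phi>" unfolding \<Phi>_def using self_subconcepts by blast
  have "finite Cs" using assms by (auto simp: Cs_def ltl_box_next_bool_ontology_def)
  then have "finite \<Phi>" by (auto simp: \<Phi>_def finite_subconcepts)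
  moreover have "subclosed \<Phi>" unfolding subclosed_def \<Phi>_def using subconcepts_trans by blast
  moreover have "\<forall>(B, H)\<in>Ont. set B \<union> set H \<subseteq> \<Phi>"
    using sub unfolding Cs_def by blast
  moreover have "\<kappa> \<in> \<Phi>" using sub by (simp add: Cs_def)
  ultimately show ?thesis unfolding covers_def by blast
qed

lemma succ_types_subset: "succ_types \<Phi> Ont \<subseteq> Pow \<Phi> \<times> Pow \<Phi>"
  by (auto simp: succ_types_def type_at_def)

section \<open>Rewritings\<close>

definition mso_true :: mso where
  "mso_true = MAll 1 (MNot (MLess 1 1))"

text \<open>The empty conjunction is a closed formula, so that conjunctions and disjunctions
  introduce no free variable; a rewriting must have exactly one.\<close>

definition mso_conj :: "mso list \<Rightarrow> mso" where
  "mso_conj fs = foldr MAnd fs mso_true"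

definition mso_disj :: "mso list \<Rightarrow> mso" where
  "mso_disj fs = foldr MOr fs (MNot mso_true)"

definition mso_imp :: "mso \<Rightarrow> mso \<Rightarrow> mso" where
  "mso_imp f g = MOr (MNot f) g"

lemma mso_sat_conj: "mso_sat D (mso_conj fs) P v \<longleftrightarrow> (\<forall>f\<in>set fs. mso_sat D f P v)"
  by (induction fs) (auto simp: mso_conj_def mso_true_def)

lemma mso_sat_disj: "mso_sat D (mso_disj fs) P v \<longleftrightarrow> (\<exists>f\<in>set fs. mso_sat D f P v)"
  by (induction fs) (auto simp: mso_disj_def mso_true_def)

lemma mso_sat_imp: "mso_sat D (mso_imp f g) P v \<longleftrightarrow> (mso_sat D f P v \<longrightarrow> mso_sat D g P v)"
  by (auto simp: mso_imp_def)

lemma mso_fv_conj: "mso_fv (mso_conj fs) = (\<Union>f\<in>set fs. mso_fv f)"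
  by (induction fs) (auto simp: mso_conj_def mso_true_def)

lemma mso_fv_disj: "mso_fv (mso_disj fs) = (\<Union>f\<in>set fs. mso_fv f)"
  by (induction fs) (auto simp: mso_disj_def mso_true_def)

lemma mso_fv_imp: "mso_fv (mso_imp f g) = mso_fv f \<union> mso_fv g"
  by (auto simp: mso_imp_def)

lemma mso_sat_Ex2_list:
  "mso_sat D (foldr MEx2 as f) P v \<longleftrightarrow>
     (\<exists>P'. (\<forall>a. a \<notin> set as \<longrightarrow> P' a = P a) \<and> (\<forall>a\<in>set as. P' a \<subseteq> D) \<and> mso_sat D f P' v)"
proof (induction as arbitrary: P)
  case Nil
  have "(\<forall>a. P' a = P a) \<longleftrightarrow> P' = P" for P' by auto
  then show ?case by simp
next
  case (Cons b as)
  show ?case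
  proof
    assume "mso_sat D (foldr MEx2 (b # as) f) P v"
    then obtain X P' where "X \<subseteq> D" "\<forall>a. a \<notin> set as \<longrightarrow> P' a = (P(b := X)) a"
      "\<forall>a\<in>set as. P' a \<subseteq> D" "mso_sat D f P' v"
      by (auto simp: Cons)
    then show "\<exists>P'. (\<forall>a. a \<notin> set (b # as) \<longrightarrow> P' a = P a) \<and>
        (\<forall>a\<in>set (b # as). P' a \<subseteq> D) \<and> mso_sat D f P' v"
      by (intro exI[of _ P']) (cases "b \<in> set as"; auto)
  next
    assume "\<exists>P'. (\<forall>a. a \<notin> set (b # as) \<longrightarrow> P' a = P a) \<and>
        (\<forall>a\<in>set (b # as). P' a \<subseteq> D) \<and> mso_sat D f P' v"
    then obtain P' where P': "\<forall>a. a \<notin> set (b # as) \<longrightarrow> P' a = P a"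
      "\<forall>a\<in>set (b # as). P' a \<subseteq> D" "mso_sat D f P' v" by blast
    \<comment> \<open>\<open>P' b\<close> serves as the outer choice even if \<open>b\<close> occurs
      again in \<open>as\<close>, because the inner quantifier then overwrites it by the same
      set.\<close>
    then have "\<forall>a. a \<notin> set as \<longrightarrow> P' a = (P(b := P' b)) a" by auto
    with P' have "mso_sat D (foldr MEx2 as f) (P(b := P' b)) v"
      unfolding Cons by (intro exI[of _ P']) simp
    moreover have "P' b \<subseteq> D" using P'(2) by simp
    ultimately show "mso_sat D (foldr MEx2 (b # as) f) P v" by auto
  qed
qed

lemma mso_fv_Ex2_list: "mso_fv (foldr MEx2 as f) = mso_fv f"
  by (induction as) auto

definition mso_succ :: "var \<Rightarrow> var \<Rightarrow> var \<Rightarrow> mso" where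
  "mso_succ x y z = MAnd (MLess x y) (MNot (MEx z (MAnd (MLess x z) (MLess z y))))"

lemma mso_sat_succ:
  assumes "z \<noteq> x" "z \<noteq> y" "v x \<in> {0..m}" "v y \<in> {0..m}"
  shows "mso_sat {0..m} (mso_succ x y z) P v \<longleftrightarrow> v y = v x + 1"
proof -
  have "(\<exists>d\<in>{0..m}. v x < d \<and> d < v y) \<longleftrightarrow> v x + 1 < v y"
  proof
    assume "v x + 1 < v y"
    then show "\<exists>d\<in>{0..m}. v x < d \<and> d < v y" using assms(3,4) by (intro bexI[of _ "v x + 1"]) simp_all
  qed auto
  then show ?thesis using assms(1,2) by (auto simp: mso_succ_def)
qed

definition mso_type :: "(concept \<Rightarrow> atom) \<Rightarrow> concept list \<Rightarrow> concept set \<Rightarrow> var \<Rightarrow> mso" where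
  "mso_type p cs \<tau> x = mso_conj (map (\<lambda>c. if c \<in> \<tau> then MPred (p c) x else MNot (MPred (p c) x)) cs)"

lemma mso_sat_type:
  "\<tau> \<subseteq> set cs \<Longrightarrow> mso_sat D (mso_type p cs \<tau> x) P v \<longleftrightarrow> {c \<in> set cs. v x \<in> P (p c)} = \<tau>"
proof -
  assume \<tau>: "\<tau> \<subseteq> set cs"
  have "mso_sat D (mso_type p cs \<tau> x) P v \<longleftrightarrow> (\<forall>c\<in>set cs. v x \<in> P (p c) \<longleftrightarrow> c \<in> \<tau>)"
    unfolding mso_type_def mso_sat_conj set_map ball_simps(9) by (rule ball_cong) auto
  with \<tau> show ?thesis by blast
qed

lemma mso_fv_type: "mso_fv (mso_type p cs \<tau> x) \<subseteq> {x}"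
  by (auto simp: mso_type_def mso_fv_conj split: if_splits)

text \<open>The predicate \<open>p c\<close> marks the points at which the guessed type contains \<open>c\<close>.\<close>

definition mso_run ::
  "(concept \<Rightarrow> atom) \<Rightarrow> concept list \<Rightarrow> (concept set \<times> concept set) list \<Rightarrow> atom list \<Rightarrow> concept \<Rightarrow> mso" where
  "mso_run p cs rs as \<kappa> =
     MAnd (MAll 1 (MAll 2 (mso_imp (mso_succ 1 2 3)
            (mso_disj (map (\<lambda>(\<sigma>, \<tau>). MAnd (mso_type p cs \<sigma> 1) (mso_type p cs \<tau> 2)) rs)))))
    (MAnd (MAll 1 (mso_conj (map (\<lambda>a. mso_imp (MPred a 1) (MPred (p (CAtom a)) 1)) as)))
          (MNot (MPred (p \<kappa>) 0)))"

lemma mso_fv_run: "mso_fv (mso_run p cs rs as \<kappa>) = {0}"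
proof -
  have "mso_fv (mso_disj (map (\<lambda>(\<sigma>, \<tau>). MAnd (mso_type p cs \<sigma> 1) (mso_type p cs \<tau> 2)) rs)) \<subseteq> {1, 2}"
    using mso_fv_type by (fastforce simp: mso_fv_disj)
  then show ?thesis
    by (auto simp: mso_run_def mso_fv_imp mso_fv_conj mso_succ_def)
qed

lemma mso_sat_run:
  assumes rs: "set rs \<subseteq> Pow (set cs) \<times> Pow (set cs)" and l: "v 0 = l"
    and as: "set as = {a. CAtom a \<in> set cs}" and \<kappa>: "\<kappa> \<in> set cs"
    and lm: "0 \<le> l" "l \<le> m"
    and P: "\<And>a t. a \<in> set as \<Longrightarrow> t \<in> P a \<longleftrightarrow> (a, t) \<in> A"
  shows "mso_sat {0..m} (mso_run p cs rs as \<kappa>) P v \<longleftrightarrow>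
    is_run (Pow (set cs)) (set rs) (\<lambda>t. admissible (set cs) \<kappa> A l (int t)) (nat m)
      (\<lambda>t. {c \<in> set cs. int t \<in> P (p c)})"
    (is "_ \<longleftrightarrow> is_run _ _ _ _ ?\<rho>")
proof -
  have pairs: "mso_sat {0..m} (mso_disj (map (\<lambda>(\<sigma>, \<tau>). MAnd (mso_type p cs \<sigma> 1) (mso_type p cs \<tau> 2)) rs)) P w
      \<longleftrightarrow> ({c \<in> set cs. w 1 \<in> P (p c)}, {c \<in> set cs. w 2 \<in> P (p c)}) \<in> set rs" for w
  proof -
    have "mso_sat {0..m} (MAnd (mso_type p cs \<sigma> 1) (mso_type p cs \<tau> 2)) P w
        \<longleftrightarrow> ({c \<in> set cs. w 1 \<in> P (p c)}, {c \<in> set cs. w 2 \<in> P (p c)}) = (\<sigma>, \<tau>)"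
      if "(\<sigma>, \<tau>) \<in> set rs" for \<sigma> \<tau>
    proof -
      have "\<sigma> \<subseteq> set cs" "\<tau> \<subseteq> set cs" using rs that by auto
      then show ?thesis by (simp only: mso_sat.simps mso_sat_type prod.inject)
    qed
    then have "(\<exists>r\<in>set rs. mso_sat {0..m} (case r of (\<sigma>, \<tau>) \<Rightarrow> MAnd (mso_type p cs \<sigma> 1) (mso_type p cs \<tau> 2)) P w)
        \<longleftrightarrow> (\<exists>r\<in>set rs. ({c \<in> set cs. w 1 \<in> P (p c)}, {c \<in> set cs. w 2 \<in> P (p c)}) = r)"
      by (intro bex_cong refl) (simp only: split_paired_all case_prod_conv)
    then show ?thesis unfolding mso_sat_disj set_map bex_simps(7) by blast
  qed
  have all_int: "(\<forall>x\<in>{0..m}. Q x) \<longleftrightarrow> (\<forall>t\<le>nat m. Q (int t))" for Q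
  proof -
    have "Q x" if "\<forall>t\<le>nat m. Q (int t)" "x \<in> {0..m}" for x
      using that(1)[rule_format, of "nat x"] that(2) by (simp add: nat_mono)
    then show ?thesis using lm by (auto simp: le_nat_iff)
  qed
  have "mso_sat {0..m} (MAll 1 (MAll 2 (mso_imp (mso_succ 1 2 3)
            (mso_disj (map (\<lambda>(\<sigma>, \<tau>). MAnd (mso_type p cs \<sigma> 1) (mso_type p cs \<tau> 2)) rs))))) P v
      \<longleftrightarrow> (\<forall>x\<in>{0..m}. \<forall>y\<in>{0..m}. y = x + 1 \<longrightarrow>
            ({c \<in> set cs. x \<in> P (p c)}, {c \<in> set cs. y \<in> P (p c)}) \<in> set rs)"
    unfolding mso_sat.simps mso_sat_imp pairs by (intro ball_cong imp_cong refl) (simp_all add: mso_sat_succ)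
  also have "\<dots> \<longleftrightarrow> (\<forall>t\<le>nat m. \<forall>u\<le>nat m. u = Suc t \<longrightarrow> (?\<rho> t, ?\<rho> u) \<in> set rs)"
  proof -
    have "int u = int t + 1 \<longleftrightarrow> u = Suc t" for t u by linarith
    then show ?thesis unfolding all_int by simp
  qed
  also have "\<dots> \<longleftrightarrow> (\<forall>t<nat m. (?\<rho> t, ?\<rho> (Suc t)) \<in> set rs)"
    by (auto simp: Suc_le_eq)
  finally have 1: "mso_sat {0..m} (MAll 1 (MAll 2 (mso_imp (mso_succ 1 2 3)
            (mso_disj (map (\<lambda>(\<sigma>, \<tau>). MAnd (mso_type p cs \<sigma> 1) (mso_type p cs \<tau> 2)) rs))))) P v
      \<longleftrightarrow> (\<forall>t<nat m. (?\<rho> t, ?\<rho> (Suc t)) \<in> set rs)" .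
  have "mso_sat {0..m} (MAll 1 (mso_conj (map (\<lambda>a. mso_imp (MPred a 1) (MPred (p (CAtom a)) 1)) as))) P v
      \<longleftrightarrow> (\<forall>t\<le>nat m. \<forall>a\<in>set as. int t \<in> P a \<longrightarrow> int t \<in> P (p (CAtom a)))"
    by (simp add: mso_sat_conj mso_sat_imp all_int)
  also have "\<dots> \<longleftrightarrow> (\<forall>t\<le>nat m. \<forall>a. CAtom a \<in> set cs \<and> (a, int t) \<in> A \<longrightarrow> CAtom a \<in> ?\<rho> t)"
    using as P by auto
  finally have 2: "mso_sat {0..m} (MAll 1 (mso_conj (map (\<lambda>a. mso_imp (MPred a 1) (MPred (p (CAtom a)) 1)) as))) P v
      \<longleftrightarrow> (\<forall>t\<le>nat m. \<forall>a. CAtom a \<in> set cs \<and> (a, int t) \<in> A \<longrightarrow> CAtom a \<in> ?\<rho> t)" .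
  have "mso_sat {0..m} (MNot (MPred (p \<kappa>) 0)) P v \<longleftrightarrow> \<kappa> \<notin> ?\<rho> (nat l)"
    using l lm \<kappa> by simp
  also have "\<dots> \<longleftrightarrow> (\<forall>t\<le>nat m. int t = l \<longrightarrow> \<kappa> \<notin> ?\<rho> t)"
  proof -
    have "int t = l \<longleftrightarrow> t = nat l" for t using lm by auto
    then show ?thesis using lm by (simp add: nat_mono)
  qed
  finally have 3: "mso_sat {0..m} (MNot (MPred (p \<kappa>) 0)) P v \<longleftrightarrow> (\<forall>t\<le>nat m. int t = l \<longrightarrow> \<kappa> \<notin> ?\<rho> t)" .
  show ?thesis
    unfolding mso_run_def mso_sat.simps(4) 1 2 3 by (auto simp: is_run_def admissible_def)
qed

text \<open>Second-order variables are atomic concepts themselves. Those used for guessing must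
  avoid the atoms of \<Phi>, since binding one of these would hide the data.\<close>

lemma ex_fresh_atoms:
  assumes "finite \<Phi>"
  shows "\<exists>p :: concept \<Rightarrow> atom. inj_on p \<Phi> \<and> (\<forall>c\<in>\<Phi>. CAtom (p c) \<notin> \<Phi>)"
proof -
  obtain f :: "concept \<Rightarrow> nat" where f: "inj_on f \<Phi>"
    using finite_imp_inj_to_nat_seg[OF assms] by blast
  have "finite (CAtom -` \<Phi>)" by (rule finite_vimageI[OF assms]) (simp add: inj_on_def)
  then obtain b where b: "\<forall>a\<in>CAtom -` \<Phi>. a < b" by (metis finite_nat_set_iff_bounded)
  \<comment> \<open>\<open>b\<close> lies above every atom in \<Phi>, so adding it makes all names
    fresh.\<close>
  have "inj_on (\<lambda>c. b + f c) \<Phi>" using f by (simp add: inj_on_def)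
  moreover have "CAtom (b + f c) \<notin> \<Phi>" for c
    using b[rule_format, of "b + f c"] by auto
  ultimately show ?thesis by (intro exI[of _ "\<lambda>c. b + f c"]) blast
qed

theorem mso_rewritable:
  assumes cov: "covers \<Phi> Ont" and \<kappa>: "\<kappa> \<in> \<Phi>" and fin: "finite \<Phi>"
  shows "mso_rewritable (Ont, \<kappa>)"
proof -
  obtain p :: "concept \<Rightarrow> atom" where p: "inj_on p \<Phi>" "\<And>c. c \<in> \<Phi> \<Longrightarrow> CAtom (p c) \<notin> \<Phi>"
    using ex_fresh_atoms[OF fin] by blast
  obtain cs where cs: "set cs = \<Phi>" using finite_list[OF fin] by blast
  have "finite (succ_types \<Phi> Ont)"
    by (rule finite_subset[OF succ_types_subset]) (simp add: fin)
  from finite_list[OF this] obtain rs where rs: "set rs = succ_types \<Phi> Ont" by blast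
  have "finite (CAtom -` \<Phi>)" by (rule finite_vimageI[OF fin]) (simp add: inj_on_def)
  from finite_list[OF this] obtain as where "set as = CAtom -` \<Phi>" by blast
  then have as: "set as = {a. CAtom a \<in> set cs}" by (simp add: cs vimage_def)
  define Q where "Q = MNot (foldr MEx2 (map p cs) (mso_run p cs rs as \<kappa>))"
  have "l \<in> ans (Ont, \<kappa>) A \<longleftrightarrow> mso_sat (tem A) Q (preds A) (\<lambda>_. l)"
    if A: "data_instance A" and l: "l \<in> tem A" for A l
  proof -
    let ?m = "max_data A"
    let ?run = "is_run (Pow \<Phi>) (succ_types \<Phi> Ont) (\<lambda>t. admissible \<Phi> \<kappa> A l (int t)) (nat ?m)"
    have lm: "0 \<le> l" "l \<le> ?m" using l tem_data_instance[OF A] by auto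
    \<comment> \<open>The equivalence holds only for those \<open>P\<close> that leave the data
      predicates alone, and these are the ones over which the quantifier prefix ranges.\<close>
    have sat: "mso_sat {0..?m} (mso_run p cs rs as \<kappa>) P (\<lambda>_. l) \<longleftrightarrow> ?run (\<lambda>t. {c \<in> \<Phi>. int t \<in> P (p c)})"
      if "\<forall>a. a \<notin> p ` \<Phi> \<longrightarrow> P a = preds A a" for P
    proof -
      have "t \<in> P a \<longleftrightarrow> (a, t) \<in> A" if "a \<in> set as" for a t
      proof -
        have "a \<notin> p ` \<Phi>" using that p(2) as cs by auto
        then show ?thesis using \<open>\<forall>a. a \<notin> p ` \<Phi> \<longrightarrow> P a = preds A a\<close> by (simp add: preds_def)
      qed
      then show ?thesis
        using mso_sat_run[of rs cs "\<lambda>_. l" l as \<kappa> ?m P A p] succ_types_subset[of \<Phi> Ont] as \<kappa> lm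
        by (simp add: cs rs)
    qed
    have "mso_sat (tem A) Q (preds A) (\<lambda>_. l) \<longleftrightarrow>
        \<not> (\<exists>P. (\<forall>a. a \<notin> p ` \<Phi> \<longrightarrow> P a = preds A a) \<and> (\<forall>a\<in>p ` \<Phi>. P a \<subseteq> {0..?m}) \<and>
           ?run (\<lambda>t. {c \<in> \<Phi>. int t \<in> P (p c)}))"
      by (simp only: Q_def mso_sat.simps mso_sat_Ex2_list tem_data_instance[OF A] set_map cs sat
          cong: conj_cong)
    also have "\<dots> \<longleftrightarrow> \<not> (\<exists>\<rho>. ?run \<rho>)"
    proof -
      have "\<exists>P. (\<forall>a. a \<notin> p ` \<Phi> \<longrightarrow> P a = preds A a) \<and> (\<forall>a\<in>p ` \<Phi>. P a \<subseteq> {0..?m}) \<and>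
           ?run (\<lambda>t. {c \<in> \<Phi>. int t \<in> P (p c)})" if \<rho>: "?run \<rho>" for \<rho>
      proof -
        \<comment> \<open>The run is read back into predicates. The bound on \<open>t\<close> keeps
          them inside the domain, as second-order quantification requires, although \<rho> is
          defined on all numbers.\<close>
        define P where "P = (\<lambda>a. if a \<in> p ` \<Phi> then {int t |t. t \<le> nat ?m \<and> inv_into \<Phi> p a \<in> \<rho> t}
                               else preds A a)"
        have "{c \<in> \<Phi>. int t \<in> P (p c)} = \<rho> t" if t: "t \<le> nat ?m" for t
        proof -
          have "int t \<in> P (p c) \<longleftrightarrow> c \<in> \<rho> t" if "c \<in> \<Phi>" for c
            using that t p(1) by (simp add: P_def)
          moreover have "\<rho> t \<subseteq> \<Phi>" using \<rho> t by (simp add: is_run_def)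
          ultimately show ?thesis by blast
        qed
        then have "?run (\<lambda>t. {c \<in> \<Phi>. int t \<in> P (p c)})"
          using \<rho> by (simp add: is_run_def del: of_nat_Suc)
        moreover have "P a \<subseteq> {0..?m}" if "a \<in> p ` \<Phi>" for a
          using that lm by (auto simp: P_def le_nat_iff)
        ultimately show ?thesis by (intro exI[of _ P]) (simp add: P_def)
      qed
      then show ?thesis by blast
    qed
    finally show ?thesis using ans_iff_no_run[OF A l cov \<kappa>] by simp
  qed
  then have "\<forall>A. data_instance A \<longrightarrow>
      ans (Ont, \<kappa>) A = {l \<in> tem A. mso_sat (tem A) Q (preds A) (\<lambda>_. l)}"
    by (auto simp: ans_def)
  moreover have "mso_fv Q = {0}" by (simp add: Q_def mso_fv_Ex2_list mso_fv_run)
  ultimately show ?thesis unfolding mso_rewritable_def by blast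
qed


section \<open>The rewriting by relational primitive recursion\<close>

definition rpr_true :: rpr where
  "rpr_true = RAll 1 (REq 1 1)"

definition rpr_conj :: "rpr list \<Rightarrow> rpr" where
  "rpr_conj fs = foldr RAnd fs rpr_true"

definition rpr_disj :: "rpr list \<Rightarrow> rpr" where
  "rpr_disj fs = foldr ROr fs (RNot rpr_true)"

lemma rpr_sat_conj: "rpr_sat D P (rpr_conj fs) v E \<longleftrightarrow> (\<forall>f\<in>set fs. rpr_sat D P f v E)"
  by (induction fs) (auto simp: rpr_conj_def rpr_true_def)

lemma rpr_sat_disj: "rpr_sat D P (rpr_disj fs) v E \<longleftrightarrow> (\<exists>f\<in>set fs. rpr_sat D P f v E)"
  by (induction fs) (auto simp: rpr_disj_def rpr_true_def)

lemma rpr_fv_conj: "rpr_fv (rpr_conj fs) = (\<Union>f\<in>set fs. rpr_fv f)"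
  by (induction fs) (auto simp: rpr_conj_def rpr_true_def)

lemma rpr_fv_disj: "rpr_fv (rpr_disj fs) = (\<Union>f\<in>set fs. rpr_fv f)"
  by (induction fs) (auto simp: rpr_disj_def rpr_true_def)

lemma rpr_wf_conj: "rpr_wf G (rpr_conj fs) \<longleftrightarrow> (\<forall>f\<in>set fs. rpr_wf G f)"
  by (induction fs) (auto simp: rpr_conj_def rpr_true_def)

lemma rpr_wf_disj: "rpr_wf G (rpr_disj fs) \<longleftrightarrow> (\<forall>f\<in>set fs. rpr_wf G f)"
  by (induction fs) (auto simp: rpr_disj_def rpr_true_def)

lemma rpr_defined_conj: "rpr_defined (rpr_conj fs) = concat (map rpr_defined fs)"
  by (induction fs) (auto simp: rpr_conj_def rpr_true_def)

lemma rpr_defined_disj: "rpr_defined (rpr_disj fs) = concat (map rpr_defined fs)"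
  by (induction fs) (auto simp: rpr_disj_def rpr_true_def)

lemma concat_map_eq_Nil: "concat (map f xs) = [] \<longleftrightarrow> (\<forall>x\<in>set xs. f x = [])"
  by auto

text \<open>In the following formulas the variable 0 is the answer variable and 1 the recursion variable.
  The relation variable \<open>i\<close> says that some run reaches the type \<open>ts ! i\<close>.\<close>

definition rpr_label :: "atom list \<Rightarrow> concept \<Rightarrow> concept set \<Rightarrow> rpr" where
  "rpr_label as \<kappa> \<tau> =
     rpr_conj (map (\<lambda>a. RNot (RPred a 1)) (filter (\<lambda>a. CAtom a \<notin> \<tau>) as)
               @ (if \<kappa> \<in> \<tau> then [RNot (REq 0 1)] else []))"

text \<open>All relations are false at \<open>-1\<close>, which would leave no type reachable. The
  first point is therefore detected by its lack of a predecessor, and there only the label is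
  tested. The answer variable is an argument of the relations because a defining formula may have no
  other free variables than its arguments and the recursion variable.\<close>

definition rpr_rule ::
  "concept set list \<Rightarrow> (concept set \<times> concept set) set \<Rightarrow> atom list \<Rightarrow> concept \<Rightarrow> relvar \<Rightarrow> rpr" where
  "rpr_rule ts R as \<kappa> i =
     RAnd (rpr_label as \<kappa> (ts ! i))
          (ROr (RNot (REx 2 (RSucc 2 1)))
               (rpr_disj (map (\<lambda>j. RPrev j [0] 1) (filter (\<lambda>j. (ts ! j, ts ! i) \<in> R) [0..<length ts]))))"

definition rpr_final :: "nat \<Rightarrow> rpr" where
  "rpr_final r =
     RNot (REx 1 (RAnd (RNot (REx 2 (RSucc 1 2))) (rpr_disj (map (\<lambda>i. RRel i [0] 1) [0..<r]))))"

definition rpr_defs ::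
  "concept set list \<Rightarrow> (concept set \<times> concept set) set \<Rightarrow> atom list \<Rightarrow> concept
    \<Rightarrow> (relvar \<times> var list \<times> rpr) list" where
  "rpr_defs ts R as \<kappa> = map (\<lambda>i. (i, [0], rpr_rule ts R as \<kappa> i)) [0..<length ts]"

lemma rpr_sat_label:
  assumes "set as = {a. CAtom a \<in> \<Phi>}"
  shows "rpr_sat D (preds A) (rpr_label as \<kappa> \<tau>) v E \<longleftrightarrow> admissible \<Phi> \<kappa> A (v 0) (v 1) \<tau>"
proof -
  have "rpr_sat D (preds A) (rpr_label as \<kappa> \<tau>) v E \<longleftrightarrow>
      (\<forall>a\<in>set as. CAtom a \<notin> \<tau> \<longrightarrow> v 1 \<notin> preds A a) \<and> (\<kappa> \<in> \<tau> \<longrightarrow> v 0 \<noteq> v 1)"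
    by (cases "\<kappa> \<in> \<tau>") (simp_all add: rpr_label_def rpr_sat_conj ball_Un, blast+)
  then show ?thesis using assms by (auto simp: admissible_def preds_def)
qed

lemma ex_nth_iff: "(\<exists>i<length xs. Q (xs ! i)) \<longleftrightarrow> (\<exists>x\<in>set xs. Q x)"
  by (metis in_set_conv_nth)

text \<open>The recursion carries out the subset construction: stage \<open>k\<close> knows the
  reachable types at the points below \<open>k\<close>. The bound on \<open>k\<close> keeps the
  predecessor of a newly treated point within the domain.\<close>

lemma rpr_stage_reach:
  assumes as: "set as = {a. CAtom a \<in> \<Phi>}" and ts: "set ts = Pow \<Phi>" and m: "k \<le> Suc m" and i: "i < length ts"
    and ds: "\<And>i. i < length ts \<Longrightarrow>
      map_of ds i = Some ([0], rpr_sat {0..int m} (preds A) (rpr_rule ts R as \<kappa> i))"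
  shows "rpr_stage ds 1 v E k i [l] s
    \<longleftrightarrow> 0 \<le> s \<and> s < int k \<and> ts ! i \<in> reach (Pow \<Phi>) R (\<lambda>t. admissible \<Phi> \<kappa> A l (int t)) (nat s)"
  using m i
proof (induction k arbitrary: i s)
  case 0
  then show ?case by (simp add: ds)
next
  case (Suc k)
  let ?reach = "reach (Pow \<Phi>) R (\<lambda>t. admissible \<Phi> \<kappa> A l (int t))"
  let ?E = "rpr_stage ds 1 v E k"
  let ?v = "(assign v [0] [l])(1 := int k)"
  have v: "assign v [0] [l] 0 = l" by (simp add: assign_def)
  have prev: "?E j [l] (int k - 1) \<longleftrightarrow> 0 < k \<and> ts ! j \<in> ?reach (k - 1)" if "j < length ts" for j
    using Suc.IH[of j "int k - 1"] Suc.prems that by (auto simp: nat_diff_distrib)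
  have first: "(\<exists>d\<in>{0..int m}. int k = d + 1) \<longleftrightarrow> k \<noteq> 0"
  proof
    assume "k \<noteq> 0"
    then show "\<exists>d\<in>{0..int m}. int k = d + 1" using Suc.prems by (intro bexI[of _ "int k - 1"]) auto
  qed auto
  have "rpr_sat {0..int m} (preds A) (rpr_rule ts R as \<kappa> i) ?v ?E \<longleftrightarrow>
      admissible \<Phi> \<kappa> A l (int k) (ts ! i) \<and>
      (k = 0 \<or> (\<exists>j<length ts. (ts ! j, ts ! i) \<in> R \<and> ts ! j \<in> ?reach (k - 1) \<and> 0 < k))"
    using first prev by (auto simp: rpr_rule_def rpr_sat_label[OF as] rpr_sat_disj v)
  also have "\<dots> \<longleftrightarrow> ts ! i \<in> ?reach k"
  proof (cases k)
    case 0
    then show ?thesis using ts Suc.prems nth_mem[of i ts] by auto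
  next
    case k: (Suc k')
    have "(\<exists>j<length ts. (ts ! j, ts ! i) \<in> R \<and> ts ! j \<in> ?reach k') \<longleftrightarrow>
        (\<exists>r\<in>?reach k'. (r, ts ! i) \<in> R)"
      unfolding ex_nth_iff[of ts "\<lambda>r. (r, ts ! i) \<in> R \<and> r \<in> ?reach k'"] ts
      using reach_subset[of "Pow \<Phi>" R _ k'] by blast
    then show ?thesis using k ts Suc.prems nth_mem[of i ts] by auto
  qed
  finally show ?case using ds[of i] Suc.IH[of i s] Suc.prems by auto
qed

theorem fo_rpr_rewritable:
  assumes cov: "covers \<Phi> Ont" and \<kappa>: "\<kappa> \<in> \<Phi>" and fin: "finite \<Phi>"
  shows "fo_rpr_rewritable (Ont, \<kappa>)"
proof -
  have "finite (CAtom -` \<Phi>)" by (rule finite_vimageI[OF fin]) (simp add: inj_on_def)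
  from finite_list[OF this] obtain as where "set as = CAtom -` \<Phi>" by blast
  then have as: "set as = {a. CAtom a \<in> \<Phi>}" by (simp add: vimage_def)
  have "finite (Pow \<Phi>)" using fin by simp
  \<comment> \<open>A type may be listed repeatedly; relation variables are indices into the list
    and so remain distinct.\<close>
  from finite_list[OF this] obtain ts where ts: "set ts = Pow \<Phi>" by blast
  have ne: "ts \<noteq> []" using ts by auto
  define R where "R = succ_types \<Phi> Ont"
  define ds where "ds = rpr_defs ts R as \<kappa>"
  define Q where "Q = RRec ds 1 (rpr_final (length ts))"
  have rule_fv: "rpr_fv (rpr_rule ts R as \<kappa> i) \<subseteq> {0, 1}" for i
    by (auto simp: rpr_rule_def rpr_label_def rpr_fv_conj rpr_fv_disj)
  have "rpr_fv (rpr_final (length ts)) = {0}"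
    using ne by (auto simp: rpr_final_def rpr_fv_disj)
  with rule_fv have fv: "rpr_fv Q = {0}"
    by (fastforce simp: Q_def ds_def rpr_defs_def)
  have scope: "map_of (map (\<lambda>(R', zs', g'). (R', length zs', x)) ds) i = Some (1, x)"
    if "i < length ts" for i and x :: "var option"
    using that by (simp add: ds_def rpr_defs_def comp_def map_of_map_restrict restrict_map_def)
  have "rpr_wf (G ++ map_of (map (\<lambda>(R', zs', g'). (R', length zs', Some 1)) ds)) (rpr_rule ts R as \<kappa> i)" for G i
    using scope by (auto simp: rpr_rule_def rpr_label_def rpr_wf_conj rpr_wf_disj map_add_def)
  moreover have "rpr_wf (G ++ map_of (map (\<lambda>(R', zs', g'). (R', length zs', None)) ds)) (rpr_final (length ts))" for G
    using scope by (auto simp: rpr_final_def rpr_wf_disj map_add_def rebind_def)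
  ultimately have wf: "rpr_wf Map.empty Q"
    unfolding Q_def rpr_wf.simps
  proof (intro conjI ballI)
    fix d assume "d \<in> set ds"
    then obtain i where "d = (i, [0], rpr_rule ts R as \<kappa> i)" by (auto simp: ds_def rpr_defs_def)
    then show "case d of (R, zs, g) \<Rightarrow> distinct (1 # zs) \<and> rpr_fv g \<subseteq> insert 1 (set zs) \<and>
        rpr_wf (rebind (insert 1 (set zs)) Map.empty
          ++ map_of (map (\<lambda>(R', zs', g'). (R', length zs', Some 1)) ds)) g"
      using rule_fv[of i] \<open>\<And>i G. rpr_wf (G ++ _) (rpr_rule ts R as \<kappa> i)\<close> by auto
  qed
  have "rpr_defined (rpr_rule ts R as \<kappa> i) = []" for i
    by (auto simp: rpr_rule_def rpr_label_def rpr_defined_conj rpr_defined_disj concat_map_eq_Nil)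
  moreover have "rpr_defined (rpr_final (length ts)) = []"
    by (auto simp: rpr_final_def rpr_defined_disj concat_map_eq_Nil)
  moreover have "concat (map (\<lambda>i. [i]) xs) = xs" for xs :: "relvar list" by (induction xs) auto
  ultimately have dist: "distinct (rpr_defined Q)"
    by (simp add: Q_def ds_def rpr_defs_def comp_def)
  have "l \<in> ans (Ont, \<kappa>) A \<longleftrightarrow> rpr_sat (tem A) (preds A) Q (\<lambda>_. l) (\<lambda>_ _ _. False)"
    if A: "data_instance A" and l: "l \<in> tem A" for A l
  proof -
    define m where "m = nat (max_data A)"
    let ?reach = "reach (Pow \<Phi>) R (\<lambda>t. admissible \<Phi> \<kappa> A l (int t))"
    have "0 \<le> max_data A" using A by (simp add: data_instance_def)
    then have tem: "tem A = {0..int m}" by (simp add: tem_data_instance[OF A] m_def)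
    define E where "E = rpr_stage (map (map_prod id (map_prod id (rpr_sat {0..int m} (preds A)))) ds) 1
      (\<lambda>_. l) (\<lambda>_ _ _. False) (Suc m)"
    have E: "E i [l] s \<longleftrightarrow> 0 \<le> s \<and> s < int (Suc m) \<and> ts ! i \<in> ?reach (nat s)" if "i < length ts" for i s
      unfolding E_def
      by (rule rpr_stage_reach[OF as ts order.refl that])
        (simp add: ds_def rpr_defs_def comp_def map_of_map_restrict restrict_map_def)
    \<comment> \<open>The end of the domain is recognised by the lack of a successor, as the
      language has no constant for it.\<close>
    have last: "(\<exists>d\<in>{0..int m}. d = s + 1) \<longleftrightarrow> s \<noteq> int m" if "s \<in> {0..int m}" for s
      using that by auto
    have "rpr_sat (tem A) (preds A) Q (\<lambda>_. l) (\<lambda>_ _ _. False) \<longleftrightarrow>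
        rpr_sat {0..int m} (preds A) (rpr_final (length ts)) (\<lambda>_. l) E"
    proof -
      have "card {0..int m} = Suc m" by simp
      then show ?thesis by (simp only: Q_def tem E_def rpr_sat.simps)
    qed
    also have "\<dots> \<longleftrightarrow> \<not> (\<exists>s\<in>{0..int m}. s = int m \<and> (\<exists>i<length ts. E i [l] s))"
    proof -
      have "rpr_sat {0..int m} (preds A) (rpr_disj (map (\<lambda>i. RRel i [0] 1) [0..<length ts])) ((\<lambda>_. l)(1 := s)) E
          \<longleftrightarrow> (\<exists>i<length ts. E i [l] s)" for s
        by (auto simp: rpr_sat_disj)
      moreover have "rpr_sat {0..int m} (preds A) (RNot (REx 2 (RSucc 1 2))) ((\<lambda>_. l)(1 := s)) E \<longleftrightarrow> s = int m"
        if "s \<in> {0..int m}" for s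
        using last[OF that] that by auto
      ultimately show ?thesis
        unfolding rpr_final_def rpr_sat.simps(6,7,9) by (simp only: cong: bex_cong)
    qed
    also have "\<dots> \<longleftrightarrow> \<not> (\<exists>i<length ts. ts ! i \<in> ?reach m)"
      using E by auto
    also have "\<dots> \<longleftrightarrow> ?reach m = {}"
      unfolding ex_nth_iff[of ts "\<lambda>r. r \<in> ?reach m"] ts
      using reach_subset[of "Pow \<Phi>" R _ m] by blast
    finally show ?thesis using ans_iff_reach[OF A l cov \<kappa>] by (simp add: R_def m_def)
  qed
  then have "\<forall>A. data_instance A \<longrightarrow>
      ans (Ont, \<kappa>) A = {l \<in> tem A. rpr_sat (tem A) (preds A) Q (\<lambda>_. l) (\<lambda>_ _ _. False)}"
    by (auto simp: ans_def)
  with fv wf dist show ?thesis unfolding fo_rpr_rewritable_def by blast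
qed

section \<open>The answers as a regular language\<close>

fun block_step ::
  "('s \<Rightarrow> 'x \<Rightarrow> 's) \<Rightarrow> ('x \<Rightarrow> bool list) \<Rightarrow> 'x set \<Rightarrow> nat
    \<Rightarrow> ('s \<times> bool list) option \<Rightarrow> bool \<Rightarrow> ('s \<times> bool list) option" where
  "block_step \<delta> enc \<Gamma> p None b = None"
| "block_step \<delta> enc \<Gamma> p (Some (s, buf)) b =
     (if Suc (length buf) < p then Some (s, buf @ [b])
      else if buf @ [b] \<in> enc ` \<Gamma> then Some (\<delta> s (inv_into \<Gamma> enc (buf @ [b])), [])
      else None)"

lemma foldl_block_step_None: "foldl (block_step \<delta> enc \<Gamma> p) None w = None"
  by (induction w) auto

lemma foldl_block_step_short:
  "length buf + length w < p \<Longrightarrow>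
    foldl (block_step \<delta> enc \<Gamma> p) (Some (s, buf)) w = Some (s, buf @ w)"
  by (induction w arbitrary: buf) auto

lemma foldl_block_step_block:
  assumes "x \<in> \<Gamma>" "inj_on enc \<Gamma>" "length (enc x) = p" "p > 0"
  shows "foldl (block_step \<delta> enc \<Gamma> p) (Some (s, [])) (enc x) = Some (\<delta> s x, [])"
proof -
  obtain w b where w: "enc x = w @ [b]"
    using assms(3,4) by (cases "enc x" rule: rev_cases) auto
  then have "w @ [b] \<in> enc ` \<Gamma>" using assms(1) by (metis imageI)
  moreover have "inv_into \<Gamma> enc (w @ [b]) = x" using assms(1,2) w by (metis inv_into_f_f)
  moreover have "Suc (length w) = p" using w assms(3) by simp
  moreover from this have "foldl (block_step \<delta> enc \<Gamma> p) (Some (s, [])) w = Some (s, w)"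
    using foldl_block_step_short[of "[]" w p \<delta> enc \<Gamma> s] by simp
  ultimately show ?thesis by (simp add: w)
qed

lemma foldl_block_step_concat:
  assumes "set xs \<subseteq> \<Gamma>" "inj_on enc \<Gamma>" "\<And>x. x \<in> \<Gamma> \<Longrightarrow> length (enc x) = p" "p > 0"
  shows "foldl (block_step \<delta> enc \<Gamma> p) (Some (s, [])) (concat (map enc xs)) = Some (foldl \<delta> s xs, [])"
  using assms(1)
  by (induction xs arbitrary: s) (simp_all add: foldl_block_step_block assms(2-4))

text \<open>\<open>None\<close> is a dead state, so a surviving run has cut the word into codes of
  letters and an incomplete rest, which is in the buffer.\<close>

lemma foldl_block_step_SomeD:
  assumes "foldl (block_step \<delta> enc \<Gamma> p) (Some (s, buf)) w = Some (s', buf')"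
    and "inj_on enc \<Gamma>"
  shows "\<exists>xs. set xs \<subseteq> \<Gamma> \<and> buf @ w = concat (map enc xs) @ buf' \<and> s' = foldl \<delta> s xs"
  using assms(1)
proof (induction w arbitrary: s buf)
  case Nil
  then show ?case by (intro exI[of _ "[]"]) auto
next
  case (Cons b w)
  consider "Suc (length buf) < p"
    | "\<not> Suc (length buf) < p" "buf @ [b] \<in> enc ` \<Gamma>"
    | "\<not> Suc (length buf) < p" "buf @ [b] \<notin> enc ` \<Gamma>" by blast
  then show ?case
  proof cases
    case 1
    then show ?thesis using Cons.IH[of s "buf @ [b]"] Cons.prems by simp
  next
    case 2
    then obtain x where x: "x \<in> \<Gamma>" "buf @ [b] = enc x" by blast
    then have "inv_into \<Gamma> enc (buf @ [b]) = x" using assms(2) by simp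
    then have "foldl (block_step \<delta> enc \<Gamma> p) (Some (\<delta> s x, [])) w = Some (s', buf')"
      using Cons.prems 2 by simp
    then obtain xs where "set xs \<subseteq> \<Gamma>" "w = concat (map enc xs) @ buf'" "s' = foldl \<delta> (\<delta> s x) xs"
      using Cons.IH by force
    then show ?thesis using x by (intro exI[of _ "x # xs"]) (simp flip: x(2))
  next
    case 3
    then show ?thesis using Cons.prems by (simp add: foldl_block_step_None)
  qed
qed

text \<open>Acceptance with an empty buffer excludes words that break off within a letter.\<close>

lemma block_language:
  assumes "inj_on enc \<Gamma>" "\<And>x. x \<in> \<Gamma> \<Longrightarrow> length (enc x) = p" "p > 0"
  shows "{concat (map enc xs) | xs. set xs \<subseteq> \<Gamma> \<and> foldl \<delta> s xs \<in> F} =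
    {w. foldl (block_step \<delta> enc \<Gamma> p) (Some (s, [])) w \<in> (\<lambda>s. Some (s, [])) ` F}"
    (is "?L = ?R")
proof
  show "?L \<subseteq> ?R" by (auto simp: foldl_block_step_concat[OF _ assms])
  show "?R \<subseteq> ?L" 
  proof
    fix w assume "w \<in> ?R"
    then obtain s' where s': "foldl (block_step \<delta> enc \<Gamma> p) (Some (s, [])) w = Some (s', [])" "s' \<in> F"
      by auto
    from foldl_block_step_SomeD[OF s'(1) assms(1)] s'(2) show "w \<in> ?L" by auto
  qed
qed

lemma block_step_closed:
  assumes "\<And>s x. s \<in> Q \<Longrightarrow> x \<in> \<Gamma> \<Longrightarrow> \<delta> s x \<in> Q"
    and "r \<in> insert None (Some ` (Q \<times> {buf. length buf \<le> p}))"
  shows "block_step \<delta> enc \<Gamma> p r b \<in> insert None (Some ` (Q \<times> {buf. length buf \<le> p}))"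
proof (cases r)
  case (Some a)
  then obtain s buf where r: "r = Some (s, buf)" "s \<in> Q" "length buf \<le> p"
    using assms(2) by (cases a) auto
  have "\<delta> s (inv_into \<Gamma> enc y) \<in> Q" if "y \<in> enc ` \<Gamma>" for y
    using assms(1)[OF r(2)] inv_into_into[OF that] by blast
  then show ?thesis using r by auto
qed simp

text \<open>Meaningful only if the kernel of \<open>f\<close> is a right congruence.\<close>

definition class_step :: "('x list \<Rightarrow> 's) \<Rightarrow> 's \<Rightarrow> 'x \<Rightarrow> 's" where
  "class_step f s x = f ((SOME u. f u = s) @ [x])"

text \<open>The Myhill-Nerode construction: the values of \<open>f\<close> are the states, and by
  the congruence any word with the right value may represent its state.\<close>

lemma foldl_class_step:
  assumes "\<And>u v x. f u = f v \<Longrightarrow> f (u @ [x]) = f (v @ [x])"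
  shows "foldl (class_step f) (f []) u = f u"
proof (induction u rule: rev_induct)
  case (snoc x u)
  have "f (SOME v. f v = f u) = f u" by (rule someI) (rule refl)
  then have "f ((SOME v. f v = f u) @ [x]) = f (u @ [x])" by (rule assms)
  with snoc show ?case by (simp add: class_step_def)
qed simp

section \<open>Data instances with a marked point as words\<close>

type_synonym letter = "atom set \<times> bool"

definition enc_letter :: "atom list \<Rightarrow> letter \<Rightarrow> bool list" where
  "enc_letter S x = map (\<lambda>a. a \<in> fst x) S @ [snd x]"

definition letters :: "data \<Rightarrow> int \<Rightarrow> letter list" where
  "letters A l = map (\<lambda>t. ({a. (a, t) \<in> A}, t = l)) [0..max_data A]"

definition letter_ok :: "concept set \<Rightarrow> concept \<Rightarrow> letter list \<Rightarrow> nat \<Rightarrow> concept set \<Rightarrow> bool" where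
  "letter_ok \<Phi> \<kappa> xs t \<tau> \<longleftrightarrow>
     (\<forall>a. CAtom a \<in> \<Phi> \<and> a \<in> fst (xs ! t) \<longrightarrow> CAtom a \<in> \<tau>) \<and> (snd (xs ! t) \<longrightarrow> \<kappa> \<notin> \<tau>)"

text \<open>On the empty word this inspects \<open>[] ! 0\<close> and carries no meaning;
  \<open>summary\<close> keeps the empty word apart from all others.\<close>

definition end_types ::
  "concept set \<Rightarrow> (concept set \<times> concept set) set \<Rightarrow> concept \<Rightarrow> letter list \<Rightarrow> concept set set" where
  "end_types \<Phi> R \<kappa> xs = reach (Pow \<Phi>) R (letter_ok \<Phi> \<kappa> xs) (length xs - 1)"

lemma end_types_snoc:
  assumes "xs \<noteq> []"
  shows "end_types \<Phi> R \<kappa> (xs @ [x]) =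
    {\<tau> \<in> Pow \<Phi>. letter_ok \<Phi> \<kappa> [x] 0 \<tau> \<and> (\<exists>\<sigma>\<in>end_types \<Phi> R \<kappa> xs. (\<sigma>, \<tau>) \<in> R)}"
proof -
  obtain n where n: "length xs = Suc n" using assms by (cases xs) auto
  have "reach (Pow \<Phi>) R (letter_ok \<Phi> \<kappa> (xs @ [x])) n = reach (Pow \<Phi>) R (letter_ok \<Phi> \<kappa> xs) n"
    by (rule reach_cong) (simp add: letter_ok_def nth_append n)
  then show ?thesis by (simp add: end_types_def n letter_ok_def nth_append)
qed

text \<open>The last component decides the answer, the others whether the word encodes a data
  instance at all: the extreme time points \<open>0\<close> and \<open>max_data A\<close> occur in
  the data, so the first and the last letter contain atoms; the maximum is at least 1, so there are
  two letters or more; and exactly one point is marked, for which it is enough to count up to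
  2.\<close>

definition summary ::
  "concept set \<Rightarrow> (concept set \<times> concept set) set \<Rightarrow> concept \<Rightarrow> letter list
    \<Rightarrow> bool \<times> bool \<times> bool \<times> bool \<times> nat \<times> concept set set" where
  "summary \<Phi> R \<kappa> xs =
     (xs = [], xs \<noteq> [] \<and> fst (hd xs) \<noteq> {}, xs \<noteq> [] \<and> fst (last xs) \<noteq> {}, length xs \<ge> 2,
      min 2 (length (filter snd xs)), end_types \<Phi> R \<kappa> xs)"

text \<open>A nonempty word can be replaced by its summary when a letter is appended; the empty word
  is alone in its class.\<close>

lemma summary_cong_snoc:
  assumes "summary \<Phi> R \<kappa> u = summary \<Phi> R \<kappa> v"
  shows "summary \<Phi> R \<kappa> (u @ [x]) = summary \<Phi> R \<kappa> (v @ [x])"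
proof (cases "u = []")
  case True
  then have "v = []" using assms by (auto simp: summary_def)
  with True show ?thesis by simp
next
  case False
  then have "v \<noteq> []" using assms by (simp add: summary_def)
  have ends: "fst (hd u) \<noteq> {} \<longleftrightarrow> fst (hd v) \<noteq> {}"
    and types: "end_types \<Phi> R \<kappa> u = end_types \<Phi> R \<kappa> v"
    and "min 2 (length (filter snd u)) = min 2 (length (filter snd v))"
    using assms False \<open>v \<noteq> []\<close> by (simp_all add: summary_def)
  then have "min 2 (length (filter snd (u @ [x]))) = min 2 (length (filter snd (v @ [x])))"
    by (simp add: min_def split: if_splits)
  moreover have "2 \<le> length (u @ [x])" "2 \<le> length (v @ [x])"
    using False \<open>v \<noteq> []\<close> by (simp_all add: Suc_le_eq)
  ultimately show ?thesis
    using False \<open>v \<noteq> []\<close> ends types unfolding summary_def prod.inject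
    by (intro conjI) (simp_all only: end_types_snoc hd_append2 last_snoc append_is_Nil_conv simp_thms list.distinct)
qed

lemma finite_range_summary:
  assumes "finite \<Phi>"
  shows "finite (range (summary \<Phi> R \<kappa>))"
proof (rule finite_subset)
  show "range (summary \<Phi> R \<kappa>) \<subseteq> UNIV \<times> UNIV \<times> UNIV \<times> UNIV \<times> {..2} \<times> Pow (Pow \<Phi>)"
    using reach_subset by (fastforce simp: summary_def end_types_def)
  show "finite (UNIV \<times> UNIV \<times> UNIV \<times> UNIV \<times> {..2} \<times> Pow (Pow \<Phi>)
      :: (bool \<times> bool \<times> bool \<times> bool \<times> nat \<times> concept set set) set)"
    using assms by simp
qed

lemma length_letters: "data_instance A \<Longrightarrow> length (letters A l) = Suc (nat (max_data A))"
  by (auto simp: letters_def data_instance_def)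

lemma nth_letters:
  "data_instance A \<Longrightarrow> t \<le> nat (max_data A) \<Longrightarrow> letters A l ! t = ({a. (a, int t) \<in> A}, int t = l)"
  by (auto simp: letters_def data_instance_def)

lemma summary_letters:
  assumes A: "data_instance A" and l: "l \<in> tem A" and cov: "covers \<Phi> Ont" and \<kappa>: "\<kappa> \<in> \<Phi>"
  shows "summary \<Phi> (succ_types \<Phi> Ont) \<kappa> (letters A l) = (False, True, True, True, 1, {})
    \<longleftrightarrow> l \<in> ans (Ont, \<kappa>) A"
proof -
  let ?xs = "letters A l" and ?m = "nat (max_data A)"
  have fin: "finite (snd ` A)" "snd ` A \<noteq> {}" using A by (auto simp: data_instance_def)
  have max: "max_data A \<ge> 1" using A by (simp add: data_instance_def)
  have ne: "?xs \<noteq> []" using length_letters[OF A] by (metis length_0_conv nat.distinct(1))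
  have "min_data A \<in> snd ` A" "max_data A \<in> snd ` A"
    using Min_in[OF fin] Max_in[OF fin] by (simp_all add: min_data_def max_data_def)
  then obtain a b where "(a, 0) \<in> A" "(b, max_data A) \<in> A"
    using A by (auto simp: data_instance_def)
  then have ends: "fst (hd ?xs) \<noteq> {}" "fst (last ?xs) \<noteq> {}"
    using nth_letters[OF A, of 0] nth_letters[OF A, of ?m] ne max
    by (auto simp: hd_conv_nth last_conv_nth length_letters[OF A])
  have "length (filter snd ?xs) = card {t. t < Suc ?m \<and> int t = l}"
    unfolding length_filter_conv_card length_letters[OF A]
    by (rule arg_cong[where f = card]) (auto simp: nth_letters[OF A])
  also have "{t. t < Suc ?m \<and> int t = l} = {nat l}"
    using l tem_data_instance[OF A] by auto
  finally have marked: "length (filter snd ?xs) = 1" by simp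
  have "end_types \<Phi> (succ_types \<Phi> Ont) \<kappa> ?xs =
      reach (Pow \<Phi>) (succ_types \<Phi> Ont) (\<lambda>t. admissible \<Phi> \<kappa> A l (int t)) ?m"
    unfolding end_types_def length_letters[OF A] diff_Suc_1
    by (rule reach_cong) (simp add: letter_ok_def admissible_def nth_letters[OF A])
  then show ?thesis
    using ne ends marked max length_letters[OF A] ans_iff_reach[OF A l cov \<kappa>]
    by (simp add: summary_def Suc_le_eq)
qed

text \<open>The converse of the encoding: the first five components of the summary characterise the
  words that come from data instances, whatever the reachable types \<open>Z\<close> are.\<close>

lemma ex_letters:
  assumes xs: "set xs \<subseteq> Pow (set S) \<times> UNIV" and sm: "summary \<Phi> R \<kappa> xs = (False, True, True, True, 1, Z)"
  shows "\<exists>A l. data_instance A \<and> fst ` A \<subseteq> set S \<and> l \<in> tem A \<and> letters A l = xs"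
proof -
  define A where "A = {(a, int t) | a t. t < length xs \<and> a \<in> fst (xs ! t)}"
  have sub: "fst (xs ! t) \<subseteq> set S" if "t < length xs" for t
    using subsetD[OF xs nth_mem[OF that]] by (simp add: mem_Times_iff)
  have len: "length xs \<ge> 2" using sm by (auto simp: summary_def)
  have fst_last: "fst (xs ! 0) \<noteq> {}" "fst (xs ! (length xs - 1)) \<noteq> {}"
    using sm by (auto simp: summary_def hd_conv_nth last_conv_nth)
  have AS: "fst ` A \<subseteq> set S" using sub by (fastforce simp: A_def)
  have "A \<subseteq> set S \<times> int ` {..<length xs}" using sub by (fastforce simp: A_def)
  then have finA: "finite A" by (rule finite_subset) simp
  have 0: "0 \<in> snd ` A" using fst_last(1) len by (force simp: A_def image_iff)
  have last: "int (length xs - 1) \<in> snd ` A"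
    using fst_last(2) len by (force simp: A_def image_iff)
  have "min_data A = 0" unfolding min_data_def
    by (rule Min_eqI) (use finA 0 in \<open>auto simp: A_def\<close>)
  moreover have max: "max_data A = int (length xs - 1)" unfolding max_data_def
    by (rule Max_eqI) (use finA last in \<open>auto simp: A_def\<close>)
  ultimately have A: "data_instance A" using finA 0 len by (auto simp: data_instance_def)
  have "card {t. t < length xs \<and> snd (xs ! t)} = 1"
    using sm by (simp add: summary_def min_def length_filter_conv_card split: if_splits)
  then obtain t0 where t0: "{t. t < length xs \<and> snd (xs ! t)} = {t0}" by (rule card_1_singletonE)
  then have t0': "t0 < length xs" by blast
  have "letters A (int t0) = xs"
  proof (rule nth_equalityI)
    show len': "length (letters A (int t0)) = length xs"
      using length_letters[OF A] max len by simp
    fix t assume "t < length (letters A (int t0))"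
    then have t: "t < length xs" using len' by simp
    then have "{a. (a, int t) \<in> A} = fst (xs ! t)" by (auto simp: A_def)
    moreover have "t = t0 \<longleftrightarrow> snd (xs ! t)" using t t0 by blast
    ultimately show "letters A (int t0) ! t = xs ! t"
      using nth_letters[OF A, of t] t max by (simp add: prod_eq_iff)
  qed
  moreover have "int t0 \<in> tem A" using tem_data_instance[OF A] max t0' by auto
  ultimately show ?thesis using A AS by blast
qed

lemma answering_problem_eq_blocks:
  assumes cov: "covers \<Phi> Ont" and \<kappa>: "\<kappa> \<in> \<Phi>"
  shows "answering_problem S (Ont, \<kappa>) =
    {concat (map (enc_letter S) xs) | xs. set xs \<subseteq> Pow (set S) \<times> UNIV \<and>
       summary \<Phi> (succ_types \<Phi> Ont) \<kappa> xs = (False, True, True, True, 1, {})}"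
    (is "?L = ?R")
proof -
  have enc: "encode S A l = concat (map (enc_letter S) (letters A l))" if "data_instance A" for A l
    using that by (simp add: encode_def letters_def enc_letter_def comp_def data_instance_def)
  have sub: "set (letters A l) \<subseteq> Pow (set S) \<times> UNIV" if "fst ` A \<subseteq> set S" for A l
    using that by (force simp: letters_def)
  have "?L \<subseteq> ?R"
  proof
    fix w assume "w \<in> ?L"
    then obtain A l where w: "w = encode S A l" and A: "data_instance A" "fst ` A \<subseteq> set S"
      and l: "l \<in> ans (Ont, \<kappa>) A"
      by (auto simp: answering_problem_def)
    have "l \<in> tem A" using l by (simp add: ans_def)
    then have "summary \<Phi> (succ_types \<Phi> Ont) \<kappa> (letters A l) = (False, True, True, True, 1, {})"
      using summary_letters[OF A(1) _ cov \<kappa>] l by simp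
    then show "w \<in> ?R" using w enc[OF A(1)] sub[OF A(2)] by blast
  qed
  moreover have "?R \<subseteq> ?L"
  proof
    fix w assume "w \<in> ?R"
    then obtain xs where w: "w = concat (map (enc_letter S) xs)" and xs: "set xs \<subseteq> Pow (set S) \<times> UNIV"
      "summary \<Phi> (succ_types \<Phi> Ont) \<kappa> xs = (False, True, True, True, 1, {})" by blast
    then obtain A l where A: "data_instance A" "fst ` A \<subseteq> set S" "l \<in> tem A" "letters A l = xs"
      using ex_letters[OF xs] by blast
    have "l \<in> ans (Ont, \<kappa>) A" using summary_letters[OF A(1,3) cov \<kappa>] xs(2) A(4) by simp
    moreover have "w = encode S A l" using w enc[OF A(1)] A(4) by simp
    ultimately show "w \<in> ?L" using A(1,2) unfolding answering_problem_def by blast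
  qed
  ultimately show ?thesis by blast
qed

type_synonym answer_state =
  "((bool \<times> bool \<times> bool \<times> bool \<times> nat \<times> concept set set) \<times> bool list) option"

theorem answering_problem_regular:
  assumes cov: "covers \<Phi> Ont" and \<kappa>: "\<kappa> \<in> \<Phi>" and fin: "finite \<Phi>"
  shows "\<exists>(\<delta> :: answer_state \<Rightarrow> bool \<Rightarrow> answer_state) Q s F.
    finite Q \<and> s \<in> Q \<and> (\<forall>r\<in>Q. \<forall>b. \<delta> r b \<in> Q) \<and>
    answering_problem S (Ont, \<kappa>) = {w. foldl \<delta> s w \<in> F}"
proof -
  define f where "f = summary \<Phi> (succ_types \<Phi> Ont) \<kappa>"
  define \<Gamma> where "\<Gamma> = Pow (set S) \<times> (UNIV :: bool set)"
  define p where "p = Suc (length S)"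
  define \<delta> where "\<delta> = block_step (class_step f) (enc_letter S) \<Gamma> p"
  define Q where "Q = insert None (Some ` (range f \<times> {buf :: bool list. length buf \<le> p}))"
  have inj: "inj_on (enc_letter S) \<Gamma>"
  proof (rule inj_onI)
    fix x y assume xy: "x \<in> \<Gamma>" "y \<in> \<Gamma>" "enc_letter S x = enc_letter S y"
    then have "map (\<lambda>a. a \<in> fst x) S = map (\<lambda>a. a \<in> fst y) S" and snd: "snd x = snd y"
      by (simp_all add: enc_letter_def)
    then have "a \<in> fst x \<longleftrightarrow> a \<in> fst y" if "a \<in> set S" for a
      using that by (simp add: map_eq_conv)
    moreover have "fst x \<subseteq> set S" "fst y \<subseteq> set S" using xy(1,2) by (auto simp: \<Gamma>_def)
    ultimately have "fst x = fst y" by blast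
    with snd show "x = y" by (simp add: prod_eq_iff)
  qed
  have fold: "foldl (class_step f) (f []) xs = f xs" for xs
    unfolding f_def by (rule foldl_class_step) (rule summary_cong_snoc)
  have "answering_problem S (Ont, \<kappa>) =
      {concat (map (enc_letter S) xs) | xs. set xs \<subseteq> \<Gamma> \<and>
        foldl (class_step f) (f []) xs \<in> {(False, True, True, True, 1, {})}}"
    unfolding fold unfolding answering_problem_eq_blocks[OF cov \<kappa>] f_def \<Gamma>_def by simp
  also have "\<dots> = {w. foldl \<delta> (Some (f [], [])) w \<in>
      (\<lambda>s. Some (s, [])) ` {(False, True, True, True, 1, {})}}"
    unfolding \<delta>_def by (rule block_language[OF inj]) (simp_all add: enc_letter_def p_def)
  finally have "answering_problem S (Ont, \<kappa>) = {w. foldl \<delta> (Some (f [], [])) w \<in>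
      (\<lambda>s. Some (s, [])) ` {(False, True, True, True, 1, {})}}" .
  moreover have "finite Q"
  proof -
    have "finite {buf :: bool list. length buf \<le> p}"
      using finite_lists_length_le[of "UNIV :: bool set" p] by simp
    moreover have "finite (range f)" unfolding f_def by (rule finite_range_summary[OF fin])
    ultimately show ?thesis by (simp add: Q_def)
  qed
  moreover have "Some (f [], []) \<in> Q" by (auto simp: Q_def)
  moreover have "\<delta> r b \<in> Q" if "r \<in> Q" for r b
    unfolding \<delta>_def Q_def by (rule block_step_closed) (use that in \<open>auto simp: Q_def class_step_def\<close>)
  ultimately show ?thesis by blast
qed

section \<open>Read-only machines\<close>

definition read :: "bool list \<Rightarrow> int \<Rightarrow> bool option" where
  "read w j = (if 0 \<le> j \<and> j < int (length w) then Some (w ! nat j) else None)"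

definition read_all :: "bool list list \<Rightarrow> int list \<Rightarrow> bool option list" where
  "read_all ws hs = map2 read ws hs"

text \<open>The control either continues in a state (\<open>Inl\<close>) or has answered (\<open>Inr\<close>).\<close>

type_synonym 'q reader = "'q \<Rightarrow> bool option list \<Rightarrow> ('q + bool) \<times> int list"

fun reader_step :: "'q reader \<Rightarrow> bool list list \<Rightarrow> ('q + bool) \<times> int list \<Rightarrow> ('q + bool) \<times> int list" where
  "reader_step T ws (Inl q, hs) =
     (case T q (read_all ws hs) of (r, ds) \<Rightarrow> (r, map2 (+) hs ds))"
| "reader_step T ws (Inr b, hs) = (Inr b, hs)"

definition answers ::
  "'q reader \<Rightarrow> bool list list \<Rightarrow> nat \<Rightarrow> ('q + bool) \<times> int list \<Rightarrow> bool \<Rightarrow> bool" where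
  "answers T ws t cfg b \<longleftrightarrow> fst ((reader_step T ws ^^ t) cfg) = Inr b"

lemma funpow_reader_step_Inr: "(reader_step T ws ^^ t) (Inr b, hs) = (Inr b, hs)"
  by (induction t) auto

lemma answers_Inr: "answers T ws t (Inr b, hs) b' \<longleftrightarrow> b = b'"
  by (simp add: answers_def funpow_reader_step_Inr)

lemma answers_Suc: "answers T ws (Suc t) cfg b \<longleftrightarrow> answers T ws t (reader_step T ws cfg) b"
  by (simp add: answers_def funpow_swap1)

lemma answers_add: "answers T ws (t + t') cfg b \<longleftrightarrow> answers T ws t ((reader_step T ws ^^ t') cfg) b"
  by (simp add: answers_def funpow_add)

lemma answers_mono:
  assumes "answers T ws t cfg b" "t \<le> t'"
  shows "answers T ws t' cfg b"
proof -
  obtain hs where "(reader_step T ws ^^ t) cfg = (Inr b, hs)"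
    using assms(1) by (cases "(reader_step T ws ^^ t) cfg") (auto simp: answers_def)
  moreover obtain d where "t' = d + t" using assms(2) by (metis le_add_diff_inverse2)
  ultimately show ?thesis by (simp add: answers_add answers_Inr)
qed

definition reader_wf :: "nat \<Rightarrow> 'q set \<Rightarrow> 'q reader \<Rightarrow> bool" where
  "reader_wf k Q T \<longleftrightarrow> (\<forall>q\<in>Q. \<forall>ss. length ss = k \<longrightarrow>
     fst (T q ss) \<in> Inl ` Q \<union> range Inr \<and> length (snd (T q ss)) = k \<and> set (snd (T q ss)) \<subseteq> {-1, 0, 1})"

fun symbol_of :: "bool option \<Rightarrow> nat" where
  "symbol_of None = 0"
| "symbol_of (Some False) = 1"
| "symbol_of (Some True) = 2"

definition of_symbol :: "nat \<Rightarrow> bool option" where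
  "of_symbol s = (if s = 0 then None else Some (s = 2))"

lemma of_symbol_of: "of_symbol (symbol_of x) = x"
  by (cases x rule: symbol_of.cases) (auto simp: of_symbol_def)

lemma fst_input_tape: "fst (input_tape w) j = symbol_of (read w j)"
  by (auto simp: input_tape_def read_def)

text \<open>Scanned symbols are written back, so a configuration amounts to a state and head
  positions. States that code no running control stand still in state 0, because
  \<open>machine_wf\<close> speaks about every number below \<open>K\<close>.\<close>

definition reader_machine ::
  "('q + bool \<Rightarrow> nat) \<Rightarrow> ('q + bool) set \<Rightarrow> 'q reader \<Rightarrow> machine" where
  "reader_machine e R T s ss =
     (if s \<in> e ` R then
        (case inv_into R e s of
           Inl q \<Rightarrow> (case T q (map of_symbol ss) of (r, ds) \<Rightarrow> (e r, zip ss ds))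
         | Inr b \<Rightarrow> (0, map (\<lambda>s. (s, 0)) ss))
      else (0, map (\<lambda>s. (s, 0)) ss))"

definition reader_tapes :: "bool list list \<Rightarrow> int list \<Rightarrow> tape list" where
  "reader_tapes ws hs = map2 (\<lambda>w h. (fst (input_tape w), h)) ws hs"

lemma machine_step_reader:
  assumes wf: "reader_wf (length ws) Q T" and e: "inj_on e (Inl ` Q \<union> range Inr)"
    and e12: "e (Inr True) = 1" "e (Inr False) = 2"
    and r: "r \<in> Inl ` Q \<union> range Inr" and hs: "length hs = length ws"
    and step: "reader_step T ws (r, hs) = (r', hs')"
  shows "machine_step (reader_machine e (Inl ` Q \<union> range Inr) T) (e r, reader_tapes ws hs) =
      (e r', reader_tapes ws hs') \<and> r' \<in> Inl ` Q \<union> range Inr \<and> length hs' = length ws"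
proof (cases r)
  case (Inr b)
  then have "e r = 1 \<or> e r = 2" using e12 by (cases b) auto
  with Inr r hs step show ?thesis by (auto simp: machine_step_def)
next
  case (Inl q)
  let ?R = "Inl ` Q \<union> range Inr"
  have q: "q \<in> Q" using r Inl by auto
  have "e r \<noteq> 1" "e r \<noteq> 2"
    using inj_onD[OF e, of r "Inr True"] inj_onD[OF e, of r "Inr False"] e12 r Inl by auto
  moreover have inv: "inv_into ?R e (e r) = Inl q" using inv_into_f_f[OF e r] Inl by simp
  moreover have scan: "map (\<lambda>(f, h). f h) (reader_tapes ws hs) = map symbol_of (read_all ws hs)"
    by (auto simp: reader_tapes_def read_all_def fst_input_tape)
  obtain ds where T: "T q (read_all ws hs) = (r', ds)" and hs': "hs' = map2 (+) hs ds"
    using step Inl by (auto split: prod.splits)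
  have len: "length (read_all ws hs) = length ws" using hs by (simp add: read_all_def)
  then have r': "r' \<in> ?R" "length ds = length ws"
    using wf q T by (force simp: reader_wf_def)+
  have "map2 (\<lambda>(f, h) (s, d). (f(h := s), h + d)) (reader_tapes ws hs)
      (zip (map symbol_of (read_all ws hs)) ds) = reader_tapes ws hs'"
    by (rule nth_equalityI)
      (use hs r'(2) in \<open>auto simp: reader_tapes_def read_all_def hs' fst_input_tape fun_upd_idem_iff\<close>)
  moreover have "reader_machine e ?R T (e r) (map symbol_of (read_all ws hs)) =
      (e r', zip (map symbol_of (read_all ws hs)) ds)"
    using r by (simp add: reader_machine_def inv T comp_def of_symbol_of)
  ultimately show ?thesis
    using r' hs hs' by (simp add: machine_step_def scan)
qed

lemma log_time_decidable_reader:
  assumes fin: "finite Q" and q0: "q0 \<in> Q" and wf: "reader_wf (Suc m) Q T"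
    and ans: "\<And>n ws. length ws = m \<Longrightarrow>
      answers T (bits n # ws) (c * (floor_log n + 1)) (Inl q0, replicate (Suc m) 0) (L n ws)"
  shows "log_time_decidable m L"
proof -
  let ?R = "Inl ` Q \<union> range Inr :: ('a + bool) set"
  obtain f :: "'a \<Rightarrow> nat" where f: "inj_on f Q"
    using finite_imp_inj_to_nat_seg[OF fin] by blast
  \<comment> \<open>The numbers 0, 1 and 2 are fixed as the initial, accepting and rejecting states;
    all other states of the control start at 3.\<close>
  define e :: "'a + bool \<Rightarrow> nat" where
    "e r = (case r of Inl q \<Rightarrow> if q = q0 then 0 else f q + 3 | Inr b \<Rightarrow> if b then 1 else 2)" for r
  have e: "inj_on e ?R"
    using f by (auto simp: inj_on_def e_def split: sum.splits if_splits)
  have "finite (e ` ?R)" using fin by simp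
  then obtain K0 where K0: "\<forall>s\<in>e ` ?R. s < K0" by (metis finite_nat_set_iff_bounded)
  define K where "K = max 3 K0"
  have eK: "e r < K" if "r \<in> ?R" for r
    using bspec[OF K0 imageI[OF that]] by (simp add: K_def)
  define M where "M = reader_machine e ?R T"
  have "machine_wf (Suc m) K M"
    unfolding machine_wf_def
  proof (intro conjI allI impI)
    fix s ss assume s: "s < K" and ss: "length ss = Suc m \<and> set ss \<subseteq> {..<K}"
    have "fst (M s ss) < K \<and> length (snd (M s ss)) = Suc m \<and> set (snd (M s ss)) \<subseteq> {..<K} \<times> {-1, 0, 1}"
    proof (cases "s \<in> e ` ?R \<and> (\<exists>q. inv_into ?R e s = Inl q)")
      case True
      then obtain q where q: "inv_into ?R e s = Inl q" by blast
      then have "q \<in> Q" using inv_into_into[of s e ?R] True by auto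
      obtain r ds where T: "T q (map of_symbol ss) = (r, ds)" by fastforce
      have "length (map of_symbol ss) = Suc m" using ss by simp
      then have "fst (T q (map of_symbol ss)) \<in> ?R \<and> length (snd (T q (map of_symbol ss))) = Suc m \<and>
          set (snd (T q (map of_symbol ss))) \<subseteq> {-1, 0, 1}"
        using wf \<open>q \<in> Q\<close> unfolding reader_wf_def by blast
      then have r: "r \<in> ?R" "length ds = Suc m" "set ds \<subseteq> {-1, 0, 1}" using T by simp_all
      have "M s ss = (e r, zip ss ds)" using True q T by (simp add: M_def reader_machine_def)
      moreover have "set (zip ss ds) \<subseteq> {..<K} \<times> {-1, 0, 1}"
      proof
        fix x assume "x \<in> set (zip ss ds)"
        then have "fst x \<in> set ss" "snd x \<in> set ds"
          by (metis prod.collapse set_zip_leftD, metis prod.collapse set_zip_rightD)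
        then show "x \<in> {..<K} \<times> {-1, 0, 1}" using ss r(3) by (auto simp: mem_Times_iff)
      qed
      ultimately show ?thesis using eK[OF r(1)] ss r(2) by simp
    next
      case False
      then have "M s ss = (0, map (\<lambda>s. (s, 0)) ss)"
        by (auto simp: M_def reader_machine_def split: sum.splits)
      then show ?thesis using ss by (auto simp: K_def)
    qed
    then show "fst (M s ss) < K" "length (snd (M s ss)) = Suc m"
      "set (snd (M s ss)) \<subseteq> {..<K} \<times> {-1, 0, 1}" by blast+
  qed (simp add: K_def)
  moreover have "fst ((machine_step M ^^ (c * (floor_log n + 1))) (machine_init (Suc m) (bits n # ws)))
      = (if L n ws then 1 else 2)" if len: "length ws = m" for n ws
  proof -
    let ?ws = "bits n # ws"
    have sim: "(machine_step M ^^ t) (e (Inl q0), reader_tapes ?ws (replicate (Suc m) 0)) =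
        (e (fst cfg), reader_tapes ?ws (snd cfg)) \<and> fst cfg \<in> ?R \<and> length (snd cfg) = length ?ws"
      if "cfg = (reader_step T ?ws ^^ t) (Inl q0, replicate (Suc m) 0)" for t cfg
      using that
    proof (induction t arbitrary: cfg)
      case 0
      then show ?case using q0 len by simp
    next
      case (Suc t)
      obtain r hs where c: "(reader_step T ?ws ^^ t) (Inl q0, replicate (Suc m) 0) = (r, hs)" by fastforce
      from Suc.IH[OF c[symmetric]] have IH:
        "(machine_step M ^^ t) (e (Inl q0), reader_tapes ?ws (replicate (Suc m) 0)) =
          (e r, reader_tapes ?ws hs)" "r \<in> ?R" "length hs = length ?ws" by auto
      have "reader_step T ?ws (r, hs) = (fst cfg, snd cfg)" using Suc.prems c by simp
      then show ?case
        using machine_step_reader[of ?ws Q T e r hs "fst cfg" "snd cfg"] wf e IH len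
        by (simp add: M_def e_def)
    qed
    have init: "machine_init (Suc m) ?ws = (e (Inl q0), reader_tapes ?ws (replicate (Suc m) 0))"
    proof -
      have "map input_tape vs = reader_tapes vs (replicate (length vs) 0)" for vs
        by (induction vs) (auto simp: reader_tapes_def input_tape_def)
      from this[of ?ws] show ?thesis using len by (simp add: machine_init_def e_def)
    qed
    have "fst ((reader_step T ?ws ^^ (c * (floor_log n + 1))) (Inl q0, replicate (Suc m) 0)) = Inr (L n ws)"
      using ans[OF len] by (simp add: answers_def)
    then show ?thesis unfolding init using sim[OF refl, of "c * (floor_log n + 1)"]
      by (simp add: e_def)
  qed
  ultimately show ?thesis unfolding log_time_decidable_def by blast
qed

section \<open>Binary notation as tape contents\<close>

lemma read_bits:
  "read (bits n) (int j) = (if n div 2 ^ j = 0 then None else Some (odd (n div 2 ^ j)))"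
proof (induction n arbitrary: j rule: bits.induct)
  case (1 n)
  show ?case
  proof (cases "n = 0")
    case True
    then show ?thesis by (simp add: bits.simps[of 0] read_def)
  next
    case False
    then have b: "bits n = odd n # bits (n div 2)" by (subst bits.simps) simp
    show ?thesis
    proof (cases j)
      case 0
      then show ?thesis using False by (simp add: b read_def)
    next
      case (Suc i)
      have "read (bits n) (int j) = read (bits (n div 2)) (int i)"
        by (simp add: b Suc read_def nat_add_distrib)
      then show ?thesis using 1[OF False, of i] by (simp add: Suc div_mult2_eq)
    qed
  qed
qed

lemma read_eq_None_iff: "read w (int j) = None \<longleftrightarrow> length w \<le> j"
  by (simp add: read_def)

lemma less_two_power_length_bits: "n < 2 ^ length (bits n)"
  using read_bits[of n "length (bits n)"] read_eq_None_iff[of "bits n" "length (bits n)"]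
  by (metis div_eq_0_iff option.distinct(1) order.refl power_eq_0_iff zero_neq_numeral)

lemma length_bits_le: "length (bits n) \<le> floor_log n + 1"
proof (cases "n = 0")
  case True
  then show ?thesis by (simp add: bits.simps[of 0])
next
  case False
  have "n < 2 ^ (floor_log n + 1)" using floor_log_exp2_gt[of n] by simp
  then have "n div 2 ^ (floor_log n + 1) = 0" by simp
  then show ?thesis using read_bits[of n "floor_log n + 1"] read_eq_None_iff[of "bits n"] by metis
qed

text \<open>The first blank cell betrays the length, so the contents of the tape determine the
  word.\<close>

lemma read_ext:
  assumes "\<And>j. read v (int j) = read w (int j)"
  shows "v = w"
proof -
  have le: "length x \<le> length y" if "\<And>j. read x (int j) = read y (int j)" for x y
    using that[of "length y"] read_eq_None_iff by (metis order.refl)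
  have "length v = length w" using le[of v w] le[of w v] assms by simp
  moreover have "v ! i = w ! i" if "i < length v" "length v = length w" for i
    using assms[of i] that by (simp add: read_def)
  ultimately show ?thesis by (simp add: list_eq_iff_nth_eq)
qed

section \<open>Uniform families of tree-shaped circuits\<close>

text \<open>In \<open>KLeaf x y\<close> the first argument applies to positions inside the input,
  where \<open>None\<close> stands for the input bit and \<open>Some b\<close> for a constant;
  \<open>y\<close> is the constant taken beyond the end.\<close>

datatype kind = KAnd | KOr | KNot | KLeaf "bool option" bool

fun has_pred :: "kind \<Rightarrow> bool \<Rightarrow> bool" where
  "has_pred KAnd b = True"
| "has_pred KOr b = True"
| "has_pred KNot b = (\<not> b)"
| "has_pred (KLeaf x y) b = False"

fun gate_of :: "nat \<Rightarrow> name \<Rightarrow> nat \<Rightarrow> kind \<Rightarrow> gate" where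
  "gate_of n g i KAnd = GAnd (g @ [False]) (g @ [True])"
| "gate_of n g i KOr = GOr (g @ [False]) (g @ [True])"
| "gate_of n g i KNot = GNot (g @ [False])"
| "gate_of n g i (KLeaf x y) =
     (case (if i < n then x else Some y) of None \<Rightarrow> GInput i | Some b \<Rightarrow> GConst b)"

lemma gate_pred_gate_of:
  "gate_pred (gate_of n g i k) b = (if has_pred k b then Some (g @ [b]) else None)"
  by (cases k; cases b) (auto split: option.splits)

text \<open>A gate is named by the path that leads to it from the output gate.  An automaton reads this
  path; while some of the \<open>k\<close> levels remain, the bits read in the states satisfying \<open>lev\<close> are also
  the binary digits, most significant first, of the input position \<open>i\<close>.  The second argument of \<open>kind\<close>
  and \<open>nxt\<close> tells whether no level remains.\<close>

locale tree_family =
  fixes Q :: "'q set" and q\<^sub>0 :: 'q and nxt :: "'q \<Rightarrow> bool \<Rightarrow> bool \<Rightarrow> 'q" and lev :: "'q \<Rightarrow> bool"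
    and kind :: "'q \<Rightarrow> bool \<Rightarrow> kind" and c :: nat
begin

definition move :: "'q \<times> nat \<times> nat \<Rightarrow> bool \<Rightarrow> 'q \<times> nat \<times> nat" where
  "move = (\<lambda>(q, k, i) b. (nxt q (k = 0) b, if lev q \<and> k > 0 then (k - 1, 2 * i + of_bool b) else (k, i)))"

definition kind_at :: "'q \<times> nat \<times> nat \<Rightarrow> kind" where
  "kind_at = (\<lambda>(q, k, i). kind q (k = 0))"

fun walk :: "'q \<times> nat \<times> nat \<Rightarrow> bool list \<Rightarrow> ('q \<times> nat \<times> nat) option" where
  "walk s [] = Some s"
| "walk s (b # g) = (if has_pred (kind_at s) b then walk (move s b) g else None)"

definition root :: "nat \<Rightarrow> 'q \<times> nat \<times> nat" where
  "root n = (q\<^sub>0, length (bits n), 0)"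

definition circuit :: "nat \<Rightarrow> circuit" where
  "circuit n g = map_option (\<lambda>s. gate_of n g (snd (snd s)) (kind_at s)) (walk (root n) g)"

lemma walk_append: "walk s (g @ p) = (case walk s g of None \<Rightarrow> None | Some s' \<Rightarrow> walk s' p)"
  by (induction g arbitrary: s) auto

lemma circuit_None: "walk (root n) g = None \<Longrightarrow> circuit n g = None"
  and circuit_Some: "walk (root n) g = Some s \<Longrightarrow> circuit n g = Some (gate_of n g (snd (snd s)) (kind_at s))"
  by (simp_all add: circuit_def)

lemma dom_circuit: "g \<in> dom (circuit n) \<longleftrightarrow> walk (root n) g \<noteq> None"
  by (auto simp: circuit_def)

lemma gate_path_circuit:
  "gate_path (circuit n) g p = (if g @ p \<in> dom (circuit n) then Some (g @ p) else None)"
proof (induction p arbitrary: g)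
  case Nil
  then show ?case by simp
next
  case (Cons b p)
  show ?case
  proof (cases "walk (root n) g")
    case None
    then show ?thesis by (simp add: circuit_None dom_circuit walk_append del: domIff)
  next
    case (Some s)
    then show ?thesis
      using Cons.IH[of "g @ [b]"]
      by (auto simp: circuit_Some dom_circuit walk_append gate_pred_gate_of simp del: domIff split: if_splits)
  qed
qed

end

text \<open>\<open>leaf\<close> guarantees that a position has received all its digits before a leaf
  uses it. \<open>walk_bound\<close> is linear in the number of levels, which makes the depth
  logarithmic.\<close>

locale bounded_tree_family = tree_family Q q\<^sub>0 nxt lev kind c
  for Q :: "'q set" and q\<^sub>0 nxt lev kind c +
  assumes finite_Q: "finite Q" and q\<^sub>0_Q: "q\<^sub>0 \<in> Q" and nxt_Q: "\<And>q z b. q \<in> Q \<Longrightarrow> nxt q z b \<in> Q"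
    and leaf: "\<And>q x y. kind q False \<noteq> KLeaf x y"
    and walk_bound: "\<And>k g. walk (q\<^sub>0, k, 0) g \<noteq> None \<Longrightarrow> length g \<le> c * (k + 1)"
begin

section \<open>Depth and size of the circuits\<close>

lemma length_walk: "walk (root n) g \<noteq> None \<Longrightarrow> length g \<le> 2 * c * (floor_log n + 1)"
proof -
  assume "walk (root n) g \<noteq> None"
  then have "length g \<le> c * (length (bits n) + 1)" using walk_bound by (auto simp only: root_def)
  also have "\<dots> \<le> c * (2 * (floor_log n + 1))" using length_bits_le[of n] by (intro mult_left_mono) simp_all
  finally show ?thesis by (simp add: algebra_simps)
qed

lemma dom_circuit_subset: "dom (circuit n) \<subseteq> {g. length g \<le> 2 * c * (floor_log n + 1)}"
  using length_walk dom_circuit by blast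

lemma finite_words: "finite {g :: bool list. length g \<le> N}"
  using finite_lists_length_le[of "UNIV :: bool set" N] by simp

lemma card_words: "card {g :: bool list. length g \<le> N} \<le> 2 ^ (N + 1)"
proof -
  have "card {g :: bool list. length g \<le> N} = (\<Sum>i\<le>N. 2 ^ i)"
    using card_lists_length_le[of "UNIV :: bool set" N] by simp
  also have "\<dots> \<le> 2 ^ (N + 1)" by (induction N) auto
  finally show ?thesis .
qed

lemma circuit_wf: "circuit_wf n (circuit n)"
  unfolding circuit_wf_def
proof (intro conjI allI impI)
  show "finite (dom (circuit n))" by (rule finite_subset[OF dom_circuit_subset finite_words])
  show "[] \<in> dom (circuit n)" by (simp add: dom_circuit del: domIff)
next
  fix g k b h assume g: "circuit n g = Some k" and h: "gate_pred k b = Some h"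
  then obtain s where s: "walk (root n) g = Some s" "k = gate_of n g (snd (snd s)) (kind_at s)"
    by (auto simp: circuit_def)
  then have "has_pred (kind_at s) b" "h = g @ [b]"
    using h by (auto simp: gate_pred_gate_of split: if_splits)
  then show "h \<in> dom (circuit n)" using s by (simp add: dom_circuit walk_append del: domIff)
next
  fix g k i assume "circuit n g = Some k" "k = GInput i"
  then obtain s where "GInput i = gate_of n g (snd (snd s)) (kind_at s)"
    by (metis circuit_None circuit_Some option.inject option.distinct(1) not_None_eq)
  then show "i < n" by (cases "kind_at s") (auto split: if_splits option.splits)
qed

lemma depth_circuit: "depth_le (circuit n) (2 * c * (floor_log n + 1))"
proof -
  have "length p \<le> 2 * c * (floor_log n + 1)" if "g @ p \<in> dom (circuit n)" for g p
    using subsetD[OF dom_circuit_subset that] by simp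
  then show ?thesis by (simp add: depth_le_def gate_path_circuit del: domIff)
qed

text \<open>Names are words of logarithmic length, of which there are only polynomially many. For
  \<open>n < 2\<close> powers of \<open>n\<close> are too small, hence the additive
  constant.\<close>

lemma card_circuit: "card (dom (circuit n)) \<le> n ^ (4 * c + 1) + 4 ^ (2 * c + 1)"
proof -
  have "card (dom (circuit n)) \<le> card {g :: bool list. length g \<le> 2 * c * (floor_log n + 1)}"
    by (rule card_mono[OF finite_words dom_circuit_subset])
  also have "\<dots> \<le> 2 ^ (2 * c * (floor_log n + 1) + 1)" by (rule card_words)
  also have "\<dots> \<le> n ^ (4 * c + 1) + 4 ^ (2 * c + 1)"
  proof (cases "n < 2")
    case True
    then have "floor_log n = 0" by (cases n) (auto simp: less_Suc_eq numeral_2_eq_2)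
    then have "2 ^ (2 * c * (floor_log n + 1) + 1) \<le> (2::nat) ^ (2 * (2 * c + 1))"
      by (intro power_increasing) auto
    then show ?thesis by (simp add: power_mult)
  next
    case False
    have "(2 ^ floor_log n * 2) ^ (2 * c) = (2::nat) ^ ((floor_log n + 1) * (2 * c))"
      unfolding power_mult by simp
    then have "(2::nat) ^ (2 * c * (floor_log n + 1) + 1) = (2 ^ floor_log n * 2) ^ (2 * c) * 2"
      by (simp only: power_add power_one_right mult.commute[of "2 * c"])
    \<comment> \<open>Both the factor 2 in the base and the final factor 2 are absorbed by
      \<open>n\<close>, as \<open>2 \<le> n\<close>.\<close>
    also have "\<dots> \<le> (n * n) ^ (2 * c) * n"
      using False floor_log_exp2_le[of n] by (intro mult_mono power_mono) auto
    also have "\<dots> = n ^ (4 * c + 1)" by (simp add: power_mult_distrib flip: power_add)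
    finally show ?thesis by simp
  qed
  finally show ?thesis .
qed

text \<open>The machine for paths runs along \<open>g\<close> or \<open>p\<close> (according to its phase) and \<open>h\<close>, and counts the
  levels on the first tape.\<close>

definition path_reader :: "(bool \<times> 'q) reader" where
  "path_reader s ss =
     (let a = ss ! 0; x = ss ! (if fst s then 2 else 1); h = ss ! 3; z = (a = None) in
      case x of
        None \<Rightarrow> if fst s then (Inr (h = None), [0, 0, 0, 0]) else (Inl (True, snd s), [0, 0, 0, 0])
      | Some b \<Rightarrow>
          if h = Some b \<and> has_pred (kind (snd s) z) b
          then (Inl (fst s, nxt (snd s) z b),
            [if lev (snd s) \<and> \<not> z then 1 else 0, if fst s then 0 else 1, if fst s then 1 else 0, 1])
          else (Inr False, [0, 0, 0, 0]))"

lemma path_reader_simps: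
  "path_reader (True, q) [a, x, None, h] = (Inr (h = None), [0, 0, 0, 0])"
  "path_reader (False, q) [a, None, y, h] = (Inl (True, q), [0, 0, 0, 0])"
  "path_reader (True, q) [a, x, Some b, h] =
     (if h = Some b \<and> has_pred (kind q (a = None)) b
      then (Inl (True, nxt q (a = None) b), [if lev q \<and> a \<noteq> None then 1 else 0, 0, 1, 1])
      else (Inr False, [0, 0, 0, 0]))"
  "path_reader (False, q) [a, Some b, y, h] =
     (if h = Some b \<and> has_pred (kind q (a = None)) b
      then (Inl (False, nxt q (a = None) b), [if lev q \<and> a \<noteq> None then 1 else 0, 1, 0, 1])
      else (Inr False, [0, 0, 0, 0]))"
  by (simp_all add: path_reader_def Let_def)

lemma path_reader_wf: "reader_wf 4 (UNIV \<times> Q) path_reader"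
  unfolding reader_wf_def
  by (auto simp: path_reader_def Let_def nxt_Q split: option.splits)

lemma read_at_length: "read (u @ v) (int (length u)) = (case v of [] \<Rightarrow> None | b # _ \<Rightarrow> Some b)"
  by (auto simp: read_def nth_append split: list.splits)

lemma read_length: "read u (int (length u)) = None"
  by (simp add: read_def)

lemma read_bits_eq_None_iff:
  "k \<le> length (bits n) \<Longrightarrow> read (bits n) (int (length (bits n)) - int k) = None \<longleftrightarrow> k = 0"
  by (auto simp: read_def)

text \<open>The first head has passed one digit for each level used up, so it sees a blank iff
  \<open>k = 0\<close>. The words on the tapes may be arbitrarily long, but a bit that leaves the
  tree causes an immediate rejection; the bound \<open>t\<close> on walks thus bounds the running
  time, and the extra step notices the end of the word.\<close>

lemma path_reader_second:
  assumes "k \<le> length (bits n)" "\<And>u. walk (q, k, i) u \<noteq> None \<Longrightarrow> length u \<le> t"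
  shows "answers path_reader [bits n, g, u @ v, w @ h] (Suc t)
    (Inl (True, q), [int (length (bits n)) - int k, int j, int (length u), int (length w)])
    (h = v \<and> walk (q, k, i) v \<noteq> None)"
  using assms
proof (induction t arbitrary: q k i u v w h)
  case 0
  show ?case
  proof (cases v)
    case Nil
    then show ?thesis
      by (cases h) (simp_all add: answers_Suc path_reader_simps read_all_def read_at_length read_length answers_Inr)
  next
    case (Cons b v')
    have "\<not> has_pred (kind q (k = 0)) b" using 0(2)[of "[b]"] by (cases "move (q, k, i) b") (auto simp: kind_at_def)
    then show ?thesis
      by (simp add: Cons answers_Suc path_reader_simps read_all_def read_at_length read_length answers_Inr
          read_bits_eq_None_iff 0 kind_at_def)
  qed
next
  case (Suc t)
  show ?case
  proof (cases v)
    case Nil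
    then show ?thesis
      by (cases h) (simp_all add: answers_Suc path_reader_simps read_all_def read_at_length read_length answers_Inr)
  next
    case (Cons b v')
    obtain q' k' i' where mv: "move (q, k, i) b = (q', k', i')" by (cases "move (q, k, i) b")
    show ?thesis
    proof (cases "has_pred (kind q (k = 0)) b \<and> (\<exists>h'. h = b # h')")
      case True
      then obtain h' where h: "h = b # h'" by blast
      have k': "k' \<le> length (bits n)" "int (length (bits n)) - int k' =
          int (length (bits n)) - int k + (if lev q \<and> k > 0 then 1 else 0)"
        using mv Suc.prems(1) by (auto simp: move_def of_nat_diff split: if_splits)
      have "length u' \<le> t" if "walk (q', k', i') u' \<noteq> None" for u'
        using Suc.prems(2)[of "b # u'"] that True mv by (simp add: kind_at_def)
      from Suc.IH[OF k'(1) this, where u = "u @ [b]" and v = v' and w = "w @ [b]" and h = h'] True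
      show ?thesis
        using mv
        by (subst answers_Suc) (simp add: Cons h path_reader_simps read_all_def read_at_length read_length
          read_bits_eq_None_iff Suc.prems(1) kind_at_def k'(2) move_def add.commute split: if_splits)
    next
      case False
      then show ?thesis
        by (cases h) (auto simp: Cons answers_Suc path_reader_simps read_all_def read_at_length read_length answers_Inr
          read_bits_eq_None_iff Suc.prems(1) kind_at_def)
    qed
  qed
qed

text \<open>The second extra step notices the end of the first word and changes the phase.\<close>

lemma path_reader_first:
  assumes "k \<le> length (bits n)" "\<And>u. walk (q, k, i) u \<noteq> None \<Longrightarrow> length u \<le> t"
  shows "answers path_reader [bits n, u @ v, p, w @ h] (t + 2)
    (Inl (False, q), [int (length (bits n)) - int k, int (length u), 0, int (length w)])
    (h = v @ p \<and> walk (q, k, i) (v @ p) \<noteq> None)"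
  using assms
proof (induction t arbitrary: q k i u v w h)
  case 0
  show ?case
  proof (cases v)
    case Nil
    then show ?thesis
      using path_reader_second[OF 0, where g = u and u = "[]" and v = p and w = w and h = h and j = "length u"]
      by (simp add: answers_Suc[of _ _ "Suc 0"] numeral_2_eq_2 path_reader_simps read_all_def read_at_length read_length)
  next
    case (Cons b v')
    have "\<not> has_pred (kind q (k = 0)) b" using 0(2)[of "[b]"] by (cases "move (q, k, i) b") (auto simp: kind_at_def)
    then show ?thesis
      by (simp add: Cons answers_Suc numeral_2_eq_2 path_reader_simps read_all_def read_at_length read_length answers_Inr
          read_bits_eq_None_iff 0 kind_at_def)
  qed
next
  case (Suc t)
  show ?case
  proof (cases v)
    case Nil
    then show ?thesis
      using path_reader_second[OF Suc.prems, where g = u and u = "[]" and v = p and w = w and h = h and j = "length u"]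
      by (simp add: answers_Suc[of _ _ "Suc (Suc t)"] path_reader_simps read_all_def read_at_length read_length)
  next
    case (Cons b v')
    obtain q' k' i' where mv: "move (q, k, i) b = (q', k', i')" by (cases "move (q, k, i) b")
    show ?thesis
    proof (cases "has_pred (kind q (k = 0)) b \<and> (\<exists>h'. h = b # h')")
      case True
      then obtain h' where h: "h = b # h'" by blast
      have k': "k' \<le> length (bits n)" "int (length (bits n)) - int k' =
          int (length (bits n)) - int k + (if lev q \<and> k > 0 then 1 else 0)"
        using mv Suc.prems(1) by (auto simp: move_def of_nat_diff split: if_splits)
      have "length u' \<le> t" if "walk (q', k', i') u' \<noteq> None" for u'
        using Suc.prems(2)[of "b # u'"] that True mv by (simp add: kind_at_def)
      from Suc.IH[OF k'(1) this, where u = "u @ [b]" and v = v' and w = "w @ [b]" and h = h'] True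
      show ?thesis
        using mv
        by (simp add: answers_Suc[of _ _ "Suc (Suc t)"] Cons h path_reader_simps read_all_def read_at_length read_length
          read_bits_eq_None_iff Suc.prems(1) kind_at_def k'(2) move_def add.commute split: if_splits)
    next
      case False
      then show ?thesis
        by (cases h) (auto simp: Cons answers_Suc path_reader_simps read_all_def read_at_length read_length answers_Inr
          read_bits_eq_None_iff Suc.prems(1) kind_at_def)
    qed
  qed
qed

lemma log_time_paths:
  "log_time_decidable 3 (\<lambda>n ws. \<exists>g p h. ws = [g, p, h] \<and> gate_path (circuit n) g p = Some h)"
proof (rule log_time_decidable_reader)
  show "finite (UNIV \<times> Q :: (bool \<times> 'q) set)" using finite_Q by simp
  show "(False, q\<^sub>0) \<in> UNIV \<times> Q" using q\<^sub>0_Q by simp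
  show "reader_wf (Suc 3) (UNIV \<times> Q) path_reader" using path_reader_wf by simp
  fix n and ws :: "bool list list" assume "length ws = 3"
  then obtain g p h where ws: "ws = [g, p, h]" by (auto simp: numeral_3_eq_3 length_Suc_conv)
  have "answers path_reader [bits n, [] @ g, p, [] @ h] (2 * c * (floor_log n + 1) + 2)
      (Inl (False, q\<^sub>0), [int (length (bits n)) - int (length (bits n)), int (length ([] :: bool list)), 0, int (length ([] :: bool list))])
      (h = g @ p \<and> walk (q\<^sub>0, length (bits n), 0) (g @ p) \<noteq> None)"
    by (rule path_reader_first) (use length_walk in \<open>auto simp: root_def\<close>)
  moreover have "(\<exists>g p h. ws = [g, p, h] \<and> gate_path (circuit n) g p = Some h) \<longleftrightarrow>
      h = g @ p \<and> walk (q\<^sub>0, length (bits n), 0) (g @ p) \<noteq> None"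
    by (auto simp: ws gate_path_circuit dom_circuit root_def simp del: domIff)
  ultimately have "answers path_reader (bits n # ws) (2 * c * (floor_log n + 1) + 2)
      (Inl (False, q\<^sub>0), replicate (Suc 3) 0) (\<exists>g p h. ws = [g, p, h] \<and> gate_path (circuit n) g p = Some h)"
    by (simp add: ws numeral_3_eq_3)
  then show "answers path_reader (bits n # ws) ((2 * c + 2) * (floor_log n + 1))
      (Inl (False, q\<^sub>0), replicate (Suc 3) 0) (\<exists>g p h. ws = [g, p, h] \<and> gate_path (circuit n) g p = Some h)"
    by (rule answers_mono) (simp add: algebra_simps)
qed

end

section \<open>Recognising the code of a gate\<close>

definition prefix5 :: "bool list \<Rightarrow> bool option list" where
  "prefix5 w = map (read w) [0, 1, 2, 3, 4]"

text \<open>Codes of gates other than inputs have at most four bits; the fifth cell, being blank,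
  shows that nothing follows.\<close>

lemma prefix5_eq_iff:
  assumes "length w \<le> 4"
  shows "prefix5 v = prefix5 w \<longleftrightarrow> v = w"
proof
  assume eq: "prefix5 v = prefix5 w"
  then have "read v 4 = None" using assms by (simp add: prefix5_def read_def)
  then have v: "length v \<le> 4" by (simp add: read_def split: if_splits)
  show "v = w"
  proof (rule read_ext)
    fix j :: nat
    consider "j = 0" | "j = 1" | "j = 2" | "j = 3" | "4 \<le> j" by linarith
    then show "read v (int j) = read w (int j)"
    proof cases
      case 5
      then have "length v \<le> j" "length w \<le> j" using v assms by simp_all
      then show ?thesis by (simp add: read_def)
    qed (use eq in \<open>simp_all add: prefix5_def\<close>)
  qed
qed simp

text \<open>While walking, with \<open>i\<close> the position read so far, the four flags record
  whether \<open>i\<close> is nonzero, whether it is less than or equal to the number formed by the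
  corresponding leading digits of the input length, and whether the code has matched the digits of
  \<open>i\<close>. The two comparisons are kept in separate flags, \<open>lt\<close> for strictly
  less and \<open>eq\<close> for equality. The list keeps the prefix of the code.\<close>

datatype 'q gate_state =
    Pre "bool option list"
  | Sweep "bool option list"
  | Turn "bool option list"
  | Walking 'q bool bool bool bool "bool option list"

text \<open>Empty names serve as predecessors because codes record only the sort of a Boolean
  gate.\<close>

fun accepts_code :: "kind \<Rightarrow> bool \<Rightarrow> bool \<Rightarrow> bool option list \<Rightarrow> bool" where
  "accepts_code KAnd lt ok l \<longleftrightarrow> l = prefix5 (gate_code (GAnd [] []))"
| "accepts_code KOr lt ok l \<longleftrightarrow> l = prefix5 (gate_code (GOr [] []))"
| "accepts_code KNot lt ok l \<longleftrightarrow> l = prefix5 (gate_code (GNot []))"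
| "accepts_code (KLeaf x y) lt ok l \<longleftrightarrow>
     (case (if lt then x else Some y) of
        None \<Rightarrow> l ! 0 = Some True \<and> ok
      | Some b \<Rightarrow> l = prefix5 (gate_code (GConst b)))"

text \<open>The digits of the input position from place \<open>k\<close> on have the value \<open>i\<close>; in the code of an input
  gate, the digit at place \<open>j\<close> is in cell \<open>j + 1\<close>.\<close>

definition digits_match :: "bool list \<Rightarrow> nat \<Rightarrow> nat \<Rightarrow> nat \<Rightarrow> bool" where
  "digits_match code K k i \<longleftrightarrow>
     (\<forall>j. k \<le> j \<and> j \<le> K \<longrightarrow> read code (int j + 1) = read (bits i) (int (j - k)))"

lemma digits_match_start: "digits_match code K K 0 \<longleftrightarrow> read code (int K + 1) = None"
  by (auto simp: digits_match_def bits.simps[of 0] read_def)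

lemma double_div: "(2 * i + of_bool b) div 2 ^ Suc j = i div 2 ^ j" for i :: nat
  by (simp add: div_mult2_eq)

text \<open>Digits arrive most significant first, so the next one belongs to place
  \<open>k - 1\<close>, which is cell \<open>k\<close> of the code. \<open>bits\<close> has no
  leading zeros: as long as only zeros have arrived, the cell must be blank.\<close>

lemma digits_match_level:
  assumes "0 < k" "k \<le> K"
  shows "digits_match code K (k - 1) (2 * i + of_bool b) \<longleftrightarrow>
    digits_match code K k i \<and> read code (int k) = (if i \<noteq> 0 \<or> b then Some b else None)"
proof -
  have split: "(\<forall>j. k - 1 \<le> j \<and> j \<le> K \<longrightarrow> P j) \<longleftrightarrow> (\<forall>j. k \<le> j \<and> j \<le> K \<longrightarrow> P j) \<and> P (k - 1)" for P
  proof -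
    have "k - 1 \<le> j \<longleftrightarrow> k \<le> j \<or> j = k - 1" for j using assms(1) by linarith
    then show ?thesis using assms by auto
  qed
  have "read (bits (2 * i + of_bool b)) (int (j - (k - 1))) = read (bits i) (int (j - k))" if "k \<le> j" for j
  proof -
    have "j - (k - 1) = Suc (j - k)" using that assms(1) by simp
    then show ?thesis unfolding read_bits by (simp only: double_div)
  qed
  moreover have "read (bits (2 * i + of_bool b)) (int 0) = (if i \<noteq> 0 \<or> b then Some b else None)"
    unfolding read_bits by simp
  moreover have "int (k - 1) + 1 = int k" using assms(1) by simp
  ultimately show ?thesis unfolding digits_match_def split by simp
qed

text \<open>Matching includes the place \<open>length (bits n)\<close>, beyond all digits of
  \<open>i\<close>. The blank found there bounds the length of the code, so no further cells have to
  be inspected.\<close>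

lemma digits_match_end:
  assumes "i < n"
  shows "code = True # bits i \<longleftrightarrow>
    read code 0 = Some True \<and> digits_match code (length (bits n)) 0 i"
proof
  assume "code = True # bits i"
  then show "read code 0 = Some True \<and> digits_match code (length (bits n)) 0 i"
    by (auto simp: digits_match_def read_def nat_add_distrib)
next
  let ?K = "length (bits n)"
  assume r: "read code 0 = Some True \<and> digits_match code ?K 0 i"
  then have d: "read code (int j + 1) = read (bits i) (int j)" if "j \<le> ?K" for j
    using that by (simp add: digits_match_def)
  have "i < 2 ^ ?K" using assms less_two_power_length_bits[of n] by linarith
  then have short: "read (bits i) (int ?K) = None" by (simp add: read_bits)
  then have "read code (int (Suc ?K)) = None" using d[of ?K] by (simp add: add.commute)
  then have len: "length code \<le> Suc ?K" "length (bits i) \<le> ?K"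
    using short by (simp_all only: read_eq_None_iff)
  show "code = True # bits i"
  proof (rule read_ext)
    fix j
    show "read code (int j) = read (True # bits i) (int j)"
    proof (cases j)
      case 0
      then show ?thesis using r by (simp add: read_def)
    next
      case (Suc j')
      have "read (True # bits i) (int j) = read (bits i) (int j')"
        by (simp add: Suc read_def nat_add_distrib)
      moreover have "read code (int j) = read (bits i) (int j')"
      proof (cases "j' \<le> ?K")
        case True
        then show ?thesis using d[OF True] by (simp add: Suc add.commute)
      next
        case False
        then show ?thesis using len by (simp add: Suc read_def)
      qed
      ultimately show ?thesis by simp
    qed
  qed
qed

lemma accepts_code_correct:
  assumes "\<And>x y. kd = KLeaf x y \<Longrightarrow> lt = (i < n) \<and> ok = digits_match code (length (bits n)) 0 i"
  shows "accepts_code kd lt ok (prefix5 code) \<longleftrightarrow> gate_code (gate_of n g i kd) = code"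
proof (cases kd)
  case (KLeaf x y)
  show ?thesis
  proof (cases "if lt then x else Some y")
    case None
    then have "lt" "x = None" by (auto split: if_splits)
    then show ?thesis
      using assms[OF KLeaf] digits_match_end[of i n code] KLeaf by (auto simp: prefix5_def)
  next
    case (Some b)
    then have "gate_of n g i kd = GConst b" using assms[OF KLeaf] KLeaf by simp
    then show ?thesis using Some KLeaf by (auto simp: prefix5_eq_iff)
  qed
qed (auto simp: prefix5_eq_iff)

lemma read_before: "read w (- 1) = None"
  by (simp add: read_def)

lemma read_level:
  assumes "k \<le> length (bits n)"
  shows "read (bits n) (int k - 1) = (if k = 0 then None else Some (odd (n div 2 ^ (k - 1))))"
proof (cases k)
  case 0
  then show ?thesis by (simp add: read_def)
next
  case (Suc m)
  then have "read (bits n) (int m) \<noteq> None" using assms by (simp add: read_eq_None_iff)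
  then show ?thesis using Suc by (simp add: read_bits split: if_splits)
qed

text \<open>Lexicographic comparison: the leading digits decide, and the new digit matters only
  after a tie.\<close>

lemma div_level:
  fixes i n :: nat
  assumes "0 < k"
  shows "2 * i + of_bool b < n div 2 ^ (k - 1) \<longleftrightarrow>
      i < n div 2 ^ k \<or> i = n div 2 ^ k \<and> \<not> b \<and> odd (n div 2 ^ (k - 1))"
    and "2 * i + of_bool b = n div 2 ^ (k - 1) \<longleftrightarrow> i = n div 2 ^ k \<and> b = odd (n div 2 ^ (k - 1))"
proof -
  obtain m where m: "k = Suc m" using assms by (cases k) auto
  define y where "y = n div 2 ^ m"
  have "n div 2 ^ k = y div 2" by (simp add: m y_def mult.commute flip: div_mult2_eq)
  moreover have "2 * i + of_bool b < y \<longleftrightarrow> i < y div 2 \<or> i = y div 2 \<and> \<not> b \<and> odd y"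
    by (cases b) (simp only: of_bool_eq, presburger)+
  moreover have "2 * i + of_bool b = y \<longleftrightarrow> i = y div 2 \<and> b = odd y"
    by (cases b) (simp only: of_bool_eq, presburger)+
  ultimately show "2 * i + of_bool b < n div 2 ^ (k - 1) \<longleftrightarrow>
      i < n div 2 ^ k \<or> i = n div 2 ^ k \<and> \<not> b \<and> odd (n div 2 ^ (k - 1))"
    "2 * i + of_bool b = n div 2 ^ (k - 1) \<longleftrightarrow> i = n div 2 ^ k \<and> b = odd (n div 2 ^ (k - 1))"
    by (simp_all add: m y_def)
qed

context bounded_tree_family
begin

text \<open>The first five symbols of the code are read in advance, since they distinguish all codes but
  those of inputs.  Then the first and the last head move to the end of the number \<open>n\<close>, whose digits
  they meet again from the most significant one on while the second head follows the path.\<close>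

fun gate_reader :: "'q gate_state reader" where
  "gate_reader (Pre l) ss =
     (if length l < 5 then (Inl (Pre (l @ [ss ! 2])), [0, 0, 1])
      else if length l < 10 then (Inl (Pre (l @ [ss ! 2])), [0, 0, -1])
      else (Inl (Sweep (take 5 l)), [0, 0, 0]))"
| "gate_reader (Sweep l) ss =
     (if ss ! 0 \<noteq> None then (Inl (Sweep l), [1, 0, 1]) else (Inl (Turn l), [0, 0, 1]))"
| "gate_reader (Turn l) ss = (Inl (Walking q\<^sub>0 False False True (ss ! 2 = None) l), [-1, 0, -1])"
| "gate_reader (Walking q nz lt eq ok l) ss =
     (case ss ! 1 of
        None \<Rightarrow> (Inr (accepts_code (kind q (ss ! 0 = None)) lt ok l), [0, 0, 0])
      | Some b \<Rightarrow>
          if \<not> has_pred (kind q (ss ! 0 = None)) b then (Inr False, [0, 0, 0])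
          else (case ss ! 0 of
              Some d \<Rightarrow>
                if lev q
                then (Inl (Walking (nxt q False b) (nz \<or> b) (lt \<or> eq \<and> \<not> b \<and> d) (eq \<and> b = d)
                    (ok \<and> ss ! 2 = (if nz \<or> b then Some b else None)) l), [-1, 1, -1])
                else (Inl (Walking (nxt q False b) nz lt eq ok l), [0, 1, 0])
            | None \<Rightarrow> (Inl (Walking (nxt q True b) nz lt eq ok l), [0, 1, 0])))"

definition gate_states :: "'q gate_state set" where
  "gate_states =
     Pre ` {l. length l \<le> 10} \<union> Sweep ` {l. length l \<le> 10} \<union> Turn ` {l. length l \<le> 10} \<union>
     (\<lambda>(q, nz, lt, eq, ok, l). Walking q nz lt eq ok l) `
       (Q \<times> UNIV \<times> UNIV \<times> UNIV \<times> UNIV \<times> {l. length l \<le> 10})"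

lemma finite_gate_states: "finite gate_states"
proof -
  have "finite {l :: bool option list. length l \<le> 10}"
    using finite_lists_length_le[of "UNIV :: bool option set" 10] by simp
  then show ?thesis by (simp add: gate_states_def finite_Q)
qed

lemma gate_states_simps:
  "Pre l \<in> gate_states \<longleftrightarrow> length l \<le> 10"
  "Sweep l \<in> gate_states \<longleftrightarrow> length l \<le> 10"
  "Turn l \<in> gate_states \<longleftrightarrow> length l \<le> 10"
  "Walking q nz lt eq ok l \<in> gate_states \<longleftrightarrow> q \<in> Q \<and> length l \<le> 10"
  by (auto simp: gate_states_def image_iff)

lemma gate_reader_wf: "reader_wf 3 gate_states gate_reader"
  unfolding reader_wf_def
proof (intro ballI allI impI)
  fix s and ss :: "bool option list" assume "s \<in> gate_states" "length ss = 3"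
  then show "fst (gate_reader s ss) \<in> Inl ` gate_states \<union> range Inr \<and>
      length (snd (gate_reader s ss)) = 3 \<and> set (snd (gate_reader s ss)) \<subseteq> {-1, 0, 1}"
    by (cases s) (auto simp: gate_states_simps nxt_Q q\<^sub>0_Q split: option.splits intro!: imageI)
qed

text \<open>With \<open>k\<close> levels left, the first head is on digit \<open>k - 1\<close> of
  the input length and the third on cell \<open>k\<close> of the code, which is the place of the
  same digit. At \<open>k = 0\<close> the first head has left its tape on the left and reads a
  blank, so no counter is required.\<close>

lemma gate_reader_walk:
  assumes "k \<le> length (bits n)" "\<And>u. walk (q, k, i) u \<noteq> None \<Longrightarrow> length u \<le> t"
  shows "answers gate_reader [bits n, u @ v, code] (Suc t)
    (Inl (Walking q (i \<noteq> 0) (i < n div 2 ^ k) (i = n div 2 ^ k)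
        (digits_match code (length (bits n)) k i) (prefix5 code)), [int k - 1, int (length u), int k])
    (\<exists>s. walk (q, k, i) v = Some s \<and> gate_code (gate_of n g (snd (snd s)) (kind_at s)) = code)"
  using assms
proof (induction t arbitrary: q k i u v)
  case 0
  show ?case
  proof (cases v)
    case Nil
    have "accepts_code (kind q (k = 0)) (i < n div 2 ^ k) (digits_match code (length (bits n)) k i) (prefix5 code)
        \<longleftrightarrow> gate_code (gate_of n g i (kind q (k = 0))) = code"
      \<comment> \<open>Leaves occur only at \<open>k = 0\<close>, where the flags have become the
        full comparison of \<open>i\<close> with \<open>n\<close> and with the code.\<close>
      by (rule accepts_code_correct) (use leaf[of q] in \<open>cases "k = 0"; simp\<close>)
    then show ?thesis
      using Nil 0(1)
      by (cases "k = 0") (simp_all add: answers_Suc read_all_def read_length answers_Inr read_level read_before kind_at_def)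
  next
    case (Cons b v')
    have "\<not> has_pred (kind q (k = 0)) b"
      using 0(2)[of "[b]"] by (cases "move (q, k, i) b") (auto simp: kind_at_def)
    then show ?thesis
      using 0(1)
      by (cases "k = 0") (simp_all add: Cons answers_Suc read_all_def read_at_length answers_Inr read_level read_before kind_at_def)
  qed
next
  case (Suc t)
  show ?case
  proof (cases v)
    case Nil
    have "accepts_code (kind q (k = 0)) (i < n div 2 ^ k) (digits_match code (length (bits n)) k i) (prefix5 code)
        \<longleftrightarrow> gate_code (gate_of n g i (kind q (k = 0))) = code"
      by (rule accepts_code_correct) (use leaf[of q] in \<open>cases "k = 0"; simp\<close>)
    then show ?thesis
      using Nil Suc.prems(1)
      by (cases "k = 0") (simp_all add: answers_Suc[of _ _ "Suc t"] read_all_def read_length answers_Inr read_level read_before kind_at_def)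
  next
    case (Cons b v')
    obtain q' k' i' where mv: "move (q, k, i) b = (q', k', i')" by (cases "move (q, k, i) b")
    show ?thesis
    proof (cases "has_pred (kind q (k = 0)) b")
      case True
      have "k' \<le> length (bits n)" using mv Suc.prems(1) by (auto simp: move_def split: if_splits)
      moreover have "length u' \<le> t" if "walk (q', k', i') u' \<noteq> None" for u'
        using Suc.prems(2)[of "b # u'"] that True mv by (simp add: kind_at_def)
      ultimately have IH: "answers gate_reader [bits n, (u @ [b]) @ v', code] (Suc t)
        (Inl (Walking q' (i' \<noteq> 0) (i' < n div 2 ^ k') (i' = n div 2 ^ k')
          (digits_match code (length (bits n)) k' i') (prefix5 code)),
          [int k' - 1, int (length (u @ [b])), int k'])
        (\<exists>s. walk (q', k', i') v' = Some s \<and> gate_code (gate_of n g (snd (snd s)) (kind_at s)) = code)"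
        by (rule Suc.IH)
      have "reader_step gate_reader [bits n, u @ v, code] (Inl (Walking q (i \<noteq> 0) (i < n div 2 ^ k) (i = n div 2 ^ k)
          (digits_match code (length (bits n)) k i) (prefix5 code)), [int k - 1, int (length u), int k]) =
        (Inl (Walking q' (i' \<noteq> 0) (i' < n div 2 ^ k') (i' = n div 2 ^ k')
          (digits_match code (length (bits n)) k' i') (prefix5 code)),
          [int k' - 1, int (length (u @ [b])), int k'])"
      proof (cases "lev q \<and> k > 0")
        case False
        then show ?thesis
          using mv True Suc.prems(1)
          by (auto simp: move_def Cons read_all_def read_at_length read_level split: if_splits)
      next
        case lev: True
        then have mv': "q' = nxt q False b" "k' = k - 1" "i' = 2 * i + of_bool b"
          using mv by (auto simp: move_def)
        have "i' \<noteq> 0 \<longleftrightarrow> i \<noteq> 0 \<or> b" by (simp add: mv')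
        moreover have "int k' = int k - 1" using lev by (simp add: mv' of_nat_diff)
        ultimately show ?thesis
          using lev True Suc.prems(1) div_level[of k i b n] digits_match_level[of k "length (bits n)" code i b]
          by (simp add: mv' Cons read_all_def read_at_length read_level del: One_nat_def)
      qed
      then show ?thesis using IH True mv by (simp add: answers_Suc[of _ _ "Suc t"] Cons kind_at_def)
    next
      case False
      then show ?thesis
        using Suc.prems(1)
        by (cases "k = 0") (simp_all add: Cons answers_Suc[of _ _ "Suc t"] read_all_def read_at_length answers_Inr read_level read_before kind_at_def)
    qed
  qed
qed

text \<open>Five steps collect the prefix and five more bring the head back, with the list as step
  counter; the eleventh drops the entries read on the way back.\<close>

lemma gate_reader_pre:
  "answers gate_reader [m, g, code] (t + 11) (Inl (Pre []), [0, 0, 0]) b \<longleftrightarrow>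
   answers gate_reader [m, g, code] t (Inl (Sweep (prefix5 code)), [0, 0, 0]) b"
  by (simp add: answers_Suc eval_nat_numeral read_all_def prefix5_def)

text \<open>The step that discovers the end of the number still advances the third head. It then
  scans the cell for the place just above all digits, which has to be blank in the code of an
  input.\<close>

lemma gate_reader_sweep:
  "d \<le> length m \<Longrightarrow>
   answers gate_reader [m, g, code] (t + Suc d)
     (Inl (Sweep l), [int (length m) - int d, 0, int (length m) - int d]) b \<longleftrightarrow>
   answers gate_reader [m, g, code] t (Inl (Turn l), [int (length m), 0, int (length m) + 1]) b"
proof (induction d)
  case 0
  then show ?case by (simp add: answers_Suc read_all_def read_length)
next
  case (Suc d)
  have "read m (int (length m) - int (Suc d)) \<noteq> None" using Suc.prems by (auto simp: read_def)
  then have "answers gate_reader [m, g, code] (t + Suc (Suc d))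
     (Inl (Sweep l), [int (length m) - int (Suc d), 0, int (length m) - int (Suc d)]) b \<longleftrightarrow>
     answers gate_reader [m, g, code] (t + Suc d)
     (Inl (Sweep l), [int (length m) - int d, 0, int (length m) - int d]) b"
    unfolding add_Suc_right[of t "Suc d"] answers_Suc[of _ _ "t + Suc d"] by (simp add: read_all_def)
  then show ?case using Suc by simp
qed

lemma log_time_gates:
  "log_time_decidable 2 (\<lambda>n ws. \<exists>g k. ws = [g, gate_code k] \<and> circuit n g = Some k)"
proof (rule log_time_decidable_reader)
  show "finite gate_states" by (rule finite_gate_states)
  show "Pre [] \<in> gate_states" by (simp add: gate_states_simps)
  show "reader_wf (Suc 2) gate_states gate_reader" using gate_reader_wf by (simp add: numeral_3_eq_3 numeral_2_eq_2)
  fix n and ws :: "bool list list" assume "length ws = 2"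
  then obtain g code where ws: "ws = [g, code]" by (auto simp: numeral_2_eq_2 length_Suc_conv)
  let ?K = "length (bits n)" and ?t = "2 * c * (floor_log n + 1)"
  let ?ans = "\<exists>s. walk (q\<^sub>0, ?K, 0) g = Some s \<and> gate_code (gate_of n g (snd (snd s)) (kind_at s)) = code"
  \<comment> \<open>Before any digit is read, \<open>i = 0\<close> ties with the empty leading part
    of \<open>n\<close>; hence the flags \<open>False False True\<close>.\<close>
  have "n div 2 ^ ?K = 0" using less_two_power_length_bits[of n] by simp
  then have "answers gate_reader [bits n, g, code] (Suc ?t)
      (Inl (Walking q\<^sub>0 False False True (read code (int ?K + 1) = None) (prefix5 code)),
        [int ?K - 1, 0, int ?K]) ?ans"
    using gate_reader_walk[of ?K n q\<^sub>0 0 ?t "[]" g code g] length_walk[of n]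
    by (simp add: digits_match_start root_def)
  then have "answers gate_reader [bits n, g, code] (Suc (Suc ?t))
      (Inl (Turn (prefix5 code)), [int ?K, 0, int ?K + 1]) ?ans"
    by (subst answers_Suc) (simp add: read_all_def)
  then have "answers gate_reader [bits n, g, code] (Suc (Suc ?t) + Suc ?K)
      (Inl (Sweep (prefix5 code)), [0, 0, 0]) ?ans"
    using gate_reader_sweep[of ?K "bits n" g code "Suc (Suc ?t)"] by simp
  then have run: "answers gate_reader [bits n, g, code] (Suc (Suc ?t) + Suc ?K + 11)
      (Inl (Pre []), [0, 0, 0]) ?ans"
    by (simp only: gate_reader_pre)
  \<comment> \<open>The walk takes at most \<open>?t\<close> steps and the sweep contributes
    \<open>?K\<close>, which is at most \<open>floor_log n + 1\<close>; the remaining 14 steps are a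
    constant.\<close>
  have "Suc (Suc ?t) + Suc ?K + 11 \<le> (2 * c + 15) * (floor_log n + 1)"
    using length_bits_le[of n] by (simp add: algebra_simps)
  then have "answers gate_reader [bits n, g, code] ((2 * c + 15) * (floor_log n + 1))
      (Inl (Pre []), [0, 0, 0]) ?ans"
    by (rule answers_mono[OF run])
  moreover have "(\<exists>g k. ws = [g, gate_code k] \<and> circuit n g = Some k) \<longleftrightarrow> ?ans"
    unfolding ws list.inject circuit_def root_def map_option_eq_Some by blast
  moreover have "replicate (Suc 2) 0 = [0, 0, 0 :: int]" by (simp add: numeral_2_eq_2)
  ultimately show "answers gate_reader (bits n # ws) ((2 * c + 15) * (floor_log n + 1))
      (Inl (Pre []), replicate (Suc 2) 0) (\<exists>g k. ws = [g, gate_code k] \<and> circuit n g = Some k)"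
    unfolding ws by (simp only:)
qed

lemma uniform_circuit: "uniform circuit"
  unfolding uniform_def using log_time_gates log_time_paths by blast

end

section \<open>Regular languages are in NC1\<close>

text \<open>\<open>gate_val\<close> is a relation. Uniqueness turns a derived value
  \<open>False\<close> into the absence of the value \<open>True\<close>, as the definition of the
  class requires.\<close>

lemma gate_val_unique:
  assumes "gate_val C w g b" "gate_val C w g b'"
  shows "b = b'"
  using assms
proof (induction arbitrary: b' rule: gate_val.induct)
  case (1 g i)
  from 1(3,1,2) show ?case by (cases rule: gate_val.cases) auto
next
  case (2 g b)
  from 2(2,1) show ?case by (cases rule: gate_val.cases) auto
next
  case (3 g h b)
  from 3(4,1,3) show ?case by (cases rule: gate_val.cases) auto
next
  case (4 g h h' b1 b2)
  from 4(6,1,4,5) show ?case by (cases rule: gate_val.cases) auto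
next
  case (5 g h h' b1 b2)
  from 5(6,1,4,5) show ?case by (cases rule: gate_val.cases) auto
qed

context bounded_tree_family
begin

lemma in_NC1:
  assumes "\<And>w. \<exists>b. gate_val (circuit (length w)) w [] b \<and> (b \<longleftrightarrow> w \<in> L)"
  shows "in_NC1 L"
proof -
  \<comment> \<open>One constant has to serve as exponent, as additive term and as factor of the
    depth.\<close>
  define d where "d = 4 ^ (2 * c + 1) + (4 * c + 1)"
  have "card (dom (circuit n)) \<le> n ^ d + d" for n
  proof -
    have "n ^ (4 * c + 1) \<le> n ^ d"
    proof (cases "n = 0")
      case False
      then show ?thesis by (intro power_increasing) (auto simp: d_def)
    qed simp
    moreover have "4 ^ (2 * c + 1) \<le> d" by (simp add: d_def)
    ultimately show ?thesis using card_circuit[of n] by linarith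
  qed
  moreover have "depth_le (circuit n) (d * (floor_log n + 1))" for n
  proof -
    have "2 * c * (floor_log n + 1) \<le> d * (floor_log n + 1)"
      by (intro mult_right_mono) (auto simp: d_def)
    then show ?thesis using depth_circuit[of n] unfolding depth_le_def by (meson order_trans)
  qed
  moreover have "gate_val (circuit n) w [] True \<longleftrightarrow> w \<in> L" if "length w = n" for n w
    using assms[of w] gate_val_unique that by metis
  ultimately show ?thesis unfolding in_NC1_def using uniform_circuit circuit_wf by blast
qed

end

text \<open>The gate \<open>Node s T []\<close> with \<open>k\<close> remaining levels and position \<open>i\<close> tests whether the automaton
  passes from \<open>s\<close> into \<open>T\<close> on the \<open>i\<close>-th block of length \<open>2 ^ k\<close>.  A disjunction over \<open>m\<close> bits,
  collected in the third argument, guesses the state reached in the middle of the block.  Positions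
  beyond the end of the input leave the state unchanged.\<close>

datatype 's node = Node 's "'s set" "bool list" | Negated 's "'s set"

text \<open>\<open>dec\<close> only has to be onto: a state with several codes merely contributes
  the same disjunct repeatedly.\<close>

locale automaton =
  fixes \<delta> :: "'s \<Rightarrow> bool \<Rightarrow> 's" and S :: "'s set" and s\<^sub>0 :: 's and F :: "'s set"
    and m :: nat and dec :: "bool list \<Rightarrow> 's"
  assumes finite_S: "finite S" and s\<^sub>0_S: "s\<^sub>0 \<in> S" and \<delta>_S: "\<And>s b. s \<in> S \<Longrightarrow> \<delta> s b \<in> S"
    and dec: "dec ` {u. length u = m} = S"
begin

text \<open>A right half inherits the target of its block, and a left half aims at one guessed
  state, so no other sets arise.\<close>

definition targets :: "'s set set" where
  "targets = insert F ((\<lambda>s. {s}) ` S)"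

definition nodes :: "'s node set" where
  "nodes = (\<lambda>(s, T, u). Node s T u) ` (S \<times> targets \<times> {u. length u \<le> m}) \<union>
     (\<lambda>(s, T). Negated s T) ` (S \<times> targets)"

text \<open>At a conjunction \<open>False\<close> leads to the left half, which must end exactly in
  the guessed state, and \<open>True\<close> to the right half, which starts there. The same bit is
  the next digit of the position.\<close>

fun node_next :: "'s node \<Rightarrow> bool \<Rightarrow> bool \<Rightarrow> 's node" where
  "node_next (Node s T u) z b =
     (if z then Negated s T
      else if length u < m then Node s T (u @ [b])
      else if b then Node (dec u) T [] else Node s {dec u} [])"
| "node_next (Negated s T) z b = Negated s T"

fun node_level :: "'s node \<Rightarrow> bool" where
  "node_level (Node s T u) \<longleftrightarrow> \<not> length u < m"
| "node_level (Negated s T) \<longleftrightarrow> False"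

text \<open>On a single letter, membership in \<open>T\<close> is a Boolean function of one bit: a
  constant, the bit or its negation. Beyond the end the state stays \<open>s\<close>; below a
  negation this default is inverted as well.\<close>

fun node_kind :: "'s node \<Rightarrow> bool \<Rightarrow> kind" where
  "node_kind (Node s T u) z =
     (if \<not> z then (if length u < m then KOr else KAnd)
      else if \<delta> s True \<in> T \<longleftrightarrow> \<delta> s False \<in> T then KLeaf (Some (\<delta> s True \<in> T)) (s \<in> T)
      else if \<delta> s True \<in> T then KLeaf None (s \<in> T)
      else KNot)"
| "node_kind (Negated s T) z = (if z then KLeaf None (s \<notin> T) else KNot)"

sublocale tree: tree_family nodes "Node s\<^sub>0 F []" node_next node_level node_kind "m + 1" .

lemma dec_S: "length u = m \<Longrightarrow> dec u \<in> S"
  using dec by blast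

lemma walk_Negated: "tree.walk (Negated s T, 0, i) g \<noteq> None \<Longrightarrow> g = []"
  by (cases g) (auto simp: tree.kind_at_def)

lemma walk_Node_0: "tree.walk (Node s T u, 0, i) g \<noteq> None \<Longrightarrow> length g \<le> 1"
  using walk_Negated[of s T i "tl g"]
  by (cases g) (auto simp: tree.kind_at_def tree.move_def split: if_splits)

text \<open>A level costs \<open>m\<close> guessed bits and one bit for the choice of a half; at the
  bottom there may be one negation. The bits in \<open>u\<close> are already spent.\<close>

lemma walk_Node:
  "tree.walk (Node s T u, k, i) g \<noteq> None \<Longrightarrow> 0 < k \<Longrightarrow> length u \<le> m \<Longrightarrow>
    length g + length u \<le> k * (m + 1) + 1"
proof (induction g arbitrary: s T u k i)
  case Nil
  have "1 * (m + 1) \<le> k * (m + 1)" using Nil by (intro mult_right_mono) auto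
  then show ?case using Nil by simp
next
  case (Cons b g)
  show ?case
  proof (cases "length u < m")
    case True
    then show ?thesis
      using Cons.IH[of s T "u @ [b]" k i] Cons.prems by (simp add: tree.kind_at_def tree.move_def)
  next
    case False
    then obtain s' T' i' where s': "tree.walk (Node s' T' [], k - 1, i') g \<noteq> None"
    proof (cases b)
      case True
      then show ?thesis
        using Cons.prems False by (intro that[of "dec u" T "2 * i + 1"]) (simp add: tree.kind_at_def tree.move_def)
    next
      case F: False
      then show ?thesis
        using Cons.prems False by (intro that[of s "{dec u}" "2 * i"]) (simp add: tree.kind_at_def tree.move_def)
    qed
    have "length g \<le> (k - 1) * (m + 1) + 1"
    proof (cases "k - 1 = 0")
      case True
      then show ?thesis using walk_Node_0 s' by fastforce
    next
      case False
      then show ?thesis using Cons.IH[OF s'] by simp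
    qed
    moreover have "k * (m + 1) = (k - 1) * (m + 1) + (m + 1)"
      using Cons.prems(2) by (cases k) auto
    ultimately show ?thesis using Cons.prems(3) by simp
  qed
qed

sublocale tree: bounded_tree_family nodes "Node s\<^sub>0 F []" node_next node_level node_kind "m + 1"
proof
  have "finite {u :: bool list. length u \<le> m}"
    using finite_lists_length_le[of "UNIV :: bool set" m] by simp
  then show "finite nodes" using finite_S by (simp add: nodes_def targets_def)
  have nodes: "Node s T u \<in> nodes \<longleftrightarrow> s \<in> S \<and> T \<in> targets \<and> length u \<le> m"
    "Negated s T \<in> nodes \<longleftrightarrow> s \<in> S \<and> T \<in> targets" for s T u
    by (auto simp: nodes_def image_iff)
  show "Node s\<^sub>0 F [] \<in> nodes" using s\<^sub>0_S by (simp add: nodes targets_def)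
  show "node_next q z b \<in> nodes" if "q \<in> nodes" for q z b
    using that by (cases q) (auto simp: nodes dec_S targets_def)
  show "node_kind q False \<noteq> KLeaf x y" for q x y by (cases q) auto
  show "length g \<le> (m + 1) * (k + 1)" if "tree.walk (Node s\<^sub>0 F [], k, 0) g \<noteq> None" for k g
  proof (cases "k = 0")
    case True
    then show ?thesis using walk_Node_0 that by fastforce
  next
    case False
    then show ?thesis using walk_Node[OF that] by (simp add: algebra_simps)
  qed
qed

section \<open>Values of the gates\<close>

definition pad_step :: "bool list \<Rightarrow> 's \<Rightarrow> nat \<Rightarrow> 's" where
  "pad_step w s j = (if j < length w then \<delta> s (w ! j) else s)"

definition block :: "bool list \<Rightarrow> nat \<Rightarrow> nat \<Rightarrow> 's \<Rightarrow> 's" where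
  "block w k i s = foldl (pad_step w) s [i * 2 ^ k ..< (i + 1) * 2 ^ k]"

lemma block_0: "block w 0 i s = pad_step w s i"
  by (simp add: block_def)

lemma block_Suc: "block w (Suc k) i s = block w k (2 * i + 1) (block w k (2 * i) s)"
proof -
  have "[i * 2 ^ Suc k ..< (i + 1) * 2 ^ Suc k] =
      [2 * i * 2 ^ k ..< (2 * i + 1) * 2 ^ k] @ [(2 * i + 1) * 2 ^ k ..< (2 * i + 1 + 1) * 2 ^ k]"
    using upt_add_eq_append[of "2 * i * 2 ^ k" "(2 * i + 1) * 2 ^ k" "2 ^ k"]
    by (simp add: algebra_simps)
  then show ?thesis by (simp add: block_def)
qed

lemma block_S: "s \<in> S \<Longrightarrow> block w k i s \<in> S"
proof -
  have "foldl (pad_step w) s js \<in> S" if "s \<in> S" for js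
    using that by (induction js arbitrary: s) (auto simp: pad_step_def \<delta>_S)
  then show "s \<in> S \<Longrightarrow> block w k i s \<in> S" by (simp add: block_def)
qed

lemma block_word:
  assumes "length w \<le> 2 ^ k"
  shows "block w k 0 s = foldl \<delta> s w"
proof -
  have "foldl (pad_step w) s [0..<n] = foldl \<delta> s (take n w)" for n
    by (induction n) (auto simp: pad_step_def take_Suc_conv_app_nth)
  then show ?thesis using assms by (simp add: block_def)
qed

lemma gate_val_Node_0:
  assumes "tree.walk (tree.root (length w)) g = Some (Node s T [], 0, i)"
  shows "gate_val (tree.circuit (length w)) w g (block w 0 i s \<in> T)"
proof -
  let ?n = "length w"
  have C: "tree.circuit ?n g = Some (gate_of ?n g i (node_kind (Node s T []) True))"
    using tree.circuit_Some[OF assms] by (simp add: tree.kind_at_def)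
  consider (const) "\<delta> s True \<in> T \<longleftrightarrow> \<delta> s False \<in> T" | (pos) "\<delta> s True \<in> T" "\<delta> s False \<notin> T"
    | (neg) "\<delta> s True \<notin> T" "\<delta> s False \<in> T" by blast
  then show ?thesis
  proof cases
    case const
    then have "tree.circuit ?n g = Some (GConst (block w 0 i s \<in> T))"
      using C by (cases "i < ?n"; cases "w ! i") (auto simp: block_0 pad_step_def)
    then show ?thesis by (rule gate_val.intros)
  next
    case pos
    show ?thesis
    proof (cases "i < ?n")
      case True
      then have "tree.circuit ?n g = Some (GInput i)" using C pos by simp
      then have "gate_val (tree.circuit ?n) w g (w ! i)" using True by (rule gate_val.intros)
      moreover have "block w 0 i s \<in> T \<longleftrightarrow> w ! i"
        using True pos by (cases "w ! i") (auto simp: block_0 pad_step_def)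
      ultimately show ?thesis by simp
    next
      case False
      then have "tree.circuit ?n g = Some (GConst (block w 0 i s \<in> T))"
        using C pos by (simp add: block_0 pad_step_def)
      then show ?thesis by (rule gate_val.intros)
    qed
  next
    case neg
    then have Cg: "tree.circuit ?n g = Some (GNot (g @ [False]))" using C by simp
    have "tree.walk (tree.root ?n) (g @ [False]) = Some (Negated s T, 0, i)"
      using assms neg by (simp add: tree.walk_append tree.kind_at_def tree.move_def)
    from tree.circuit_Some[OF this] have C': "tree.circuit ?n (g @ [False]) =
        Some (gate_of ?n (g @ [False]) i (KLeaf None (s \<notin> T)))"
      by (simp add: tree.kind_at_def)
    have "gate_val (tree.circuit ?n) w (g @ [False]) (block w 0 i s \<notin> T)"
    proof (cases "i < ?n")
      case True
      then have "tree.circuit ?n (g @ [False]) = Some (GInput i)" using C' by simp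
      then have "gate_val (tree.circuit ?n) w (g @ [False]) (w ! i)" using True by (rule gate_val.intros)
      moreover have "block w 0 i s \<notin> T \<longleftrightarrow> w ! i"
        using True neg by (cases "w ! i") (auto simp: block_0 pad_step_def)
      ultimately show ?thesis by simp
    next
      case False
      then have "tree.circuit ?n (g @ [False]) = Some (GConst (block w 0 i s \<notin> T))"
        using C' by (simp add: block_0 pad_step_def)
      then show ?thesis by (rule gate_val.intros)
    qed
    from gate_val.intros(3)[OF Cg this] show ?thesis by simp
  qed
qed

text \<open>The induction on levels is general in \<open>s\<close> and \<open>T\<close>, because the
  halves start from and aim at guessed states.\<close>

lemma gate_val_Node:
  assumes "tree.walk (tree.root (length w)) g = Some (Node s T [], k, i)" "s \<in> S"
  shows "gate_val (tree.circuit (length w)) w g (block w k i s \<in> T)"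
  using assms
proof (induction k arbitrary: g s T i)
  case 0
  then show ?case by (intro gate_val_Node_0)
next
  case (Suc k)
  let ?C = "tree.circuit (length w)" and ?walk = "tree.walk (tree.root (length w))"
  let ?good = "\<lambda>r. block w k (2 * i) s = r \<and> block w k (2 * i + 1) r \<in> T"
  \<comment> \<open>An inner induction on the number \<open>d\<close> of bits still to be guessed
    unfolds the tree of disjunctions.\<close>
  have guess: "gate_val ?C w g (\<exists>v. length v = d \<and> ?good (dec (u @ v)))"
    if "?walk g = Some (Node s T u, Suc k, i)" "length u + d = m" for d u g
    using that
  proof (induction d arbitrary: u g)
    case 0
    have C: "?C g = Some (GAnd (g @ [False]) (g @ [True]))"
      using tree.circuit_Some[OF 0(1)] 0(2) by (simp add: tree.kind_at_def)
    have left: "?walk (g @ [False]) = Some (Node s {dec u} [], k, 2 * i)"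
      and right: "?walk (g @ [True]) = Some (Node (dec u) T [], k, 2 * i + 1)"
      using 0 by (simp_all add: tree.walk_append tree.kind_at_def tree.move_def)
    have "gate_val ?C w (g @ [False]) (block w k (2 * i) s \<in> {dec u})"
      by (rule Suc.IH[OF left Suc.prems(2)])
    moreover have "gate_val ?C w (g @ [True]) (block w k (2 * i + 1) (dec u) \<in> T)"
      by (rule Suc.IH[OF right dec_S]) (use 0 in simp)
    ultimately have "gate_val ?C w (g @ [False]) (block w k (2 * i) s \<in> {dec u})"
      "gate_val ?C w (g @ [True]) (block w k (2 * i + 1) (dec u) \<in> T)" .
    from gate_val.intros(4)[OF C this] show ?case by simp
  next
    case (Suc d)
    have C: "?C g = Some (GOr (g @ [False]) (g @ [True]))"
      using tree.circuit_Some[OF Suc.prems(1)] Suc.prems(2) by (simp add: tree.kind_at_def)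
    have "?walk (g @ [b]) = Some (Node s T (u @ [b]), Suc k, i)" for b
      using Suc.prems by (simp add: tree.walk_append tree.kind_at_def tree.move_def)
    then have "gate_val ?C w (g @ [b]) (\<exists>v. length v = d \<and> ?good (dec ((u @ [b]) @ v)))" for b
      using Suc.prems(2) by (intro Suc.IH) auto
    from gate_val.intros(5)[OF C this this]
    have "gate_val ?C w g ((\<exists>v. length v = d \<and> ?good (dec (u @ False # v))) \<or>
        (\<exists>v. length v = d \<and> ?good (dec (u @ True # v))))" by simp
    moreover have "(\<exists>v. length v = Suc d \<and> P v) \<longleftrightarrow>
        (\<exists>v. length v = d \<and> P (False # v)) \<or> (\<exists>v. length v = d \<and> P (True # v))" for P :: "bool list \<Rightarrow> bool"
      by (auto simp: length_Suc_conv) (metis (full_types))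
    ultimately show ?case by simp
  qed
  have "(\<exists>v. length v = m \<and> ?good (dec v)) \<longleftrightarrow> block w (Suc k) i s \<in> T"
  proof -
    \<comment> \<open>The state actually reached in the middle lies in \<open>S\<close>, so some
      guess names it.\<close>
    have "block w k (2 * i) s \<in> dec ` {v. length v = m}" using block_S[OF Suc.prems(2)] dec by simp
    then show ?thesis unfolding block_Suc by auto
  qed
  then show ?case using guess[OF Suc.prems(1), of m] by simp
qed

theorem in_NC1: "in_NC1 {w. foldl \<delta> s\<^sub>0 w \<in> F}"
proof (rule tree.in_NC1)
  fix w :: "bool list"
  have "gate_val (tree.circuit (length w)) w [] (block w (length (bits (length w))) 0 s\<^sub>0 \<in> F)"
    by (rule gate_val_Node) (simp_all add: tree.root_def s\<^sub>0_S)
  moreover have "block w (length (bits (length w))) 0 s\<^sub>0 = foldl \<delta> s\<^sub>0 w"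
    by (rule block_word) (simp add: less_imp_le less_two_power_length_bits)
  ultimately show "\<exists>b. gate_val (tree.circuit (length w)) w [] b \<and> (b \<longleftrightarrow> w \<in> {w. foldl \<delta> s\<^sub>0 w \<in> F})"
    by auto
qed

end

theorem regular_in_NC1:
  fixes \<delta> :: "'s \<Rightarrow> bool \<Rightarrow> 's"
  assumes "finite S" "s\<^sub>0 \<in> S" "\<And>s b. s \<in> S \<Longrightarrow> \<delta> s b \<in> S"
  shows "in_NC1 {w. foldl \<delta> s\<^sub>0 w \<in> F}"
proof -
  let ?B = "{u :: bool list. length u = card S}"
  have B: "finite ?B" "card ?B = 2 ^ card S"
    using finite_lists_length_eq[of "UNIV :: bool set" "card S"] card_lists_length_eq[of "UNIV :: bool set" "card S"]
    by simp_all
  \<comment> \<open>As many bits as there are states are enough, since a number is less than two to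
    its power.\<close>
  then have "card S \<le> card ?B" by (simp add: less_imp_le)
  then obtain f where f: "f ` S \<subseteq> ?B" "inj_on f S" using card_le_inj[OF assms(1) B(1)] by blast
  \<comment> \<open>Words that code no state are sent to the initial state, which keeps the range of
    \<open>dec\<close> within \<open>S\<close>.\<close>
  define dec where "dec u = (if u \<in> f ` S then inv_into S f u else s\<^sub>0)" for u
  have "dec ` ?B = S"
  proof
    show "dec ` ?B \<subseteq> S" using assms(2) by (auto simp: dec_def inv_into_into)
    show "S \<subseteq> dec ` ?B"
    proof
      fix s assume "s \<in> S"
      then have "dec (f s) = s" "f s \<in> ?B" using f by (auto simp: dec_def)
      then show "s \<in> dec ` ?B" by (metis imageI)
    qed
  qed
  then interpret automaton \<delta> S s\<^sub>0 F "card S" dec using assms by unfold_locales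
  show ?thesis by (rule in_NC1)
qed

theorem theorem8:
  fixes q :: omiq
  assumes "ltl_box_next_bool_omiq q"
  shows "fo_rpr_rewritable q \<and> mso_rewritable q \<and> answering_in_NC1 q"
proof -
  obtain Ont \<kappa> where q: "q = (Ont, \<kappa>)" by (cases q)
  then obtain \<Phi> where \<Phi>: "finite \<Phi>" "covers \<Phi> Ont" "\<kappa> \<in> \<Phi>"
    using assms finite_cover[of Ont \<kappa>] by (auto simp: ltl_box_next_bool_omiq_def)
  have "in_NC1 (answering_problem S q)" for S
  proof -
    obtain \<delta> :: "answer_state \<Rightarrow> bool \<Rightarrow> answer_state" and Q s F where
      "finite Q" "s \<in> Q" "\<And>r b. r \<in> Q \<Longrightarrow> \<delta> r b \<in> Q"
      and "answering_problem S (Ont, \<kappa>) = {w. foldl \<delta> s w \<in> F}"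
      using answering_problem_regular[OF \<Phi>(2,3,1), of S] by blast
    then show ?thesis using regular_in_NC1[of Q s \<delta> F] by (simp add: q)
  qed
  then show ?thesis
    using fo_rpr_rewritable[OF \<Phi>(2,3,1)] mso_rewritable[OF \<Phi>(2,3,1)]
    by (simp add: answering_in_NC1_def q)
qed

end
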